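(* Let $\mathcal B$ be a Krull–Schmidt exact category with enough projectives and enough injectives, and let $(\mathcal S,\mathcal T),(\mathcal U,\mathcal V)$ be a twin cotorsion pair on $\mathcal B$. Then its heart $\underline{\mathcal H}=\mathcal H/\mathcal W$ is semi-abelian.
   Context: Exact category is meant in the sense of Quillen (the class of short exact sequences is closed under isomorphisms, direct sums and direct summands); $X\rightarrowtail Y\twoheadrightarrow Z$ denotes a short exact sequence of the exact structure. For subcategories $\mathcal C,\mathcal D$, $\mathrm{Ext}^1_{\mathcal B}(\mathcal C,\mathcal D)=0$ means $\mathrm{Ext}^1_{\mathcal B}(C,D)=0$ for all $C\in\mathcal C$, $D\in\mathcal D$. Cotorsion pair: a pair $(\mathcal U,\mathcal V)$ of full additive subcategories of $\mathcal B$, closed under direct summands, such that $\mathrm{Ext}^1_{\mathcal B}(\mathcal U,\mathcal V)=0$ and every $B\in\mathcal B$ admits short exact sequences $V_B\rightarrowtail U_B\twoheadrightarrow B$ and $B\rightarrowtail V^B\twoheadrightarrow U^B$ with $U_B,U^B\in\mathcal U$, $V_B,V^B\in\mathcal V$. Twin cotorsion pair: a pair of cotorsion pairs $(\mathcal S,\mathcal T),(\mathcal U,\mathcal V)$ with $\mathcal S\subseteq\mathcal U$. For a twin cotorsion pair put $\mathcal W=\mathcal T\cap\mathcal U$. $\mathcal B^+$ is the full subcategory of objects $B$ admitting a short exact sequence $V_B\rightarrowtail U_B\twoheadrightarrow B$ with $U_B\in\mathcal W$, $V_B\in\mathcal V$. $\mathcal B^-$ is the full subcategory of objects $B$ admitting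 a short exact sequence $B\rightarrowtail T^B\twoheadrightarrow S^B$ with $T^B\in\mathcal W$, $S^B\in\mathcal S$. Put $\mathcal H=\mathcal B^+\cap\mathcal B^-\supseteq\mathcal W$. The heart is the additive quotient category $\underline{\mathcal H}=\mathcal H/\mathcal W$ (morphisms modulo those factoring through an object of $\mathcal W$). Preabelian: additive with all kernels and cokernels. A morphism is called a cokernel (kernel) if it is a cokernel (kernel) of some morphism. A preabelian category is left semi-abelian if in every pull-back square with $\alpha:A\to B$, $\beta:A\to C$, $\gamma:B\to D$, $\delta:C\to D$, $\gamma\alpha=\delta\beta$, the morphism $\alpha$ is an epimorphism whenever $\delta$ is a cokernel. Right semi-abelian is defined dually; semi-abelian means both left and right semi-abelian. *)

theory Defs
  imports "HOL-Algebra.Ring" "HOL-Algebra.Coset"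
begin

section \<open>Categories enriched in abelian groups\<close>

text \<open>
  \<^term>\<open>Add\<close> and \<^term>\<open>Zero\<close> are the addition and the zero morphisms of the hom-groups.
  The operations are meaningful only on composable (respectively parallel) morphisms.
\<close>

record ('o, 'm) addcat =
  Obj :: "'o set"
  Arr :: "'m set"
  Dom :: "'m \<Rightarrow> 'o"
  Cod :: "'m \<Rightarrow> 'o"
  Id :: "'o \<Rightarrow> 'm"
  Comp :: "'m \<Rightarrow> 'm \<Rightarrow> 'm"  (infixl \<open>\<cdot>\<index>\<close> 70)
  Zero :: "'o \<Rightarrow> 'o \<Rightarrow> 'm"
  Add :: "'m \<Rightarrow> 'm \<Rightarrow> 'm"  (infixl \<open>\<boxplus>\<index>\<close> 65)

definition Hom :: "('o, 'm) addcat \<Rightarrow> 'o \<Rightarrow> 'o \<Rightarrow> 'm set" where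
  "Hom C X Y = {f \<in> Arr C. Dom C f = X \<and> Cod C f = Y}"

definition hom_group :: "('o, 'm) addcat \<Rightarrow> 'o \<Rightarrow> 'o \<Rightarrow> 'm monoid" where
  "hom_group C X Y = \<lparr>carrier = Hom C X Y, monoid.mult = Add C, one = Zero C X Y\<rparr>"

definition end_ring :: "('o, 'm) addcat \<Rightarrow> 'o \<Rightarrow> 'm ring" where
  "end_ring C X = \<lparr>carrier = Hom C X X, monoid.mult = Comp C, one = Id C X,
     zero = Zero C X X, add = Add C\<rparr>"

locale category =
  fixes C :: "('o, 'm) addcat" (structure)
  assumes Dom_Obj: "f \<in> Arr C \<Longrightarrow> Dom C f \<in> Obj C"
    and Cod_Obj: "f \<in> Arr C \<Longrightarrow> Cod C f \<in> Obj C"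
    and Id_Hom: "X \<in> Obj C \<Longrightarrow> Id C X \<in> Hom C X X"
    and Comp_Hom: "\<lbrakk>f \<in> Hom C X Y; g \<in> Hom C Y Z\<rbrakk> \<Longrightarrow> g \<cdot> f \<in> Hom C X Z"
    and Comp_assoc: "\<lbrakk>f \<in> Hom C W X; g \<in> Hom C X Y; h \<in> Hom C Y Z\<rbrakk>
      \<Longrightarrow> h \<cdot> (g \<cdot> f) = (h \<cdot> g) \<cdot> f"
    and Comp_Id_right: "f \<in> Hom C X Y \<Longrightarrow> f \<cdot> Id C X = f"
    and Comp_Id_left: "f \<in> Hom C X Y \<Longrightarrow> Id C Y \<cdot> f = f"

locale preadditive_category = category +
  assumes hom_comm_group: "\<lbrakk>X \<in> Obj C; Y \<in> Obj C\<rbrakk> \<Longrightarrow> comm_group (hom_group C X Y)"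
    and Comp_Add_right: "\<lbrakk>f \<in> Hom C X Y; f' \<in> Hom C X Y; g \<in> Hom C Y Z\<rbrakk>
      \<Longrightarrow> g \<cdot> (f \<boxplus> f') = (g \<cdot> f) \<boxplus> (g \<cdot> f')"
    and Comp_Add_left: "\<lbrakk>f \<in> Hom C X Y; g \<in> Hom C Y Z; g' \<in> Hom C Y Z\<rbrakk>
      \<Longrightarrow> (g \<boxplus> g') \<cdot> f = (g \<cdot> f) \<boxplus> (g' \<cdot> f)"

definition zero_object :: "('o, 'm) addcat \<Rightarrow> 'o \<Rightarrow> bool" where
  "zero_object C N \<longleftrightarrow> N \<in> Obj C \<and>
     (\<forall>X\<in>Obj C. (\<exists>!f. f \<in> Hom C N X) \<and> (\<exists>!f. f \<in> Hom C X N))"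

definition is_biproduct ::
  "('o, 'm) addcat \<Rightarrow> 'o \<Rightarrow> 'o \<Rightarrow> 'o \<Rightarrow> 'm \<Rightarrow> 'm \<Rightarrow> 'm \<Rightarrow> 'm \<Rightarrow> bool" where
  "is_biproduct C X1 X2 X i1 i2 p1 p2 \<longleftrightarrow>
     i1 \<in> Hom C X1 X \<and> i2 \<in> Hom C X2 X \<and> p1 \<in> Hom C X X1 \<and> p2 \<in> Hom C X X2 \<and>
     p1 \<cdot>\<^bsub>C\<^esub> i1 = Id C X1 \<and> p2 \<cdot>\<^bsub>C\<^esub> i2 = Id C X2 \<and>
     p1 \<cdot>\<^bsub>C\<^esub> i2 = Zero C X2 X1 \<and> p2 \<cdot>\<^bsub>C\<^esub> i1 = Zero C X1 X2 \<and>
     (i1 \<cdot>\<^bsub>C\<^esub> p1) \<boxplus>\<^bsub>C\<^esub> (i2 \<cdot>\<^bsub>C\<^esub> p2) = Id C X"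

locale additive_category = preadditive_category +
  assumes ex_zero_object: "\<exists>N. zero_object C N"
    and ex_biproduct: "\<lbrakk>X1 \<in> Obj C; X2 \<in> Obj C\<rbrakk>
      \<Longrightarrow> \<exists>X i1 i2 p1 p2. is_biproduct C X1 X2 X i1 i2 p1 p2"

text \<open>For \<open>n = 0\<close> the condition says that \<open>X\<close> is a zero object.\<close>

definition is_finite_direct_sum ::
  "('o, 'm) addcat \<Rightarrow> nat \<Rightarrow> (nat \<Rightarrow> 'o) \<Rightarrow> 'o \<Rightarrow> bool" where
  "is_finite_direct_sum C n Xs X \<longleftrightarrow> (\<exists>i p.
     (\<forall>k<n. i k \<in> Hom C (Xs k) X \<and> p k \<in> Hom C X (Xs k)) \<and>
     (\<forall>k<n. \<forall>l<n. p k \<cdot>\<^bsub>C\<^esub> i l = (if k = l then Id C (Xs k) else Zero C (Xs l) (Xs k))) \<and>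
     finprod (hom_group C X X) (\<lambda>k. i k \<cdot>\<^bsub>C\<^esub> p k) {..<n} = Id C X)"

text \<open>Noncommutative local rings.\<close>

definition local_ring :: "('a, 'b) ring_scheme \<Rightarrow> bool" where
  "local_ring R \<longleftrightarrow> ring R \<and> \<one>\<^bsub>R\<^esub> \<noteq> \<zero>\<^bsub>R\<^esub> \<and>
     (\<forall>a\<in>carrier R - Units R. \<forall>b\<in>carrier R - Units R. a \<oplus>\<^bsub>R\<^esub> b \<notin> Units R)"

definition krull_schmidt :: "('o, 'm) addcat \<Rightarrow> bool" where
  "krull_schmidt C \<longleftrightarrow> additive_category C \<and>
     (\<forall>X\<in>Obj C. \<exists>n Xs. (\<forall>k<n. Xs k \<in> Obj C \<and> local_ring (end_ring C (Xs k))) \<and>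
        is_finite_direct_sum C n Xs X)"


section \<open>Limits and special morphisms\<close>

definition is_iso :: "('o, 'm) addcat \<Rightarrow> 'm \<Rightarrow> bool" where
  "is_iso C f \<longleftrightarrow> f \<in> Arr C \<and> (\<exists>g\<in>Hom C (Cod C f) (Dom C f).
     g \<cdot>\<^bsub>C\<^esub> f = Id C (Dom C f) \<and> f \<cdot>\<^bsub>C\<^esub> g = Id C (Cod C f))"

definition is_mono :: "('o, 'm) addcat \<Rightarrow> 'm \<Rightarrow> bool" where
  "is_mono C f \<longleftrightarrow> f \<in> Arr C \<and> (\<forall>T. \<forall>u\<in>Hom C T (Dom C f). \<forall>v\<in>Hom C T (Dom C f).
     f \<cdot>\<^bsub>C\<^esub> u = f \<cdot>\<^bsub>C\<^esub> v \<longrightarrow> u = v)"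

definition is_epi :: "('o, 'm) addcat \<Rightarrow> 'm \<Rightarrow> bool" where
  "is_epi C f \<longleftrightarrow> f \<in> Arr C \<and> (\<forall>T. \<forall>u\<in>Hom C (Cod C f) T. \<forall>v\<in>Hom C (Cod C f) T.
     u \<cdot>\<^bsub>C\<^esub> f = v \<cdot>\<^bsub>C\<^esub> f \<longrightarrow> u = v)"

definition is_kernel_of :: "('o, 'm) addcat \<Rightarrow> 'm \<Rightarrow> 'm \<Rightarrow> bool" where
  "is_kernel_of C k f \<longleftrightarrow> k \<in> Arr C \<and> f \<in> Arr C \<and> Cod C k = Dom C f \<and>
     f \<cdot>\<^bsub>C\<^esub> k = Zero C (Dom C k) (Cod C f) \<and>
     (\<forall>T. \<forall>u\<in>Hom C T (Dom C f). f \<cdot>\<^bsub>C\<^esub> u = Zero C T (Cod C f) \<longrightarrow>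
        (\<exists>!w. w \<in> Hom C T (Dom C k) \<and> k \<cdot>\<^bsub>C\<^esub> w = u))"

definition is_cokernel_of :: "('o, 'm) addcat \<Rightarrow> 'm \<Rightarrow> 'm \<Rightarrow> bool" where
  "is_cokernel_of C c f \<longleftrightarrow> c \<in> Arr C \<and> f \<in> Arr C \<and> Dom C c = Cod C f \<and>
     c \<cdot>\<^bsub>C\<^esub> f = Zero C (Dom C f) (Cod C c) \<and>
     (\<forall>T. \<forall>u\<in>Hom C (Cod C f) T. u \<cdot>\<^bsub>C\<^esub> f = Zero C (Dom C f) T \<longrightarrow>
        (\<exists>!w. w \<in> Hom C (Cod C c) T \<and> w \<cdot>\<^bsub>C\<^esub> c = u))"

definition is_kernel :: "('o, 'm) addcat \<Rightarrow> 'm \<Rightarrow> bool" where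
  "is_kernel C k \<longleftrightarrow> (\<exists>f. is_kernel_of C k f)"

definition is_cokernel :: "('o, 'm) addcat \<Rightarrow> 'm \<Rightarrow> bool" where
  "is_cokernel C c \<longleftrightarrow> (\<exists>f. is_cokernel_of C c f)"

text \<open>
  Squares are written with \<open>a : A \<rightarrow> B\<close>, \<open>b : A \<rightarrow> C'\<close>, \<open>c : B \<rightarrow> D\<close>, \<open>d : C' \<rightarrow> D\<close>
  and \<open>c a = d b\<close>.
\<close>

definition commutative_square ::
  "('o, 'm) addcat \<Rightarrow> 'm \<Rightarrow> 'm \<Rightarrow> 'm \<Rightarrow> 'm \<Rightarrow> bool" where
  "commutative_square C a b c d \<longleftrightarrow>
     a \<in> Arr C \<and> b \<in> Arr C \<and> c \<in> Arr C \<and> d \<in> Arr C \<and>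
     Dom C a = Dom C b \<and> Cod C a = Dom C c \<and> Cod C b = Dom C d \<and> Cod C c = Cod C d \<and>
     c \<cdot>\<^bsub>C\<^esub> a = d \<cdot>\<^bsub>C\<^esub> b"

definition is_pullback :: "('o, 'm) addcat \<Rightarrow> 'm \<Rightarrow> 'm \<Rightarrow> 'm \<Rightarrow> 'm \<Rightarrow> bool" where
  "is_pullback C a b c d \<longleftrightarrow> commutative_square C a b c d \<and>
     (\<forall>T. \<forall>u\<in>Hom C T (Dom C c). \<forall>v\<in>Hom C T (Dom C d). c \<cdot>\<^bsub>C\<^esub> u = d \<cdot>\<^bsub>C\<^esub> v \<longrightarrow>
        (\<exists>!w. w \<in> Hom C T (Dom C a) \<and> a \<cdot>\<^bsub>C\<^esub> w = u \<and> b \<cdot>\<^bsub>C\<^esub> w = v))"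

definition is_pushout :: "('o, 'm) addcat \<Rightarrow> 'm \<Rightarrow> 'm \<Rightarrow> 'm \<Rightarrow> 'm \<Rightarrow> bool" where
  "is_pushout C a b c d \<longleftrightarrow> commutative_square C a b c d \<and>
     (\<forall>T. \<forall>u\<in>Hom C (Cod C a) T. \<forall>v\<in>Hom C (Cod C b) T. u \<cdot>\<^bsub>C\<^esub> a = v \<cdot>\<^bsub>C\<^esub> b \<longrightarrow>
        (\<exists>!w. w \<in> Hom C (Cod C c) T \<and> w \<cdot>\<^bsub>C\<^esub> c = u \<and> w \<cdot>\<^bsub>C\<^esub> d = v))"


section \<open>Semi-abelian categories\<close>

definition preabelian :: "('o, 'm) addcat \<Rightarrow> bool" where
  "preabelian C \<longleftrightarrow> additive_category C \<and>
     (\<forall>f\<in>Arr C. (\<exists>k. is_kernel_of C k f) \<and> (\<exists>c. is_cokernel_of C c f))"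

definition left_semi_abelian :: "('o, 'm) addcat \<Rightarrow> bool" where
  "left_semi_abelian C \<longleftrightarrow> preabelian C \<and>
     (\<forall>a b c d. is_pullback C a b c d \<longrightarrow> is_cokernel C d \<longrightarrow> is_epi C a)"

definition right_semi_abelian :: "('o, 'm) addcat \<Rightarrow> bool" where
  "right_semi_abelian C \<longleftrightarrow> preabelian C \<and>
     (\<forall>a b c d. is_pushout C a b c d \<longrightarrow> is_kernel C a \<longrightarrow> is_mono C d)"

definition semi_abelian :: "('o, 'm) addcat \<Rightarrow> bool" where
  "semi_abelian C \<longleftrightarrow> left_semi_abelian C \<and> right_semi_abelian C"


section \<open>Exact categories\<close>

text \<open>
  An exact structure is a set \<open>E\<close> of composable pairs \<open>(f, g)\<close>, standing for the short exact
  sequences with inflation \<open>f\<close> and deflation \<open>g\<close>.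
\<close>

definition inflation :: "('m \<times> 'm) set \<Rightarrow> 'm \<Rightarrow> bool" where
  "inflation E f \<longleftrightarrow> (\<exists>g. (f, g) \<in> E)"

definition deflation :: "('m \<times> 'm) set \<Rightarrow> 'm \<Rightarrow> bool" where
  "deflation E g \<longleftrightarrow> (\<exists>f. (f, g) \<in> E)"

definition short_exact ::
  "('o, 'm) addcat \<Rightarrow> ('m \<times> 'm) set \<Rightarrow> 'o \<Rightarrow> 'm \<Rightarrow> 'o \<Rightarrow> 'm \<Rightarrow> 'o \<Rightarrow> bool" where
  "short_exact C E X f Y g Z \<longleftrightarrow> (f, g) \<in> E \<and> f \<in> Hom C X Y \<and> g \<in> Hom C Y Z"

definition isomorphic_sequences ::
  "('o, 'm) addcat \<Rightarrow> 'm \<times> 'm \<Rightarrow> 'm \<times> 'm \<Rightarrow> bool" where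
  "isomorphic_sequences C = (\<lambda>(f, g) (f', g'). \<exists>X Y Z X' Y' Z' x y z.
     f \<in> Hom C X Y \<and> g \<in> Hom C Y Z \<and> f' \<in> Hom C X' Y' \<and> g' \<in> Hom C Y' Z' \<and>
     x \<in> Hom C X X' \<and> y \<in> Hom C Y Y' \<and> z \<in> Hom C Z Z' \<and>
     is_iso C x \<and> is_iso C y \<and> is_iso C z \<and>
     y \<cdot>\<^bsub>C\<^esub> f = f' \<cdot>\<^bsub>C\<^esub> x \<and> z \<cdot>\<^bsub>C\<^esub> g = g' \<cdot>\<^bsub>C\<^esub> y)"

definition is_direct_sum_of_sequences ::
  "('o, 'm) addcat \<Rightarrow> 'm \<times> 'm \<Rightarrow> 'm \<times> 'm \<Rightarrow> 'm \<times> 'm \<Rightarrow> bool" where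
  "is_direct_sum_of_sequences C = (\<lambda>(f1, g1) (f2, g2) (f, g).
     \<exists>X1 X2 X Y1 Y2 Y Z1 Z2 Z ix1 ix2 px1 px2 iy1 iy2 py1 py2 iz1 iz2 pz1 pz2.
       f1 \<in> Hom C X1 Y1 \<and> g1 \<in> Hom C Y1 Z1 \<and>
       f2 \<in> Hom C X2 Y2 \<and> g2 \<in> Hom C Y2 Z2 \<and>
       f \<in> Hom C X Y \<and> g \<in> Hom C Y Z \<and>
       is_biproduct C X1 X2 X ix1 ix2 px1 px2 \<and>
       is_biproduct C Y1 Y2 Y iy1 iy2 py1 py2 \<and>
       is_biproduct C Z1 Z2 Z iz1 iz2 pz1 pz2 \<and>
       f \<cdot>\<^bsub>C\<^esub> ix1 = iy1 \<cdot>\<^bsub>C\<^esub> f1 \<and> f \<cdot>\<^bsub>C\<^esub> ix2 = iy2 \<cdot>\<^bsub>C\<^esub> f2 \<and>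
       g \<cdot>\<^bsub>C\<^esub> iy1 = iz1 \<cdot>\<^bsub>C\<^esub> g1 \<and> g \<cdot>\<^bsub>C\<^esub> iy2 = iz2 \<cdot>\<^bsub>C\<^esub> g2)"

locale exact_category = additive_category +
  fixes E :: "('b \<times> 'b) set"
  assumes kernel_cokernel_pair:
      "(f, g) \<in> E \<Longrightarrow> is_kernel_of C f g \<and> is_cokernel_of C g f"
    and iso_closed: "\<lbrakk>s \<in> E; isomorphic_sequences C s s'\<rbrakk> \<Longrightarrow> s' \<in> E"
    and direct_sum_closed:
      "\<lbrakk>s1 \<in> E; s2 \<in> E; is_direct_sum_of_sequences C s1 s2 s\<rbrakk> \<Longrightarrow> s \<in> E"
    and direct_summand_closed:
      "\<lbrakk>s \<in> E; is_direct_sum_of_sequences C s1 s2 s\<rbrakk> \<Longrightarrow> s1 \<in> E \<and> s2 \<in> E"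
    and Id_inflation: "X \<in> Obj C \<Longrightarrow> inflation E (Id C X)"
    and Id_deflation: "X \<in> Obj C \<Longrightarrow> deflation E (Id C X)"
    and Comp_inflation: "\<lbrakk>inflation E f; inflation E g; Cod C f = Dom C g\<rbrakk>
      \<Longrightarrow> inflation E (g \<cdot> f)"
    and Comp_deflation: "\<lbrakk>deflation E f; deflation E g; Cod C f = Dom C g\<rbrakk>
      \<Longrightarrow> deflation E (g \<cdot> f)"
    and pushout_inflation: "\<lbrakk>inflation E a; b \<in> Arr C; Dom C a = Dom C b\<rbrakk>
      \<Longrightarrow> \<exists>c d. is_pushout C a b c d \<and> inflation E d"
    and pullback_deflation: "\<lbrakk>deflation E d; c \<in> Arr C; Cod C c = Cod C d\<rbrakk>
      \<Longrightarrow> \<exists>a b. is_pullback C a b c d \<and> deflation E a"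

definition projective :: "('o, 'm) addcat \<Rightarrow> ('m \<times> 'm) set \<Rightarrow> 'o \<Rightarrow> bool" where
  "projective C E P \<longleftrightarrow> P \<in> Obj C \<and>
     (\<forall>g. deflation E g \<longrightarrow> (\<forall>f\<in>Hom C P (Cod C g). \<exists>h\<in>Hom C P (Dom C g). g \<cdot>\<^bsub>C\<^esub> h = f))"

definition injective :: "('o, 'm) addcat \<Rightarrow> ('m \<times> 'm) set \<Rightarrow> 'o \<Rightarrow> bool" where
  "injective C E I \<longleftrightarrow> I \<in> Obj C \<and>
     (\<forall>g. inflation E g \<longrightarrow> (\<forall>f\<in>Hom C (Dom C g) I. \<exists>h\<in>Hom C (Cod C g) I. h \<cdot>\<^bsub>C\<^esub> g = f))"

definition enough_projectives :: "('o, 'm) addcat \<Rightarrow> ('m \<times> 'm) set \<Rightarrow> bool" where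
  "enough_projectives C E \<longleftrightarrow>
     (\<forall>X\<in>Obj C. \<exists>P g. projective C E P \<and> g \<in> Hom C P X \<and> deflation E g)"

definition enough_injectives :: "('o, 'm) addcat \<Rightarrow> ('m \<times> 'm) set \<Rightarrow> bool" where
  "enough_injectives C E \<longleftrightarrow>
     (\<forall>X\<in>Obj C. \<exists>I g. injective C E I \<and> g \<in> Hom C X I \<and> inflation E g)"


subsection \<open>Extensions\<close>

text \<open>
  \<open>Ext1 C E Z X\<close> is the Yoneda Ext of short exact sequences \<open>X \<rightarrow> Y \<rightarrow> Z\<close>; its zero element
  (for the Baer sum) is the class of the split sequences.
\<close>

definition extensions ::
  "('o, 'm) addcat \<Rightarrow> ('m \<times> 'm) set \<Rightarrow> 'o \<Rightarrow> 'o \<Rightarrow> ('m \<times> 'm) set" where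
  "extensions C E Z X = {(f, g). \<exists>Y. short_exact C E X f Y g Z}"

definition ext_equiv ::
  "('o, 'm) addcat \<Rightarrow> ('m \<times> 'm) set \<Rightarrow> 'o \<Rightarrow> 'o \<Rightarrow> (('m \<times> 'm) \<times> ('m \<times> 'm)) set" where
  "ext_equiv C E Z X = {((f, g), (f', g')).
     (f, g) \<in> extensions C E Z X \<and> (f', g') \<in> extensions C E Z X \<and>
     (\<exists>h\<in>Hom C (Cod C f) (Cod C f'). h \<cdot>\<^bsub>C\<^esub> f = f' \<and> g' \<cdot>\<^bsub>C\<^esub> h = g)}"

definition Ext1 ::
  "('o, 'm) addcat \<Rightarrow> ('m \<times> 'm) set \<Rightarrow> 'o \<Rightarrow> 'o \<Rightarrow> ('m \<times> 'm) set set" where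
  "Ext1 C E Z X = extensions C E Z X // ext_equiv C E Z X"

definition Ext1_zero ::
  "('o, 'm) addcat \<Rightarrow> ('m \<times> 'm) set \<Rightarrow> 'o \<Rightarrow> 'o \<Rightarrow> ('m \<times> 'm) set" where
  "Ext1_zero C E Z X =
     {(f, g) \<in> extensions C E Z X. \<exists>Y i p. is_biproduct C X Z Y f i p g}"


section \<open>Full subcategories and ideal quotients\<close>

definition full_subcategory :: "('o, 'm) addcat \<Rightarrow> 'o set \<Rightarrow> ('o, 'm) addcat" where
  "full_subcategory C S = C\<lparr>Obj := S, Arr := {f \<in> Arr C. Dom C f \<in> S \<and> Cod C f \<in> S}\<rparr>"

definition additive_subcategory :: "('o, 'm) addcat \<Rightarrow> 'o set \<Rightarrow> bool" where
  "additive_subcategory C S \<longleftrightarrow> S \<subseteq> Obj C \<and> additive_category (full_subcategory C S)"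

definition closed_under_direct_summands :: "('o, 'm) addcat \<Rightarrow> 'o set \<Rightarrow> bool" where
  "closed_under_direct_summands C S \<longleftrightarrow>
     (\<forall>X1 X2 X i1 i2 p1 p2. X1 \<in> Obj C \<and> X2 \<in> Obj C \<and> X \<in> S \<and>
        is_biproduct C X1 X2 X i1 i2 p1 p2 \<longrightarrow> X1 \<in> S)"

definition factoring_morphisms :: "('o, 'm) addcat \<Rightarrow> 'o set \<Rightarrow> 'o \<Rightarrow> 'o \<Rightarrow> 'm set" where
  "factoring_morphisms C W X Y = {h \<cdot>\<^bsub>C\<^esub> g | g h Z. Z \<in> W \<and> g \<in> Hom C X Z \<and> h \<in> Hom C Z Y}"

definition mor_class :: "('o, 'm) addcat \<Rightarrow> 'o set \<Rightarrow> 'm \<Rightarrow> 'm set" where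
  "mor_class C W f = factoring_morphisms C W (Dom C f) (Cod C f)
     #>\<^bsub>hom_group C (Dom C f) (Cod C f)\<^esub> f"

text \<open>
  The quotient of \<open>C\<close> modulo the morphisms factoring through an object of \<open>W\<close>: its hom-groups are
  the factor groups \<open>hom_group C X Y Mod factoring_morphisms C W X Y\<close>, and the union defining
  composition is over equal cosets.  A coset determines the common domain and codomain of its
  members, which are therefore read off from an arbitrary representative.
\<close>

definition quotient_category :: "('o, 'm) addcat \<Rightarrow> 'o set \<Rightarrow> ('o, 'm set) addcat" where
  "quotient_category C W = \<lparr>
     Obj = Obj C,
     Arr = mor_class C W ` Arr C,
     Dom = (\<lambda>F. Dom C (SOME f. f \<in> F)),
     Cod = (\<lambda>F. Cod C (SOME f. f \<in> F)),
     Id = (\<lambda>X. mor_class C W (Id C X)),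
     Comp = (\<lambda>G F. \<Union>g\<in>G. \<Union>f\<in>F. mor_class C W (g \<cdot>\<^bsub>C\<^esub> f)),
     Zero = factoring_morphisms C W,
     Add = (\<lambda>F G. {f \<boxplus>\<^bsub>C\<^esub> g | f g. f \<in> F \<and> g \<in> G})\<rparr>"


section \<open>Twin cotorsion pairs and their hearts\<close>

definition cotorsion_pair ::
  "('o, 'm) addcat \<Rightarrow> ('m \<times> 'm) set \<Rightarrow> 'o set \<Rightarrow> 'o set \<Rightarrow> bool" where
  "cotorsion_pair C E U V \<longleftrightarrow>
     additive_subcategory C U \<and> closed_under_direct_summands C U \<and>
     additive_subcategory C V \<and> closed_under_direct_summands C V \<and>
     (\<forall>X\<in>U. \<forall>Y\<in>V. Ext1 C E X Y = {Ext1_zero C E X Y}) \<and>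
     (\<forall>B\<in>Obj C.
        (\<exists>V1\<in>V. \<exists>U1\<in>U. \<exists>f g. short_exact C E V1 f U1 g B) \<and>
        (\<exists>V2\<in>V. \<exists>U2\<in>U. \<exists>f g. short_exact C E B f V2 g U2))"

definition twin_cotorsion_pair ::
  "('o, 'm) addcat \<Rightarrow> ('m \<times> 'm) set \<Rightarrow> 'o set \<Rightarrow> 'o set \<Rightarrow> 'o set \<Rightarrow> 'o set \<Rightarrow> bool" where
  "twin_cotorsion_pair C E S T U V \<longleftrightarrow>
     cotorsion_pair C E S T \<and> cotorsion_pair C E U V \<and> S \<subseteq> U"

definition B_plus ::
  "('o, 'm) addcat \<Rightarrow> ('m \<times> 'm) set \<Rightarrow> 'o set \<Rightarrow> 'o set \<Rightarrow> 'o set" where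
  "B_plus C E W V = {B \<in> Obj C. \<exists>V1\<in>V. \<exists>U1\<in>W. \<exists>f g. short_exact C E V1 f U1 g B}"

definition B_minus ::
  "('o, 'm) addcat \<Rightarrow> ('m \<times> 'm) set \<Rightarrow> 'o set \<Rightarrow> 'o set \<Rightarrow> 'o set" where
  "B_minus C E W S = {B \<in> Obj C. \<exists>T1\<in>W. \<exists>S1\<in>S. \<exists>f g. short_exact C E B f T1 g S1}"

definition heart ::
  "('o, 'm) addcat \<Rightarrow> ('m \<times> 'm) set \<Rightarrow> 'o set \<Rightarrow> 'o set \<Rightarrow> 'o set \<Rightarrow> 'o set
     \<Rightarrow> ('o, 'm set) addcat" where
  "heart C E S T U V =
     (let W = T \<inter> U; H = B_plus C E W V \<inter> B_minus C E W S
      in quotient_category (full_subcategory C H) W)"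

end

theory Submission
  imports Defs
begin

text \<open>
  Let \<open>W\<close> be the intersection of \<open>T\<close> and \<open>U\<close>. Two consequences of the vanishing of extensions drive
  everything: morphisms from objects of \<open>U\<close> lift along deflations with kernel in \<open>V\<close>, and morphisms
  into objects of \<open>T\<close> extend along inflations with cokernel in \<open>S\<close>. An object of \<open>B\<^sup>+\<close> is covered by an
  object of \<open>W\<close> with kernel in \<open>V\<close>, an object of \<open>B\<^sup>-\<close> embeds into an object of \<open>W\<close> with cokernel in \<open>S\<close>.
  It follows that an inflation with cokernel in \<open>S\<close> is an epimorphism modulo \<open>W\<close> when tested against
  \<open>B\<^sup>+\<close> (lemma \<open>factoring_reflected\<close>).

  Cokernels. For \<open>f : A \<rightarrow> B\<close> in the heart, the pushout along \<open>f\<close> of an embedding of \<open>A\<close> into \<open>W\<close> is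
  the universal object under \<open>B\<close> on which \<open>f\<close> factors through \<open>W\<close>. It lies in \<open>B\<^sup>-\<close> (lemma \<open>Bminus_iff\<close>) and
  is moved into the heart by a reflection (lemma \<open>reflection\<close>). Both steps enlarge \<open>B\<close> by inflations
  with cokernel in \<open>S\<close>, so the result is a cokernel modulo \<open>W\<close> (lemmas \<open>weak_cokernel\<close> and
  \<open>heart_cokernel\<close>), and every cokernel in the heart is, up to isomorphism, represented by an inflation
  with cokernel in \<open>S\<close>.

  Pullbacks. Let \<open>d : A \<rightarrow> D\<close> be such an inflation with cokernel \<open>s : D \<rightarrow> S1\<close>, and let \<open>g : B \<rightarrow> D\<close> be a
  morphism in the heart. After adding to \<open>B\<close> an object of \<open>W\<close> covering \<open>D\<close>, the map to \<open>S1\<close> becomes a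
  deflation. Its kernel maps to \<open>A\<close>, and its inclusion into (the enlarged) \<open>B\<close> is an inflation
  with cokernel \<open>S1\<close>, hence an epimorphism modulo \<open>W\<close>. Since this morphism into \<open>B\<close> factors through
  the pullback of \<open>d\<close> along \<open>g\<close>, the projection of the pullback to \<open>B\<close> is an epimorphism (lemmas
  \<open>epi_cover_of_pullback\<close> and \<open>heart_pullback_epi\<close>).

  The other half is dual: the opposite of an exact category is exact, the opposite of the twin
  cotorsion pair is \<open>(V, U), (T, S)\<close>, and its heart is the opposite of the heart.
\<close>

section \<open>Calculus in preadditive categories\<close>

context category
begin

declare Dom_Obj [simp] Cod_Obj [simp]

lemma Hom_D: "f \<in> Hom C X Y \<Longrightarrow> f \<in> Arr C \<and> Dom C f = X \<and> Cod C f = Y \<and> X \<in> Obj C \<and> Y \<in> Obj C"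
  using Dom_Obj Cod_Obj by (auto simp: Hom_def)

lemma Hom_I: "\<lbrakk>f \<in> Arr C; Dom C f = X; Cod C f = Y\<rbrakk> \<Longrightarrow> f \<in> Hom C X Y"
  by (auto simp: Hom_def)

lemma Arr_Comp [simp]:
  assumes "f \<in> Arr C" "g \<in> Arr C" "Dom C g = Cod C f"
  shows "g \<cdot> f \<in> Arr C" "Dom C (g \<cdot> f) = Dom C f" "Cod C (g \<cdot> f) = Cod C g"
  using Comp_Hom[of f "Dom C f" "Cod C f" g "Cod C g"] assms by (auto simp: Hom_def)

lemma Arr_Id [simp]:
  assumes "X \<in> Obj C"
  shows "Id C X \<in> Arr C" "Dom C (Id C X) = X" "Cod C (Id C X) = X"
  using Id_Hom[OF assms] by (auto simp: Hom_def)

lemma Comp_assoc' [simp]: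
  assumes "f \<in> Arr C" "g \<in> Arr C" "h \<in> Arr C" "Dom C g = Cod C f" "Dom C h = Cod C g"
  shows "(h \<cdot> g) \<cdot> f = h \<cdot> (g \<cdot> f)"
  using Comp_assoc[of f "Dom C f" "Cod C f" g "Cod C g" h "Cod C h"] assms by (auto simp: Hom_def)

lemma Comp_Id' [simp]:
  assumes "f \<in> Arr C"
  shows "Dom C f = X \<Longrightarrow> f \<cdot> Id C X = f" "Cod C f = Y \<Longrightarrow> Id C Y \<cdot> f = f"
  using Comp_Id_right[of f "Dom C f" "Cod C f"] Comp_Id_left[of f "Dom C f" "Cod C f"] assms
  by (auto simp: Hom_def)

lemma Comp_absorb:
  assumes "p \<cdot> k = q" "k \<in> Arr C" "p \<in> Arr C" "f \<in> Arr C" "Dom C p = Cod C k" "Dom C k = Cod C f"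
  shows "p \<cdot> (k \<cdot> f) = q \<cdot> f"
  using assms by (metis Comp_assoc')

end

context preadditive_category
begin

lemma Zero_Arr [simp]:
  assumes "X \<in> Obj C" "Y \<in> Obj C"
  shows "Zero C X Y \<in> Arr C" "Dom C (Zero C X Y) = X" "Cod C (Zero C X Y) = Y"
proof -
  interpret G: comm_group "hom_group C X Y" using hom_comm_group assms by blast
  show "Zero C X Y \<in> Arr C" "Dom C (Zero C X Y) = X" "Cod C (Zero C X Y) = Y"
    using G.one_closed by (auto simp: hom_group_def Hom_def)
qed

lemma Add_Arr [simp]:
  assumes "f \<in> Arr C" "g \<in> Arr C" "Dom C g = Dom C f" "Cod C g = Cod C f"
  shows "f \<boxplus> g \<in> Arr C" "Dom C (f \<boxplus> g) = Dom C f" "Cod C (f \<boxplus> g) = Cod C f"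
proof -
  interpret G: comm_group "hom_group C (Dom C f) (Cod C f)"
    using hom_comm_group assms Dom_Obj Cod_Obj by blast
  show "f \<boxplus> g \<in> Arr C" "Dom C (f \<boxplus> g) = Dom C f" "Cod C (f \<boxplus> g) = Cod C f"
    using G.m_closed[of f g] assms by (auto simp: hom_group_def Hom_def)
qed

definition Neg :: "'b \<Rightarrow> 'b" where
  "Neg f = inv\<^bsub>hom_group C (Dom C f) (Cod C f)\<^esub> f"

abbreviation Minus :: "'b \<Rightarrow> 'b \<Rightarrow> 'b"  (infixl \<open>\<boxminus>\<close> 65) where
  "f \<boxminus> g \<equiv> f \<boxplus> Neg g"

lemma Neg_Arr [simp]:
  assumes "f \<in> Arr C"
  shows "Neg f \<in> Arr C" "Dom C (Neg f) = Dom C f" "Cod C (Neg f) = Cod C f"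
    "f \<boxplus> Neg f = Zero C (Dom C f) (Cod C f)" "Neg f \<boxplus> f = Zero C (Dom C f) (Cod C f)"
proof -
  interpret G: comm_group "hom_group C (Dom C f) (Cod C f)"
    using hom_comm_group assms Dom_Obj Cod_Obj by blast
  have f: "f \<in> carrier (hom_group C (Dom C f) (Cod C f))"
    using assms by (auto simp: hom_group_def Hom_def)
  show "Neg f \<in> Arr C" "Dom C (Neg f) = Dom C f" "Cod C (Neg f) = Cod C f"
    using G.inv_closed[OF f] by (auto simp: Neg_def hom_group_def Hom_def)
  show "f \<boxplus> Neg f = Zero C (Dom C f) (Cod C f)" "Neg f \<boxplus> f = Zero C (Dom C f) (Cod C f)"
    using G.r_inv[OF f] G.l_inv[OF f] by (auto simp: Neg_def hom_group_def)
qed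

lemma Add_assoc:
  assumes "f \<in> Arr C" "g \<in> Arr C" "h \<in> Arr C" "Dom C g = Dom C f" "Cod C g = Cod C f"
    "Dom C h = Dom C f" "Cod C h = Cod C f"
  shows "(f \<boxplus> g) \<boxplus> h = f \<boxplus> (g \<boxplus> h)"
proof -
  interpret G: comm_group "hom_group C (Dom C f) (Cod C f)"
    using hom_comm_group assms Dom_Obj Cod_Obj by blast
  show ?thesis using G.m_assoc[of f g h] assms by (auto simp: hom_group_def Hom_def)
qed

lemma Add_comm:
  assumes "f \<in> Arr C" "g \<in> Arr C" "Dom C g = Dom C f" "Cod C g = Cod C f"
  shows "f \<boxplus> g = g \<boxplus> f"
proof -
  interpret G: comm_group "hom_group C (Dom C f) (Cod C f)"
    using hom_comm_group assms Dom_Obj Cod_Obj by blast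
  show ?thesis using G.m_comm[of f g] assms by (auto simp: hom_group_def Hom_def)
qed

lemma Add_Zero [simp]:
  assumes "f \<in> Arr C" "Dom C f = X" "Cod C f = Y"
  shows "f \<boxplus> Zero C X Y = f" "Zero C X Y \<boxplus> f = f"
proof -
  interpret G: comm_group "hom_group C X Y"
    using hom_comm_group assms Dom_Obj Cod_Obj by blast
  show "f \<boxplus> Zero C X Y = f" "Zero C X Y \<boxplus> f = f"
    using G.r_one[of f] G.l_one[of f] assms by (auto simp: hom_group_def Hom_def)
qed

lemma Add_cancel:
  assumes "f \<in> Arr C" "g \<in> Arr C" "h \<in> Arr C" "Dom C g = Dom C f" "Cod C g = Cod C f"
    "Dom C h = Dom C f" "Cod C h = Cod C f" "f \<boxplus> g = f \<boxplus> h"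
  shows "g = h"
proof -
  interpret G: comm_group "hom_group C (Dom C f) (Cod C f)"
    using hom_comm_group assms Dom_Obj Cod_Obj by blast
  show ?thesis using G.Units_l_cancel[of f g h] assms
    unfolding G.Units_eq by (auto simp: hom_group_def Hom_def)
qed

lemma Minus_Add_cancel [simp]:
  assumes "f \<in> Arr C" "g \<in> Arr C" "Dom C g = Dom C f" "Cod C g = Cod C f"
  shows "(f \<boxminus> g) \<boxplus> g = f"
  using assms by (simp add: Add_assoc)

lemma Comp_Add [simp]:
  assumes "f \<in> Arr C" "f' \<in> Arr C" "g \<in> Arr C" "Dom C f' = Dom C f" "Cod C f' = Cod C f"
    "Dom C g = Cod C f"
  shows "g \<cdot> (f \<boxplus> f') = (g \<cdot> f) \<boxplus> (g \<cdot> f')"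
  using Comp_Add_right[of f "Dom C f" "Cod C f" f' g "Cod C g"] assms by (auto simp: Hom_def)

lemma Add_Comp [simp]:
  assumes "f \<in> Arr C" "g \<in> Arr C" "g' \<in> Arr C" "Dom C g' = Dom C g" "Cod C g' = Cod C g"
    "Dom C g = Cod C f"
  shows "(g \<boxplus> g') \<cdot> f = (g \<cdot> f) \<boxplus> (g' \<cdot> f)"
  using Comp_Add_left[of f "Dom C f" "Cod C f" g "Cod C g" g'] assms by (auto simp: Hom_def)

lemma Add_self_Zero:
  assumes "f \<in> Arr C" "f \<boxplus> f = f"
  shows "f = Zero C (Dom C f) (Cod C f)"
  using Add_cancel[of f f "Zero C (Dom C f) (Cod C f)"] assms Dom_Obj Cod_Obj by simp

lemma Comp_Zero [simp]:
  assumes "g \<in> Arr C" "X \<in> Obj C" "Dom C g = Y"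
  shows "g \<cdot> Zero C X Y = Zero C X (Cod C g)"
proof -
  have Y: "Y \<in> Obj C" using assms Dom_Obj by blast
  have "g \<cdot> Zero C X Y \<boxplus> g \<cdot> Zero C X Y = g \<cdot> (Zero C X Y \<boxplus> Zero C X Y)"
    using assms Y by (simp del: Add_Zero)
  then show ?thesis
    using assms Y Add_self_Zero[of "g \<cdot> Zero C X Y"] by simp
qed

lemma Zero_Comp [simp]:
  assumes "f \<in> Arr C" "Z \<in> Obj C" "Cod C f = Y"
  shows "Zero C Y Z \<cdot> f = Zero C (Dom C f) Z"
proof -
  have Y: "Y \<in> Obj C" using assms Cod_Obj by blast
  have "Zero C Y Z \<cdot> f \<boxplus> Zero C Y Z \<cdot> f = (Zero C Y Z \<boxplus> Zero C Y Z) \<cdot> f"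
    using assms Y by (simp del: Add_Zero)
  then show ?thesis
    using assms Y Add_self_Zero[of "Zero C Y Z \<cdot> f"] by simp
qed

lemma Neg_unique:
  assumes "f \<in> Arr C" "g \<in> Arr C" "Dom C g = Dom C f" "Cod C g = Cod C f"
    "f \<boxplus> g = Zero C (Dom C f) (Cod C f)"
  shows "g = Neg f"
  using Add_cancel[of f g "Neg f"] assms by simp

lemma Comp_Neg [simp]:
  assumes "f \<in> Arr C" "g \<in> Arr C" "Dom C g = Cod C f"
  shows "g \<cdot> Neg f = Neg (g \<cdot> f)"
proof (rule Neg_unique)
  have "g \<cdot> f \<boxplus> g \<cdot> Neg f = g \<cdot> (f \<boxplus> Neg f)" using assms by (simp del: Neg_Arr(4,5))
  then show "g \<cdot> f \<boxplus> g \<cdot> Neg f = Zero C (Dom C (g \<cdot> f)) (Cod C (g \<cdot> f))"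
    using assms Dom_Obj by simp
qed (use assms in auto)

lemma Neg_Comp [simp]:
  assumes "f \<in> Arr C" "g \<in> Arr C" "Dom C g = Cod C f"
  shows "Neg g \<cdot> f = Neg (g \<cdot> f)"
proof (rule Neg_unique)
  have "g \<cdot> f \<boxplus> Neg g \<cdot> f = (g \<boxplus> Neg g) \<cdot> f" using assms by (simp del: Neg_Arr(4,5))
  then show "g \<cdot> f \<boxplus> Neg g \<cdot> f = Zero C (Dom C (g \<cdot> f)) (Cod C (g \<cdot> f))"
    using assms Cod_Obj by simp
qed (use assms in auto)

lemma Neg_Zero [simp]: "\<lbrakk>X \<in> Obj C; Y \<in> Obj C\<rbrakk> \<Longrightarrow> Neg (Zero C X Y) = Zero C X Y"
  using Neg_unique[of "Zero C X Y" "Zero C X Y"] by simp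

lemma Neg_Neg [simp]: "f \<in> Arr C \<Longrightarrow> Neg (Neg f) = f"
  using Neg_unique[of "Neg f" f] by simp

lemma Neg_Add:
  assumes "f \<in> Arr C" "g \<in> Arr C" "Dom C g = Dom C f" "Cod C g = Cod C f"
  shows "Neg (f \<boxplus> g) = Neg f \<boxplus> Neg g"
proof -
  interpret G: comm_group "hom_group C (Dom C f) (Cod C f)"
    using hom_comm_group assms Dom_Obj Cod_Obj by blast
  show ?thesis using G.inv_mult[of f g] assms
    by (simp add: Neg_def) (auto simp: hom_group_def Hom_def)
qed

lemma Minus_Add_self:
  assumes "f \<in> Arr C" "g \<in> Arr C" "Dom C g = Dom C f" "Cod C g = Cod C f"
  shows "f \<boxminus> (f \<boxplus> g) = Neg g"
  using assms Add_assoc[of f "Neg f" "Neg g"] by (simp add: Neg_Add)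

lemma Minus_telescope:
  assumes "f \<in> Arr C" "g \<in> Arr C" "h \<in> Arr C" "Dom C g = Dom C f" "Cod C g = Cod C f"
    "Dom C h = Dom C f" "Cod C h = Cod C f"
  shows "(f \<boxminus> g) \<boxplus> (g \<boxminus> h) = f \<boxminus> h"
proof -
  have "(f \<boxminus> g) \<boxplus> (g \<boxminus> h) = ((f \<boxminus> g) \<boxplus> g) \<boxminus> h"
    by (rule Add_assoc[symmetric]) (use assms in simp_all)
  then show ?thesis using assms by simp
qed

end

section \<open>The opposite category\<close>

definition op :: "('o, 'm) addcat \<Rightarrow> ('o, 'm) addcat" where
  "op C = \<lparr>Obj = Obj C, Arr = Arr C, Dom = Cod C, Cod = Dom C, Id = Id C,
     Comp = (\<lambda>g f. f \<cdot>\<^bsub>C\<^esub> g), Zero = (\<lambda>X Y. Zero C Y X), Add = Add C\<rparr>"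

lemma op_simps [simp]:
  "Obj (op C) = Obj C" "Arr (op C) = Arr C" "Dom (op C) = Cod C" "Cod (op C) = Dom C"
  "Id (op C) = Id C" "g \<cdot>\<^bsub>op C\<^esub> f = f \<cdot>\<^bsub>C\<^esub> g" "Zero (op C) X Y = Zero C Y X"
  "Add (op C) = Add C"
  by (auto simp: op_def)

lemma op_op [simp]: "op (op C) = C"
  by (cases C) (simp add: op_def)

lemma Hom_op [simp]: "Hom (op C) X Y = Hom C Y X"
  by (auto simp: Hom_def)

lemma hom_group_op [simp]: "hom_group (op C) X Y = hom_group C Y X"
  by (simp add: hom_group_def)

lemma zero_object_op [simp]: "zero_object (op C) N \<longleftrightarrow> zero_object C N"
  by (auto simp: zero_object_def)

lemma is_biproduct_op [simp]:
  "is_biproduct (op C) X1 X2 X i1 i2 p1 p2 \<longleftrightarrow> is_biproduct C X1 X2 X p1 p2 i1 i2"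
  by (auto simp: is_biproduct_def)

lemma category_op:
  assumes "category C"
  shows "category (op C)"
proof -
  interpret category C by fact
  show ?thesis
    by unfold_locales
      (auto simp: Dom_Obj Cod_Obj Id_Hom intro: Comp_Hom Comp_Id_right Comp_Id_left,
       metis Comp_assoc)
qed

lemma preadditive_category_op:
  assumes "preadditive_category C"
  shows "preadditive_category (op C)"
proof -
  interpret preadditive_category C by fact
  interpret op: category "op C" using category_op category_axioms .
  show ?thesis
    by (intro preadditive_category.intro preadditive_category_axioms.intro op.category_axioms)
      (auto simp: hom_comm_group Comp_Add_left Comp_Add_right)
qed

lemma additive_category_op:
  assumes "additive_category C"
  shows "additive_category (op C)"
proof -
  interpret additive_category C by fact
  interpret op: preadditive_category "op C"
    using preadditive_category_op preadditive_category_axioms .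
  have "\<exists>X i1 i2 p1 p2. is_biproduct C X1 X2 X p1 p2 i1 i2" if "X1 \<in> Obj C" "X2 \<in> Obj C" for X1 X2
    using ex_biproduct[OF that] by blast
  then show ?thesis
    using ex_zero_object
    by (intro additive_category.intro additive_category_axioms.intro op.preadditive_category_axioms)
      auto
qed

lemma is_iso_op [simp]: "is_iso (op C) f \<longleftrightarrow> is_iso C f"
  by (auto simp: is_iso_def)

lemma is_mono_op [simp]: "is_mono (op C) f \<longleftrightarrow> is_epi C f"
  by (auto simp: is_mono_def is_epi_def)

lemma is_kernel_of_op [simp]: "is_kernel_of (op C) k f \<longleftrightarrow> is_cokernel_of C k f"
  by (simp add: is_kernel_of_def is_cokernel_of_def)

lemma is_cokernel_of_op [simp]: "is_cokernel_of (op C) k f \<longleftrightarrow> is_kernel_of C k f"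
  by (simp add: is_kernel_of_def is_cokernel_of_def)

lemma is_pushout_op [simp]: "is_pushout (op C) a b c d \<longleftrightarrow> is_pullback C c d a b"
  unfolding is_pushout_def is_pullback_def commutative_square_def
  by (intro iffI; elim conjE; simp)

lemma is_pushout_swap: "is_pushout C a b c d \<Longrightarrow> is_pushout C b a d c"
  unfolding is_pushout_def commutative_square_def by (simp; metis)

lemma is_pullback_swap: "is_pullback C a b c d \<Longrightarrow> is_pullback C b a d c"
  unfolding is_pullback_def commutative_square_def by (simp; metis)

lemma inflation_converse [simp]: "inflation (E\<inverse>) f \<longleftrightarrow> deflation E f"
  by (simp add: inflation_def deflation_def)

lemma deflation_converse [simp]: "deflation (E\<inverse>) f \<longleftrightarrow> inflation E f"
  by (simp add: inflation_def deflation_def)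

lemma short_exact_op [simp]:
  "short_exact (op C) (E\<inverse>) X f Y g Z \<longleftrightarrow> short_exact C E Z g Y f X"
  by (auto simp: short_exact_def)

section \<open>Isomorphisms and biproducts\<close>

context category
begin

lemma is_iso_inverse:
  assumes "is_iso C f"
  obtains g where "g \<in> Hom C (Cod C f) (Dom C f)" "g \<cdot> f = Id C (Dom C f)" "f \<cdot> g = Id C (Cod C f)"
    "is_iso C g"
  using assms unfolding is_iso_def Hom_def by auto

lemma is_iso_Id: "X \<in> Obj C \<Longrightarrow> is_iso C (Id C X)"
  unfolding is_iso_def Hom_def by auto

lemma isomorphic_sequences_sym:
  assumes "isomorphic_sequences C (f, g) (f', g')"
  shows "isomorphic_sequences C (f', g') (f, g)"
proof -
  from assms obtain X Y Z X' Y' Z' x y z where h: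
    "f \<in> Hom C X Y" "g \<in> Hom C Y Z" "f' \<in> Hom C X' Y'" "g' \<in> Hom C Y' Z'"
    "x \<in> Hom C X X'" "y \<in> Hom C Y Y'" "z \<in> Hom C Z Z'"
    "is_iso C x" "is_iso C y" "is_iso C z"
    and eq: "y \<cdot> f = f' \<cdot> x" "z \<cdot> g = g' \<cdot> y"
    unfolding isomorphic_sequences_def by auto
  from h(8) obtain x' where x': "x' \<in> Hom C X' X" "x' \<cdot> x = Id C X" "x \<cdot> x' = Id C X'" "is_iso C x'"
    using is_iso_inverse h(5)[THEN Hom_D] by metis
  from h(9) obtain y' where y': "y' \<in> Hom C Y' Y" "y' \<cdot> y = Id C Y" "y \<cdot> y' = Id C Y'" "is_iso C y'"
    using is_iso_inverse h(6)[THEN Hom_D] by metis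
  from h(10) obtain z' where z': "z' \<in> Hom C Z' Z" "z' \<cdot> z = Id C Z" "z \<cdot> z' = Id C Z'" "is_iso C z'"
    using is_iso_inverse h(7)[THEN Hom_D] by metis
  note H = h(1-7)[THEN Hom_D] x'(1)[THEN Hom_D] y'(1)[THEN Hom_D] z'(1)[THEN Hom_D]
  have "y' \<cdot> f' = y' \<cdot> (f' \<cdot> (x \<cdot> x'))" using H x' by simp
  also have "\<dots> = y' \<cdot> ((f' \<cdot> x) \<cdot> x')" using H by simp
  also have "\<dots> = (y' \<cdot> y) \<cdot> (f \<cdot> x')" using H by (simp add: eq(1)[symmetric])
  also have "\<dots> = f \<cdot> x'" using H y' by simp
  finally have 1: "y' \<cdot> f' = f \<cdot> x'" .
  have "z' \<cdot> g' = z' \<cdot> (g' \<cdot> (y \<cdot> y'))" using H y' by simp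
  also have "\<dots> = z' \<cdot> ((g' \<cdot> y) \<cdot> y')" using H by simp
  also have "\<dots> = (z' \<cdot> z) \<cdot> (g \<cdot> y')" using H by (simp add: eq(2)[symmetric])
  also have "\<dots> = g \<cdot> y'" using H z' by simp
  finally have 2: "z' \<cdot> g' = g \<cdot> y'" .
  show ?thesis unfolding isomorphic_sequences_def
    using h x' y' z' 1 2 by blast
qed

end

context preadditive_category
begin

lemma is_biproduct_D:
  assumes "is_biproduct C X1 X2 X i1 i2 p1 p2"
  shows "i1 \<in> Arr C" "Dom C i1 = X1" "Cod C i1 = X"
    "i2 \<in> Arr C" "Dom C i2 = X2" "Cod C i2 = X"
    "p1 \<in> Arr C" "Dom C p1 = X" "Cod C p1 = X1"
    "p2 \<in> Arr C" "Dom C p2 = X" "Cod C p2 = X2"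
    "X1 \<in> Obj C" "X2 \<in> Obj C" "X \<in> Obj C"
    "p1 \<cdot> i1 = Id C X1" "p2 \<cdot> i2 = Id C X2"
    "p1 \<cdot> i2 = Zero C X2 X1" "p2 \<cdot> i1 = Zero C X1 X2"
    "(i1 \<cdot> p1) \<boxplus> (i2 \<cdot> p2) = Id C X"
  using assms by (auto simp: is_biproduct_def dest!: Hom_D)

lemma is_biproduct_swap:
  assumes "is_biproduct C X1 X2 X i1 i2 p1 p2"
  shows "is_biproduct C X2 X1 X i2 i1 p2 p1"
proof -
  note H = is_biproduct_D[OF assms]
  have "(i2 \<cdot> p2) \<boxplus> (i1 \<cdot> p1) = Id C X"
    using H Add_comm[of "i1 \<cdot> p1" "i2 \<cdot> p2"] by simp
  then show ?thesis using assms by (auto simp: is_biproduct_def)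
qed

lemma biproduct_expand:
  assumes "is_biproduct C X1 X2 X i1 i2 p1 p2" "f \<in> Arr C" "Cod C f = X"
  shows "f = (i1 \<cdot> (p1 \<cdot> f)) \<boxplus> (i2 \<cdot> (p2 \<cdot> f))"
proof -
  note H = is_biproduct_D[OF assms(1)]
  have "f = ((i1 \<cdot> p1) \<boxplus> (i2 \<cdot> p2)) \<cdot> f" using H assms by simp
  also have "\<dots> = (i1 \<cdot> (p1 \<cdot> f)) \<boxplus> (i2 \<cdot> (p2 \<cdot> f))" using H(1-15) assms by simp
  finally show ?thesis .
qed

lemma biproduct_expand':
  assumes "is_biproduct C X1 X2 X i1 i2 p1 p2" "f \<in> Arr C" "Dom C f = X"
  shows "f = (f \<cdot> i1 \<cdot> p1) \<boxplus> (f \<cdot> i2 \<cdot> p2)"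
proof -
  note H = is_biproduct_D[OF assms(1)]
  have "f = f \<cdot> ((i1 \<cdot> p1) \<boxplus> (i2 \<cdot> p2))" using H assms by simp
  also have "\<dots> = (f \<cdot> i1 \<cdot> p1) \<boxplus> (f \<cdot> i2 \<cdot> p2)" using H(1-15) assms by simp
  finally show ?thesis .
qed

text \<open>Both conditions say that \<open>f\<close> is the diagonal matrix with entries \<open>f1\<close> and \<open>f2\<close>; this is what makes
  direct sums of sequences a self-dual notion.\<close>

lemma biproduct_morphism_injections:
  assumes X: "is_biproduct C X1 X2 X i1 i2 p1 p2" and Y: "is_biproduct C Y1 Y2 Y j1 j2 q1 q2"
    and f: "f1 \<in> Hom C X1 Y1" "f2 \<in> Hom C X2 Y2" "f \<in> Hom C X Y"
    and q: "q1 \<cdot> f = f1 \<cdot> p1" "q2 \<cdot> f = f2 \<cdot> p2"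
  shows "f \<cdot> i1 = j1 \<cdot> f1" "f \<cdot> i2 = j2 \<cdot> f2"
proof -
  note HX = is_biproduct_D[OF X] and HY = is_biproduct_D[OF Y] and F = f[THEN Hom_D]
  have "f = (j1 \<cdot> (q1 \<cdot> f)) \<boxplus> (j2 \<cdot> (q2 \<cdot> f))" by (rule biproduct_expand[OF Y]) (use F in auto)
  then have e: "f = (j1 \<cdot> (f1 \<cdot> p1)) \<boxplus> (j2 \<cdot> (f2 \<cdot> p2))" by (simp add: q)
  show "f \<cdot> i1 = j1 \<cdot> f1" by (subst e) (use HX HY F in simp)
  show "f \<cdot> i2 = j2 \<cdot> f2" by (subst e) (use HX HY F in simp)
qed

lemma is_direct_sum_of_sequences_op:
  assumes "is_direct_sum_of_sequences (op C) (g1, f1) (g2, f2) (g, f)"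
  shows "is_direct_sum_of_sequences C (f1, g1) (f2, g2) (f, g)"
proof -
  from assms obtain X1 X2 X Y1 Y2 Y Z1 Z2 Z ix1 ix2 px1 px2 iy1 iy2 py1 py2 iz1 iz2 pz1 pz2 where
    h: "f1 \<in> Hom C X1 Y1" "g1 \<in> Hom C Y1 Z1" "f2 \<in> Hom C X2 Y2" "g2 \<in> Hom C Y2 Z2"
      "f \<in> Hom C X Y" "g \<in> Hom C Y Z"
    and b: "is_biproduct C X1 X2 X ix1 ix2 px1 px2" "is_biproduct C Y1 Y2 Y iy1 iy2 py1 py2"
       "is_biproduct C Z1 Z2 Z iz1 iz2 pz1 pz2"
    and e: "py1 \<cdot> f = f1 \<cdot> px1" "py2 \<cdot> f = f2 \<cdot> px2" "pz1 \<cdot> g = g1 \<cdot> py1" "pz2 \<cdot> g = g2 \<cdot> py2"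
    unfolding is_direct_sum_of_sequences_def by auto
  note 1 = biproduct_morphism_injections[OF b(1,2) h(1,3,5) e(1,2)]
    and 2 = biproduct_morphism_injections[OF b(2,3) h(2,4,6) e(3,4)]
  show ?thesis
    unfolding is_direct_sum_of_sequences_def prod.case
    by (intro exI conjI) (rule h b 1 2)+
qed

end

text \<open>The axioms come in dual pairs, except that both closure axioms for direct sums are stated with
  injections. Statements about inflations are transferred to deflations through this lemma.\<close>

lemma exact_category_op:
  fixes C :: "('o, 'm) addcat"
  assumes "exact_category C E"
  shows "exact_category (op C) (E\<inverse>)"
proof -
  interpret exact_category C E by fact
  interpret op: additive_category "op C"
    using additive_category_op additive_category_axioms .
  show ?thesis
  proof (intro exact_category.intro exact_category_axioms.intro op.additive_category_axioms)
    fix s s' :: "'m \<times> 'm"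
    assume s: "s \<in> E\<inverse>" and iso: "isomorphic_sequences (op C) s s'"
    obtain f g f' g' where [simp]: "s = (g, f)" "s' = (g', f')" by (metis surj_pair)
    have "isomorphic_sequences C (f', g') (f, g)"
      using iso unfolding isomorphic_sequences_def by simp metis
    then show "s' \<in> E\<inverse>"
      using s iso_closed[of "(f, g)" "(f', g')"] isomorphic_sequences_sym by simp
  next
    fix s1 s2 s :: "'m \<times> 'm"
    assume s: "s1 \<in> E\<inverse>" "s2 \<in> E\<inverse>" and ds: "is_direct_sum_of_sequences (op C) s1 s2 s"
    obtain f1 g1 f2 g2 f g where [simp]: "s1 = (g1, f1)" "s2 = (g2, f2)" "s = (g, f)"
      by (metis surj_pair)
    have "is_direct_sum_of_sequences C (f1, g1) (f2, g2) (f, g)"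
      using ds is_direct_sum_of_sequences_op by simp
    then show "s \<in> E\<inverse>"
      using s direct_sum_closed[of "(f1, g1)" "(f2, g2)" "(f, g)"] by simp
  next
    fix s1 s2 s :: "'m \<times> 'm"
    assume s: "s \<in> E\<inverse>" and ds: "is_direct_sum_of_sequences (op C) s1 s2 s"
    obtain f1 g1 f2 g2 f g where [simp]: "s1 = (g1, f1)" "s2 = (g2, f2)" "s = (g, f)"
      by (metis surj_pair)
    have "is_direct_sum_of_sequences C (f1, g1) (f2, g2) (f, g)"
      using ds is_direct_sum_of_sequences_op by simp
    then show "s1 \<in> E\<inverse> \<and> s2 \<in> E\<inverse>"
      using s direct_summand_closed[of "(f, g)" "(f1, g1)" "(f2, g2)"] by simp
  next
    fix a b
    assume "inflation (E\<inverse>) a" "b \<in> Arr (op C)" "Dom (op C) a = Dom (op C) b"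
    then show "\<exists>c d. is_pushout (op C) a b c d \<and> inflation (E\<inverse>) d"
      using pullback_deflation[of a b] is_pullback_swap by fastforce
  next
    fix d c
    assume "deflation (E\<inverse>) d" "c \<in> Arr (op C)" "Cod (op C) c = Cod (op C) d"
    then obtain a b where "is_pushout C d c a b" "inflation E b"
      using pushout_inflation[of d c] by auto
    then have "is_pushout C c d b a" "inflation E b" by (auto intro: is_pushout_swap)
    moreover have "is_pullback (op C) b a c d \<longleftrightarrow> is_pushout C c d b a"
      using is_pushout_op[of "op C" c d b a] by simp
    ultimately show "\<exists>a b. is_pullback (op C) a b c d \<and> deflation (E\<inverse>) a" by auto
  qed (use kernel_cokernel_pair Id_inflation Id_deflation Comp_inflation Comp_deflation in auto)
qed

section \<open>Exact categories\<close>

context preadditive_category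
begin

lemma kernel_lift:
  assumes "is_kernel_of C k f" "u \<in> Arr C" "Cod C u = Dom C f" "f \<cdot> u = Zero C (Dom C u) (Cod C f)"
  obtains w where "w \<in> Arr C" "Dom C w = Dom C u" "Cod C w = Dom C k" "k \<cdot> w = u"
proof -
  have "u \<in> Hom C (Dom C u) (Dom C f)" using assms by (simp add: Hom_def)
  then obtain w where "w \<in> Hom C (Dom C u) (Dom C k)" "k \<cdot> w = u"
    using assms(1,4) unfolding is_kernel_of_def by blast
  then show ?thesis using that by (auto simp: Hom_def)
qed

lemma kernel_mono:
  assumes "is_kernel_of C k f" "w \<in> Arr C" "w' \<in> Arr C" "Dom C w' = Dom C w"
    "Cod C w = Dom C k" "Cod C w' = Dom C k" "k \<cdot> w = k \<cdot> w'"
  shows "w = w'"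
proof -
  have k: "k \<in> Arr C" "f \<in> Arr C" "Cod C k = Dom C f" "f \<cdot> k = Zero C (Dom C k) (Cod C f)"
    using assms(1) by (auto simp: is_kernel_of_def)
  have "f \<cdot> (k \<cdot> w) = Zero C (Dom C w) (Cod C f)"
    using k assms Comp_absorb[OF k(4), of w] Cod_Obj by simp
  moreover have "k \<cdot> w \<in> Hom C (Dom C w) (Dom C f)" using k assms by (simp add: Hom_def)
  ultimately have "\<exists>!v. v \<in> Hom C (Dom C w) (Dom C k) \<and> k \<cdot> v = k \<cdot> w"
    using assms(1) unfolding is_kernel_of_def by blast
  then show ?thesis using assms by (auto simp: Hom_def)
qed

lemma cokernel_extend:
  assumes "is_cokernel_of C c f" "u \<in> Arr C" "Dom C u = Cod C f" "u \<cdot> f = Zero C (Dom C f) (Cod C u)"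
  obtains w where "w \<in> Arr C" "Dom C w = Cod C c" "Cod C w = Cod C u" "w \<cdot> c = u"
proof -
  have "u \<in> Hom C (Cod C f) (Cod C u)" using assms by (simp add: Hom_def)
  then obtain w where "w \<in> Hom C (Cod C c) (Cod C u)" "w \<cdot> c = u"
    using assms(1,4) unfolding is_cokernel_of_def by blast
  then show ?thesis using that by (auto simp: Hom_def)
qed

lemma cokernel_epi:
  assumes "is_cokernel_of C c f" "w \<in> Arr C" "w' \<in> Arr C" "Cod C w' = Cod C w"
    "Dom C w = Cod C c" "Dom C w' = Cod C c" "w \<cdot> c = w' \<cdot> c"
  shows "w = w'"
proof -
  interpret op: preadditive_category "op C"
    using preadditive_category_op preadditive_category_axioms .
  show ?thesis using op.kernel_mono[of c f w w'] assms by simp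
qed

lemma is_cokernel_of_I:
  assumes "c \<in> Arr C" "f \<in> Arr C" "Dom C c = Cod C f" "c \<cdot> f = Zero C (Dom C f) (Cod C c)"
    and "\<And>u. \<lbrakk>u \<in> Arr C; Dom C u = Cod C f; u \<cdot> f = Zero C (Dom C f) (Cod C u)\<rbrakk> \<Longrightarrow>
       \<exists>w\<in>Hom C (Cod C c) (Cod C u). w \<cdot> c = u"
    and "\<And>w w'. \<lbrakk>w \<in> Arr C; w' \<in> Arr C; Dom C w = Cod C c; Dom C w' = Cod C c; Cod C w' = Cod C w;
       w \<cdot> c = w' \<cdot> c\<rbrakk> \<Longrightarrow> w = w'"
  shows "is_cokernel_of C c f"
proof -
  have "\<exists>!w. w \<in> Hom C (Cod C c) T \<and> w \<cdot> c = u"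
    if "u \<in> Hom C (Cod C f) T" "u \<cdot> f = Zero C (Dom C f) T" for T u
  proof -
    have u: "u \<in> Arr C" "Dom C u = Cod C f" "Cod C u = T" using that by (auto simp: Hom_def)
    with assms(5)[of u] that(2) obtain w where "w \<in> Hom C (Cod C c) T" "w \<cdot> c = u" by auto
    moreover have "w' = w" if "w' \<in> Hom C (Cod C c) T \<and> w' \<cdot> c = u" for w'
      using that calculation assms(6)[of w' w] by (auto simp: Hom_def)
    ultimately show ?thesis by blast
  qed
  then show ?thesis using assms(1-4) unfolding is_cokernel_of_def by blast
qed

lemma is_pushout_D:
  assumes "is_pushout C a b c d"
  shows "a \<in> Arr C" "b \<in> Arr C" "c \<in> Arr C" "d \<in> Arr C"
    "Dom C a = Dom C b" "Cod C a = Dom C c" "Cod C b = Dom C d" "Cod C c = Cod C d"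
    "c \<cdot> a = d \<cdot> b"
  using assms by (auto simp: is_pushout_def commutative_square_def)

lemma pushout_extend:
  assumes "is_pushout C a b c d" "u \<in> Arr C" "v \<in> Arr C" "Dom C u = Cod C a" "Dom C v = Cod C b"
    "Cod C v = Cod C u" "u \<cdot> a = v \<cdot> b"
  obtains w where "w \<in> Arr C" "Dom C w = Cod C c" "Cod C w = Cod C u" "w \<cdot> c = u" "w \<cdot> d = v"
proof -
  have "u \<in> Hom C (Cod C a) (Cod C u)" "v \<in> Hom C (Cod C b) (Cod C u)"
    using assms by (auto simp: Hom_def)
  then have "\<exists>!w. w \<in> Hom C (Cod C c) (Cod C u) \<and> w \<cdot> c = u \<and> w \<cdot> d = v"
    using assms(1,7) unfolding is_pushout_def by blast
  then show ?thesis using that by (auto simp: Hom_def)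
qed

lemma pushout_unique:
  assumes "is_pushout C a b c d" "w \<in> Arr C" "w' \<in> Arr C" "Dom C w = Cod C c" "Dom C w' = Cod C c"
    "Cod C w' = Cod C w" "w \<cdot> c = w' \<cdot> c" "w \<cdot> d = w' \<cdot> d"
  shows "w = w'"
proof -
  note D = is_pushout_D[OF assms(1)]
  have "w \<cdot> c \<in> Hom C (Cod C a) (Cod C w)" "w \<cdot> d \<in> Hom C (Cod C b) (Cod C w)"
    using assms D by (auto simp: Hom_def)
  moreover have "(w \<cdot> c) \<cdot> a = (w \<cdot> d) \<cdot> b" using assms D by simp
  ultimately have "\<exists>!v. v \<in> Hom C (Cod C c) (Cod C w) \<and> v \<cdot> c = w \<cdot> c \<and> v \<cdot> d = w \<cdot> d"
    using assms(1) unfolding is_pushout_def by blast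
  then show ?thesis using assms by (auto simp: Hom_def)
qed

lemma pushout_iso:
  assumes "is_pushout C a b c d" "is_pushout C a b c' d'"
  obtains w where "is_iso C w" "w \<in> Hom C (Cod C c) (Cod C c')" "w \<cdot> c = c'" "w \<cdot> d = d'"
proof -
  note D = is_pushout_D[OF assms(1)] is_pushout_D[OF assms(2)]
  obtain w where w: "w \<in> Arr C" "Dom C w = Cod C c" "Cod C w = Cod C c'" "w \<cdot> c = c'" "w \<cdot> d = d'"
    by (rule pushout_extend[OF assms(1), of c' d']) (use D in auto)
  obtain v where v: "v \<in> Arr C" "Dom C v = Cod C c'" "Cod C v = Cod C c" "v \<cdot> c' = c" "v \<cdot> d' = d"
    by (rule pushout_extend[OF assms(2), of c d]) (use D in auto)
  have "v \<cdot> w = Id C (Cod C c)"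
    by (rule pushout_unique[OF assms(1)]) (use D w v Cod_Obj in simp_all)
  moreover have "w \<cdot> v = Id C (Cod C c')"
    by (rule pushout_unique[OF assms(2)]) (use D w v Cod_Obj in simp_all)
  ultimately show ?thesis using that w v by (auto simp: is_iso_def Hom_def)
qed

lemma cokernel_iso:
  assumes "is_cokernel_of C c f" "is_cokernel_of C c' f"
  obtains w where "is_iso C w" "w \<in> Hom C (Cod C c) (Cod C c')" "w \<cdot> c = c'"
proof -
  have D: "c \<in> Arr C" "c' \<in> Arr C" "f \<in> Arr C" "Dom C c = Cod C f" "Dom C c' = Cod C f"
    "c \<cdot> f = Zero C (Dom C f) (Cod C c)" "c' \<cdot> f = Zero C (Dom C f) (Cod C c')"
    using assms by (auto simp: is_cokernel_of_def)
  obtain w where w: "w \<in> Arr C" "Dom C w = Cod C c" "Cod C w = Cod C c'" "w \<cdot> c = c'"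
    by (rule cokernel_extend[OF assms(1), of c']) (use D in auto)
  obtain v where v: "v \<in> Arr C" "Dom C v = Cod C c'" "Cod C v = Cod C c" "v \<cdot> c' = c"
    by (rule cokernel_extend[OF assms(2), of c]) (use D in auto)
  have "v \<cdot> w = Id C (Cod C c)"
    by (rule cokernel_epi[OF assms(1)]) (use D w v Cod_Obj in simp_all)
  moreover have "w \<cdot> v = Id C (Cod C c')"
    by (rule cokernel_epi[OF assms(2)]) (use D w v Cod_Obj in simp_all)
  ultimately show ?thesis using that w v by (auto simp: is_iso_def Hom_def)
qed

text \<open>A morphism that kills \<open>a k\<close> restricts along \<open>a\<close> to one that factors through \<open>b\<close>, and these two
  maps glue over the pushout.\<close>

lemma cokernel_pushout:
  assumes po: "is_pushout C a b c d" and ck: "is_cokernel_of C b k"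
  shows "is_cokernel_of C c (a \<cdot> k)"
proof (rule is_cokernel_of_I)
  note D = is_pushout_D[OF po]
  have K: "k \<in> Arr C" "Dom C b = Cod C k" "b \<cdot> k = Zero C (Dom C k) (Cod C b)"
    using ck by (auto simp: is_cokernel_of_def)
  show "c \<in> Arr C" "a \<cdot> k \<in> Arr C" "Dom C c = Cod C (a \<cdot> k)" using D K by auto
  have "c \<cdot> (a \<cdot> k) = d \<cdot> (b \<cdot> k)" using Comp_absorb[OF D(9), of k] D K by simp
  then show "c \<cdot> (a \<cdot> k) = Zero C (Dom C (a \<cdot> k)) (Cod C c)"
    using D K Dom_Obj by simp
  {
    fix u assume u: "u \<in> Arr C" "Dom C u = Cod C (a \<cdot> k)"
      "u \<cdot> (a \<cdot> k) = Zero C (Dom C (a \<cdot> k)) (Cod C u)"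
    obtain v where v: "v \<in> Arr C" "Dom C v = Cod C b" "Cod C v = Cod C (u \<cdot> a)" "v \<cdot> b = u \<cdot> a"
      by (rule cokernel_extend[OF ck, of "u \<cdot> a"]) (use D K u in auto)
    obtain w where "w \<in> Arr C" "Dom C w = Cod C c" "Cod C w = Cod C u" "w \<cdot> c = u"
      by (rule pushout_extend[OF po, of u v]) (use D K u v in auto)
    then show "\<exists>w\<in>Hom C (Cod C c) (Cod C u). w \<cdot> c = u" by (auto simp: Hom_def)
  next
    fix w w'
    assume w: "w \<in> Arr C" "w' \<in> Arr C" "Dom C w = Cod C c" "Dom C w' = Cod C c" "Cod C w' = Cod C w"
       "w \<cdot> c = w' \<cdot> c"
    have "(w \<cdot> d) \<cdot> b = (w \<cdot> c) \<cdot> a" using w(1,3) D by simp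
    also have "\<dots> = (w' \<cdot> d) \<cdot> b" using w(2,4) D by (simp add: w(6))
    finally have wd: "(w \<cdot> d) \<cdot> b = (w' \<cdot> d) \<cdot> b" .
    have "w \<cdot> d = w' \<cdot> d"
      by (rule cokernel_epi[OF ck _ _ _ _ _ wd]) (use D w(1-5) in auto)
    then show "w = w'" using pushout_unique[OF po w(1,2,3,4,5,6)] by blast
  }
qed

text \<open>The second projection of the biproduct arises by factoring \<open>1 - s p\<close> through the kernel.\<close>

lemma split_biproduct:
  assumes k: "is_kernel_of C k p" and s: "s \<in> Arr C" "Dom C s = Cod C p" "Cod C s = Dom C p"
    "p \<cdot> s = Id C (Cod C p)"
  obtains r where "is_biproduct C (Dom C k) (Cod C p) (Dom C p) k s r p"
proof -
  have K: "k \<in> Arr C" "p \<in> Arr C" "Cod C k = Dom C p" "p \<cdot> k = Zero C (Dom C k) (Cod C p)"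
    using k by (auto simp: is_kernel_of_def)
  have O: "Dom C k \<in> Obj C" "Cod C p \<in> Obj C" "Dom C p \<in> Obj C" using K Dom_Obj Cod_Obj by auto
  have ps: "p \<cdot> (s \<cdot> f) = f" if "f \<in> Arr C" "Cod C f = Cod C p" for f
    using Comp_absorb[OF s(4), of f] that s K by simp
  obtain r where r: "r \<in> Arr C" "Dom C r = Dom C p" "Cod C r = Dom C k" "k \<cdot> r = Id C (Dom C p) \<boxminus> s \<cdot> p"
    by (rule kernel_lift[OF k, of "Id C (Dom C p) \<boxminus> s \<cdot> p"]) (use K O s ps in auto)
  have rk: "r \<cdot> k = Id C (Dom C k)"
  proof (rule kernel_mono[OF k])
    have "k \<cdot> (r \<cdot> k) = k" using Comp_absorb[OF r(4), of k] r K O s by simp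
    then show "k \<cdot> (r \<cdot> k) = k \<cdot> Id C (Dom C k)" using K O by simp
  qed (use r K O in auto)
  have rs: "r \<cdot> s = Zero C (Cod C p) (Dom C k)"
  proof (rule kernel_mono[OF k])
    have "k \<cdot> (r \<cdot> s) = Zero C (Cod C p) (Dom C p)" using Comp_absorb[OF r(4), of s] r K O s by simp
    then show "k \<cdot> (r \<cdot> s) = k \<cdot> Zero C (Cod C p) (Dom C k)" using K O by simp
  qed (use r K O s in auto)
  have "(k \<cdot> r) \<boxplus> (s \<cdot> p) = Id C (Dom C p)" using r K O s by simp
  with rk rs K O s r have "is_biproduct C (Dom C k) (Cod C p) (Dom C p) k s r p"
    by (auto simp: is_biproduct_def Hom_def)
  then show ?thesis by (rule that)
qed

end

context exact_category
begin

abbreviation ses where "ses \<equiv> short_exact C E"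

lemma ses_D:
  assumes "ses X f Y g Z"
  shows "(f, g) \<in> E" "f \<in> Arr C" "Dom C f = X" "Cod C f = Y" "g \<in> Arr C" "Dom C g = Y" "Cod C g = Z"
    "X \<in> Obj C" "Y \<in> Obj C" "Z \<in> Obj C" "g \<cdot> f = Zero C X Z"
    "is_kernel_of C f g" "is_cokernel_of C g f"
  using assms kernel_cokernel_pair[of f g]
  by (auto simp: short_exact_def is_kernel_of_def dest!: Hom_D)

lemma ses_I: "(f, g) \<in> E \<Longrightarrow> ses (Dom C f) f (Cod C f) g (Cod C g)"
  using kernel_cokernel_pair[of f g] by (auto simp: short_exact_def is_kernel_of_def Hom_def)

lemma exact_dual: "exact_category (op C) (E\<inverse>)"
  using exact_category_op exact_category_axioms .

lemma inflation_with_cokernel: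
  assumes "inflation E f" "is_cokernel_of C g f"
  shows "(f, g) \<in> E"
proof -
  from assms(1) obtain g0 where g0: "(f, g0) \<in> E" by (auto simp: inflation_def)
  note D = ses_D[OF ses_I[OF g0]]
  obtain w where w: "is_iso C w" "w \<in> Hom C (Cod C g0) (Cod C g)" "w \<cdot> g0 = g"
    using cokernel_iso D(13) assms(2) by blast
  have g: "g \<in> Arr C" "Dom C g = Cod C f" using assms(2) by (auto simp: is_cokernel_of_def)
  have "isomorphic_sequences C (f, g0) (f, g)"
    unfolding isomorphic_sequences_def prod.case
    by (rule exI[of _ "Dom C f"], rule exI[of _ "Cod C f"], rule exI[of _ "Cod C g0"],
        rule exI[of _ "Dom C f"], rule exI[of _ "Cod C f"], rule exI[of _ "Cod C g"],
        rule exI[of _ "Id C (Dom C f)"], rule exI[of _ "Id C (Cod C f)"], rule exI[of _ w])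
      (use D w g is_iso_Id in \<open>auto simp: Hom_def\<close>)
  then show ?thesis using iso_closed g0 by blast
qed

lemma inflation_Comp_iso:
  assumes "inflation E f" "is_iso C w" "w \<in> Hom C (Cod C f) Y"
  shows "inflation E (w \<cdot> f)"
proof -
  from assms(1) obtain g0 where g0: "(f, g0) \<in> E" by (auto simp: inflation_def)
  note D = ses_D[OF ses_I[OF g0]]
  have W: "w \<in> Arr C" "Dom C w = Cod C f" "Cod C w = Y" using assms(3) by (auto simp: Hom_def)
  obtain v where v: "v \<in> Hom C Y (Cod C f)" "v \<cdot> w = Id C (Cod C f)" "w \<cdot> v = Id C Y" "is_iso C v"
    using is_iso_inverse[OF assms(2)] W by metis
  have V: "v \<in> Arr C" "Dom C v = Y" "Cod C v = Cod C f" using v by (auto simp: Hom_def)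
  have "isomorphic_sequences C (f, g0) (w \<cdot> f, g0 \<cdot> v)"
    unfolding isomorphic_sequences_def prod.case
    by (rule exI[of _ "Dom C f"], rule exI[of _ "Cod C f"], rule exI[of _ "Cod C g0"],
        rule exI[of _ "Dom C f"], rule exI[of _ Y], rule exI[of _ "Cod C g0"],
        rule exI[of _ "Id C (Dom C f)"], rule exI[of _ w], rule exI[of _ "Id C (Cod C g0)"])
      (use D W V v assms is_iso_Id in \<open>auto simp: Hom_def\<close>)
  then show ?thesis using iso_closed g0 unfolding inflation_def by blast
qed

text \<open>The axioms only provide some pushout of an inflation in which the opposite side is an inflation;
  uniqueness of pushouts transfers this to all of them. The map \<open>q\<close> is induced by \<open>p\<close> and \<open>0\<close>, and
  it is a cokernel of \<open>d\<close> because a morphism out of the pushout that kills \<open>d\<close> restricts along \<open>c\<close>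
  to one that kills \<open>a\<close>.\<close>

lemma pushout_ses:
  assumes po: "is_pushout C a b c d" and ap: "ses (Dom C a) a (Cod C a) p Z"
  obtains q where "ses (Dom C d) d (Cod C d) q Z" "q \<cdot> c = p"
proof -
  note D = is_pushout_D[OF po] and P = ses_D[OF ap]
  have infl: "inflation E d"
  proof -
    have "inflation E a" using P(1) by (auto simp: inflation_def)
    with pushout_inflation D obtain c' d' where po': "is_pushout C a b c' d'" "inflation E d'" by blast
    obtain w where "is_iso C w" "w \<in> Hom C (Cod C c') (Cod C c)" "w \<cdot> d' = d"
      using pushout_iso[OF po'(1) po] by blast
    then show ?thesis using inflation_Comp_iso[of d' w] po' is_pushout_D(8)[OF po'(1)] by metis
  qed
  have "p \<cdot> a = Zero C (Cod C b) Z \<cdot> b" using P D by simp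
  then obtain q where q: "q \<in> Arr C" "Dom C q = Cod C c" "Cod C q = Z" "q \<cdot> c = p"
      "q \<cdot> d = Zero C (Cod C b) Z"
    by (rule pushout_extend[OF po, rotated 5]) (use D P Cod_Obj in auto)
  have "is_cokernel_of C q d"
  proof (rule is_cokernel_of_I)
    show "q \<in> Arr C" "d \<in> Arr C" "Dom C q = Cod C d" "q \<cdot> d = Zero C (Dom C d) (Cod C q)"
      using q D by auto
    fix u assume u: "u \<in> Arr C" "Dom C u = Cod C d" "u \<cdot> d = Zero C (Dom C d) (Cod C u)"
    have "(u \<cdot> c) \<cdot> a = (u \<cdot> d) \<cdot> b" using u(1,2) D by simp
    then have ua: "u \<cdot> c \<cdot> a = Zero C (Dom C a) (Cod C u)" using u D Cod_Obj by simp
    obtain v where v: "v \<in> Arr C" "Dom C v = Cod C p" "Cod C v = Cod C u" "v \<cdot> p = u \<cdot> c"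
      by (rule cokernel_extend[OF P(13), of "u \<cdot> c"]) (use D u P ua in auto)
    have "v \<cdot> q = u"
    proof (rule pushout_unique[OF po])
      show "(v \<cdot> q) \<cdot> c = u \<cdot> c" using v q D P by simp
      show "(v \<cdot> q) \<cdot> d = u \<cdot> d" using v q D P u Dom_Obj by simp
    qed (use v q D P u in auto)
    then show "\<exists>w\<in>Hom C (Cod C q) (Cod C u). w \<cdot> q = u" using v q P by (auto simp: Hom_def)
  next
    fix w w'
    assume w: "w \<in> Arr C" "w' \<in> Arr C" "Dom C w = Cod C q" "Dom C w' = Cod C q" "Cod C w' = Cod C w"
      "w \<cdot> q = w' \<cdot> q"
    have "w \<cdot> p = (w \<cdot> q) \<cdot> c" using w(1,3) q D by simp
    also have "\<dots> = w' \<cdot> p" using w(2,4) q D by (simp add: w(6))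
    finally show "w = w'" using cokernel_epi[OF P(13), of w w'] w q P by simp
  qed
  with infl have "(d, q) \<in> E" by (rule inflation_with_cokernel)
  then have "ses (Dom C d) d (Cod C d) q Z" using ses_I q by metis
  with q that show ?thesis by blast
qed

lemma ses_pushout:
  assumes "ses X a Y p Z" "b \<in> Hom C X X'"
  obtains c d q P where "is_pushout C a b c d" "ses X' d P q Z" "q \<cdot> c = p" "c \<in> Hom C Y P"
proof -
  note P = ses_D[OF assms(1)] and B = assms(2)[THEN Hom_D]
  have "inflation E a" using P(1) by (auto simp: inflation_def)
  then obtain c d where po: "is_pushout C a b c d" using pushout_inflation[of a b] P B by auto
  note D = is_pushout_D[OF po]
  have "ses (Dom C a) a (Cod C a) p Z" using assms P by simp
  from pushout_ses[OF po this] obtain q where "ses (Dom C d) d (Cod C d) q Z" "q \<cdot> c = p" .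
  then show ?thesis using that[OF po, of "Cod C d" q] D P B by (auto simp: Hom_def)
qed

lemma ses_pullback:
  assumes "ses X f Y g Z" "h \<in> Hom C Z' Z"
  obtains k a b P where "is_pullback C a b h g" "ses X k P a Z'" "b \<cdot> k = f" "b \<in> Hom C P Y"
proof -
  interpret op: exact_category "op C" "E\<inverse>" by (rule exact_dual)
  have "op.ses Z g Y f X" "h \<in> Hom (op C) Z Z'" using assms by auto
  then obtain c d q P where *: "is_pushout (op C) g h c d"
    "op.ses Z' d P q X" "q \<cdot>\<^bsub>op C\<^esub> c = f" "c \<in> Hom (op C) Y P" by (rule op.ses_pushout)
  then have "is_pullback C d c h g" using is_pullback_swap by auto
  then show ?thesis by (rule that[of d c q P]) (use * in auto)
qed

text \<open>The third isomorphism theorem for a composite of two inflations.\<close>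

lemma ses_Comp_inflation:
  assumes 1: "ses X f Y g Z" and 2: "ses Y f' Y' g' Z'"
  obtains Q c d q where "ses X (f' \<cdot> f) Y' c Q" "ses Z d Q q Z'" "q \<cdot> c = g'" "is_pushout C f' g c d"
proof -
  note D1 = ses_D[OF 1] and D2 = ses_D[OF 2]
  have "g \<in> Hom C Y Z" using D1 by (auto simp: Hom_def)
  with 2 obtain c d q Q where
    *: "is_pushout C f' g c d" "ses Z d Q q Z'" "q \<cdot> c = g'" "c \<in> Hom C Y' Q"
    by (rule ses_pushout)
  have "inflation E (f' \<cdot> f)"
    using Comp_inflation[of f f'] D1 D2 by (auto simp: inflation_def)
  with cokernel_pushout[OF *(1) D1(13)] have "(f' \<cdot> f, c) \<in> E"
    by (rule inflation_with_cokernel[rotated])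
  then have "ses X (f' \<cdot> f) Y' c Q"
    using ses_I[of "f' \<cdot> f" c] D1 D2 * by (auto simp: Hom_def)
  then show ?thesis using that * by blast
qed

lemma ses_Comp_deflation:
  assumes 1: "ses X f Y g Z" and 2: "ses X' f' Z g' Z'"
  obtains L j k q where "ses L j Y (g' \<cdot> g) Z'" "ses X k L q X'" "j \<cdot> k = f" "is_pullback C j q g f'"
proof -
  interpret op: exact_category "op C" "E\<inverse>" by (rule exact_dual)
  have "op.ses Z' g' Z f' X'" "op.ses Z g Y f X" using 1 2 by auto
  then obtain Q c d q where *:
    "op.ses Z' (g \<cdot>\<^bsub>op C\<^esub> g') Y c Q" "op.ses X' d Q q X" "q \<cdot>\<^bsub>op C\<^esub> c = f"
    "is_pushout (op C) g f' c d" by (rule op.ses_Comp_inflation)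
  then show ?thesis by (intro that[of Q c q d]) auto
qed

lemma ses_split_section:
  assumes "ses X f Y g Z" "s \<in> Hom C Z Y" "g \<cdot> s = Id C Z"
  obtains r where "is_biproduct C X Z Y f s r g"
proof -
  note D = ses_D[OF assms(1)]
  show ?thesis
    by (rule split_biproduct[OF D(12), of s]) (use that D assms in \<open>auto simp: Hom_def\<close>)
qed

lemma ses_split_retraction:
  assumes "ses X f Y g Z" "r \<in> Hom C Y X" "r \<cdot> f = Id C X"
  obtains s where "is_biproduct C X Z Y f s r g"
proof -
  interpret op: exact_category "op C" "E\<inverse>" by (rule exact_dual)
  obtain s where "is_biproduct (op C) Z X Y g r s f"
    by (rule op.ses_split_section[of Z g Y f X r]) (use assms in auto)
  then have "is_biproduct C X Z Y f s r g" using is_biproduct_swap by simp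
  then show ?thesis by (rule that)
qed

end

section \<open>Direct sums in exact categories\<close>

context preadditive_category
begin

lemma is_pushout_I:
  assumes "a \<in> Arr C" "b \<in> Arr C" "c \<in> Arr C" "d \<in> Arr C"
    "Dom C a = Dom C b" "Cod C a = Dom C c" "Cod C b = Dom C d" "Cod C c = Cod C d" "c \<cdot> a = d \<cdot> b"
    and ext: "\<And>u v. \<lbrakk>u \<in> Arr C; v \<in> Arr C; Dom C u = Cod C a; Dom C v = Cod C b; Cod C v = Cod C u;
       u \<cdot> a = v \<cdot> b\<rbrakk> \<Longrightarrow> \<exists>w\<in>Hom C (Cod C c) (Cod C u). w \<cdot> c = u \<and> w \<cdot> d = v"
    and uniq: "\<And>w w'. \<lbrakk>w \<in> Arr C; w' \<in> Arr C; Dom C w = Cod C c; Dom C w' = Cod C c;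
       Cod C w' = Cod C w; w \<cdot> c = w' \<cdot> c; w \<cdot> d = w' \<cdot> d\<rbrakk> \<Longrightarrow> w = w'"
  shows "is_pushout C a b c d"
proof -
  have "\<exists>!w. w \<in> Hom C (Cod C c) T \<and> w \<cdot> c = u \<and> w \<cdot> d = v"
    if h: "u \<in> Hom C (Cod C a) T" "v \<in> Hom C (Cod C b) T" "u \<cdot> a = v \<cdot> b" for T u v
  proof -
    have u: "u \<in> Arr C" "Dom C u = Cod C a" "Cod C u = T" "v \<in> Arr C" "Dom C v = Cod C b" "Cod C v = T"
      using h by (auto simp: Hom_def)
    with ext[of u v] h(3) obtain w where w: "w \<in> Hom C (Cod C c) T" "w \<cdot> c = u" "w \<cdot> d = v" by auto
    moreover have "w' = w" if "w' \<in> Hom C (Cod C c) T \<and> w' \<cdot> c = u \<and> w' \<cdot> d = v" for w'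
      using that w uniq[of w' w] by (auto simp: Hom_def)
    ultimately show ?thesis by blast
  qed
  then show ?thesis
    using assms(1-9) unfolding is_pushout_def commutative_square_def by simp
qed

text \<open>The two legs are zero, so that gluing over the square imposes no condition whatever \<open>N\<close> is.\<close>

lemma biproduct_pushout:
  assumes b: "is_biproduct C X Z Y i1 i2 p1 p2" and N: "N \<in> Obj C"
  shows "is_pushout C (Zero C N Z) (Zero C N X) i2 i1"
proof (rule is_pushout_I)
  note D = is_biproduct_D[OF b]
  show "Zero C N Z \<in> Arr C" "Zero C N X \<in> Arr C" "i2 \<in> Arr C" "i1 \<in> Arr C"
    "Dom C (Zero C N Z) = Dom C (Zero C N X)" "Cod C (Zero C N Z) = Dom C i2"
    "Cod C (Zero C N X) = Dom C i1" "Cod C i2 = Cod C i1" "i2 \<cdot> Zero C N Z = i1 \<cdot> Zero C N X"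
    using D N by simp_all
  {
    fix u v assume "u \<in> Arr C" "v \<in> Arr C" "Dom C u = Cod C (Zero C N Z)"
      "Dom C v = Cod C (Zero C N X)" "Cod C v = Cod C u"
    then have "v \<cdot> p1 \<boxplus> u \<cdot> p2 \<in> Hom C (Cod C i2) (Cod C u)"
      "(v \<cdot> p1 \<boxplus> u \<cdot> p2) \<cdot> i2 = u" "(v \<cdot> p1 \<boxplus> u \<cdot> p2) \<cdot> i1 = v"
      using D N by (simp_all add: Hom_def)
    then show "\<exists>w\<in>Hom C (Cod C i2) (Cod C u). w \<cdot> i2 = u \<and> w \<cdot> i1 = v" by blast
  next
    fix w w' assume w: "w \<in> Arr C" "w' \<in> Arr C" "Dom C w = Cod C i2" "Dom C w' = Cod C i2"
      "w \<cdot> i2 = w' \<cdot> i2" "w \<cdot> i1 = w' \<cdot> i1"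
    have "w = (w \<cdot> i1 \<cdot> p1) \<boxplus> (w \<cdot> i2 \<cdot> p2)" using biproduct_expand'[OF b, of w] w D by simp
    also have "\<dots> = (w' \<cdot> i1 \<cdot> p1) \<boxplus> (w' \<cdot> i2 \<cdot> p2)" by (simp only: w)
    also have "\<dots> = w'" using biproduct_expand'[OF b, of w'] w D by simp
    finally show "w = w'" .
  }
qed

end

context exact_category
begin

text \<open>The identity of \<open>Z\<close> is a deflation, and its kernel \<open>k\<close> is a zero morphism. Hence a biproduct is a
  pushout of the inflation \<open>k\<close>, and its injection inherits the cokernel of \<open>k\<close>.\<close>

lemma biproduct_ses:
  assumes b: "is_biproduct C X Z Y i1 i2 p1 p2"
  shows "ses X i1 Y p2 Z"
proof -
  note D = is_biproduct_D[OF b]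
  obtain k where "(k, Id C Z) \<in> E" using Id_deflation D(14) by (auto simp: deflation_def)
  note k = ses_I[OF this]
  note K = ses_D[OF k]
  have k0: "k = Zero C (Dom C k) Z" using K D by simp
  have "is_pushout C k (Zero C (Dom C k) X) i2 i1"
    using biproduct_pushout[OF b, of "Dom C k"] K k0 by simp
  then obtain q where q: "ses (Dom C i1) i1 (Cod C i1) q Z" "q \<cdot> i2 = Id C Z"
    by (rule pushout_ses[of k "Zero C (Dom C k) X" i2 i1 "Id C Z" Z]) (use k K D in auto)
  note Q = ses_D[OF q(1)]
  have "q = (q \<cdot> i1 \<cdot> p1) \<boxplus> (q \<cdot> i2 \<cdot> p2)" by (rule biproduct_expand'[OF b]) (use Q D in auto)
  also have "\<dots> = p2"
    using Q D q(2) Comp_absorb[OF Q(11), of p1] Comp_absorb[OF q(2), of p2] by simp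
  finally show ?thesis using q D by simp
qed

lemma pullback_of_deflation:
  assumes "is_pullback C a b c d" "deflation E d"
  shows "deflation E a"
proof -
  interpret op: exact_category "op C" "E\<inverse>" by (rule exact_dual)
  from assms(2) obtain k where "(k, d) \<in> E" by (auto simp: deflation_def)
  then have s: "op.ses (Dom (op C) d) d (Cod (op C) d) k (Dom C k)"
    using ses_I[of k d] ses_D[OF ses_I[of k d]] by simp
  have po: "is_pushout (op C) d c b a" using is_pullback_swap[OF assms(1)] by simp
  obtain q where "op.ses (Dom (op C) a) a (Cod (op C) a) q (Dom C k)"
    by (rule op.pushout_ses[OF po s])
  then have "(q, a) \<in> E" by (simp add: short_exact_def)
  then show ?thesis unfolding deflation_def by blast
qed

text \<open>The diagonal morphism is the pullback of \<open>w\<close> along the projection onto \<open>D\<close>.\<close>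

lemma deflation_sum_Id:
  assumes b: "is_biproduct C B W X i1 i2 p1 p2" and b': "is_biproduct C B D Y j1 j2 q1 q2"
    and w: "deflation E w" "w \<in> Hom C W D"
  shows "deflation E (j1 \<cdot> p1 \<boxplus> j2 \<cdot> w \<cdot> p2)"
proof -
  note H = is_biproduct_D[OF b] and H' = is_biproduct_D[OF b'] and W = w(2)[THEN Hom_D]
  interpret op: preadditive_category "op C"
    using preadditive_category_op preadditive_category_axioms .
  define a where "a = j1 \<cdot> p1 \<boxplus> j2 \<cdot> w \<cdot> p2"
  have a: "a \<in> Arr C" "Dom C a = X" "Cod C a = Y" "q2 \<cdot> a = w \<cdot> p2" "q1 \<cdot> a = p1"
    unfolding a_def using H H' W
      Comp_absorb[OF H'(16)] Comp_absorb[OF H'(17)] Comp_absorb[OF H'(18)] Comp_absorb[OF H'(19)]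
    by simp_all
  \<comment> \<open>This is the pullback square with sides \<open>a\<close>, \<open>p2\<close>, \<open>q2\<close>, \<open>w\<close>, read in the opposite category.\<close>
  have "is_pushout (op C) q2 w a p2"
  proof (rule op.is_pushout_I, goal_cases)
    case (10 u v)
    then have uv: "u \<in> Arr C" "v \<in> Arr C" "Cod C u = Y" "Cod C v = W" "Dom C u = Dom C v"
      "q2 \<cdot> u = w \<cdot> v" using H H' W by simp_all
    let ?x = "i1 \<cdot> q1 \<cdot> u \<boxplus> i2 \<cdot> v"
    have p: "p1 \<cdot> ?x = q1 \<cdot> u" "p2 \<cdot> ?x = v"
      using H H' W uv
        Comp_absorb[OF H(16)] Comp_absorb[OF H(17)] Comp_absorb[OF H(18)] Comp_absorb[OF H(19)]
      by simp_all
    have x: "?x \<in> Arr C" "Dom C ?x = Dom C u" "Cod C ?x = X" using H H' W uv by simp_all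
    have "a \<cdot> ?x = j1 \<cdot> (p1 \<cdot> ?x) \<boxplus> j2 \<cdot> (w \<cdot> (p2 \<cdot> ?x))"
      using H(1-15) H'(1-15) W x unfolding a_def by (simp del: Comp_Add)
    also have "\<dots> = j1 \<cdot> (q1 \<cdot> u) \<boxplus> j2 \<cdot> (q2 \<cdot> u)" by (simp only: p uv(6))
    also have "\<dots> = u" using biproduct_expand[OF b', of u] uv by simp
    finally show ?case
      using p x uv a by (intro bexI[of _ ?x]) (simp_all add: Hom_def)
  next
    case (11 x x')
    then have x: "x \<in> Arr C" "x' \<in> Arr C" "Cod C x = X" "Cod C x' = X" "Dom C x' = Dom C x"
      "a \<cdot> x = a \<cdot> x'" "p2 \<cdot> x = p2 \<cdot> x'" using a by simp_all
    have e: "p1 \<cdot> x = p1 \<cdot> x'"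
      using Comp_absorb[OF a(5), of x] Comp_absorb[OF a(5), of x'] x a H' by simp
    have "x = (i1 \<cdot> (p1 \<cdot> x)) \<boxplus> (i2 \<cdot> (p2 \<cdot> x))" using biproduct_expand[OF b, of x] x by simp
    also have "\<dots> = x'" using biproduct_expand[OF b, of x'] x by (simp only: e x)
    finally show ?case .
  qed (use a H H' W in simp_all)
  then show ?thesis using pullback_of_deflation w(1) unfolding a_def by auto
qed

text \<open>Shearing turns the projection of a biproduct into an arbitrary copairing with an
  identity, so a copairing is a deflation as soon as one of its components is.\<close>

lemma deflation_copair:
  assumes b: "is_biproduct C B W X i1 i2 p1 p2"
    and w: "deflation E w" "w \<in> Hom C W D" and g: "g \<in> Hom C B D"
  shows "deflation E (g \<cdot> p1 \<boxplus> w \<cdot> p2)"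
proof -
  note H = is_biproduct_D[OF b] and W = w(2)[THEN Hom_D] and G = g[THEN Hom_D]
  obtain Y j1 j2 q1 q2 where b': "is_biproduct C B D Y j1 j2 q1 q2"
    using ex_biproduct[of B D] G by blast
  note H' = is_biproduct_D[OF b']
  note ab = Comp_absorb[OF H'(16)] Comp_absorb[OF H'(17)] Comp_absorb[OF H'(18)]
    Comp_absorb[OF H'(19)]
  \<comment> \<open>The shear sends the projection \<open>q2\<close> to the copairing of \<open>g\<close> with the identity of \<open>D\<close>.\<close>
  have "is_biproduct C B D Y (j1 \<boxminus> j2 \<cdot> g) j2 q1 (q2 \<boxplus> g \<cdot> q1)"
  proof -
    have 1: "q1 \<cdot> (j1 \<boxminus> j2 \<cdot> g) = Id C B" using H' G ab by simp
    have 2: "(q2 \<boxplus> g \<cdot> q1) \<cdot> j2 = Id C D" using H' G ab by simp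
    have 3: "(q2 \<boxplus> g \<cdot> q1) \<cdot> (j1 \<boxminus> j2 \<cdot> g) = Zero C B D" using H' G ab by simp
    have "(j1 \<boxminus> j2 \<cdot> g) \<cdot> q1 \<boxplus> j2 \<cdot> (q2 \<boxplus> g \<cdot> q1)
        = (j1 \<cdot> q1 \<boxminus> j2 \<cdot> g \<cdot> q1) \<boxplus> (j2 \<cdot> g \<cdot> q1 \<boxplus> j2 \<cdot> q2)"
      using H'(1-15) G Add_comm[of "j2 \<cdot> q2" "j2 \<cdot> (g \<cdot> q1)"] by simp
    also have "\<dots> = ((j1 \<cdot> q1 \<boxminus> j2 \<cdot> g \<cdot> q1) \<boxplus> j2 \<cdot> g \<cdot> q1) \<boxplus> j2 \<cdot> q2"
      using H'(1-15) G by (subst Add_assoc[of "j1 \<cdot> q1 \<boxminus> j2 \<cdot> g \<cdot> q1"]) simp_all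
    also have "\<dots> = Id C Y" using H' G by simp
    finally have 4: "(j1 \<boxminus> j2 \<cdot> g) \<cdot> q1 \<boxplus> j2 \<cdot> (q2 \<boxplus> g \<cdot> q1) = Id C Y" .
    show ?thesis unfolding is_biproduct_def Hom_def using H' G 1 2 3 4 by simp
  qed
  from ses_D(1)[OF biproduct_ses[OF this]] have d1: "deflation E (q2 \<boxplus> g \<cdot> q1)"
    by (auto simp: deflation_def)
  have d2: "deflation E (j1 \<cdot> p1 \<boxplus> j2 \<cdot> w \<cdot> p2)"
    by (rule deflation_sum_Id[OF b b' w])
  have "deflation E ((q2 \<boxplus> g \<cdot> q1) \<cdot> (j1 \<cdot> p1 \<boxplus> j2 \<cdot> w \<cdot> p2))"
    using Comp_deflation[OF d2 d1] H H' G W by simp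
  moreover have "(q2 \<boxplus> g \<cdot> q1) \<cdot> (j1 \<cdot> p1 \<boxplus> j2 \<cdot> w \<cdot> p2) = g \<cdot> p1 \<boxplus> w \<cdot> p2"
    using H H' G W ab Add_comm[of "w \<cdot> p2" "g \<cdot> p1"] by simp
  ultimately show ?thesis by simp
qed

lemma direct_sum_ses:
  assumes 1: "ses X1 f1 Y1 g1 Z1" and 2: "ses X2 f2 Y2 g2 Z2"
    and X: "is_biproduct C X1 X2 X i1 i2 p1 p2" and Y: "is_biproduct C Y1 Y2 Y j1 j2 q1 q2"
    and Z: "is_biproduct C Z1 Z2 Z k1 k2 r1 r2"
  obtains f g where "ses X f Y g Z"
proof -
  note H = is_biproduct_D[OF X] is_biproduct_D[OF Y] is_biproduct_D[OF Z] ses_D[OF 1] ses_D[OF 2]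
  define f where "f = j1 \<cdot> f1 \<cdot> p1 \<boxplus> j2 \<cdot> f2 \<cdot> p2"
  define g where "g = k1 \<cdot> g1 \<cdot> q1 \<boxplus> k2 \<cdot> g2 \<cdot> q2"
  have fg: "f \<in> Hom C X Y" "g \<in> Hom C Y Z" unfolding f_def g_def using H by (simp_all add: Hom_def)
  have "is_direct_sum_of_sequences C (f1, g1) (f2, g2) (f, g)"
    unfolding is_direct_sum_of_sequences_def prod.case
  proof (intro exI conjI)
    show "f1 \<in> Hom C X1 Y1" "g1 \<in> Hom C Y1 Z1" "f2 \<in> Hom C X2 Y2" "g2 \<in> Hom C Y2 Z2"
      using H by (simp_all add: Hom_def)
    show "f \<cdot> i1 = j1 \<cdot> f1" "f \<cdot> i2 = j2 \<cdot> f2" "g \<cdot> j1 = k1 \<cdot> g1" "g \<cdot> j2 = k2 \<cdot> g2"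
      unfolding f_def g_def using H by simp_all
  qed (fact fg X Y Z)+
  with direct_sum_closed have "(f, g) \<in> E" using H by blast
  then show ?thesis using that[of f g] fg by (auto simp: short_exact_def)
qed

end

section \<open>Ext-orthogonal classes\<close>

text \<open>The vanishing of all extensions is recorded as the splitting of all sequences, with both
  splittings, which makes the notion visibly self-dual.\<close>

definition ext_orthogonal ::
  "('o, 'm) addcat \<Rightarrow> ('m \<times> 'm) set \<Rightarrow> 'o set \<Rightarrow> 'o set \<Rightarrow> bool" where
  "ext_orthogonal C E U V \<longleftrightarrow> (\<forall>Z\<in>U. \<forall>X\<in>V. \<forall>f M g. short_exact C E X f M g Z \<longrightarrow>
     (\<exists>s r. is_biproduct C X Z M f s r g))"

context exact_category
begin

lemma ext_orthogonal_op: "ext_orthogonal C E U V \<Longrightarrow> ext_orthogonal (op C) (E\<inverse>) V U"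
  unfolding ext_orthogonal_def using is_biproduct_swap by simp blast

text \<open>Pulling the sequence back along the given morphism produces a split one.\<close>

lemma ext_orthogonal_lift:
  assumes o: "ext_orthogonal C E U V" and X: "X \<in> U" and K: "K \<in> V"
    and s: "ses K k M p Z" and h: "h \<in> Hom C X Z"
  obtains l where "l \<in> Hom C X M" "p \<cdot> l = h"
proof -
  obtain k' a b P where pb: "is_pullback C a b h p" "ses K k' P a X" "b \<cdot> k' = k" "b \<in> Hom C P M"
    using s h by (rule ses_pullback)
  then obtain t r where t: "is_biproduct C K X P k' t r a" using o X K
    unfolding ext_orthogonal_def by blast
  have e: "p \<cdot> b = h \<cdot> a" using pb(1) by (auto simp: is_pullback_def commutative_square_def)
  note T = is_biproduct_D[OF t] ses_D[OF s] h[THEN Hom_D] pb(4)[THEN Hom_D]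
  have "p \<cdot> (b \<cdot> t) = h" using Comp_absorb[OF e, of t] T by simp
  then show ?thesis using that[of "b \<cdot> t"] T by (simp add: Hom_def)
qed

lemma ext_orthogonal_extend:
  assumes "ext_orthogonal C E U V" "Z \<in> U" "T \<in> V" "ses X f Y g Z" "h \<in> Hom C X T"
  obtains l where "l \<in> Hom C Y T" "l \<cdot> f = h"
proof -
  interpret op: exact_category "op C" "E\<inverse>" by (rule exact_dual)
  obtain l where "l \<in> Hom (op C) T Y" "f \<cdot>\<^bsub>op C\<^esub> l = h"
    by (rule op.ext_orthogonal_lift[OF ext_orthogonal_op[OF assms(1)] assms(3,2), of g Y f X h])
      (use assms in auto)
  then show ?thesis using that by simp
qed

text \<open>The approximation \<open>M\<close> of \<open>Y\<close> splits over \<open>X\<close>. The retraction onto \<open>K\<close> that this defines on the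
  preimage \<open>L\<close> of \<open>X\<close> extends to \<open>M\<close>, because \<open>Z\<close> lies in the class as well; so \<open>Y\<close> is a direct summand of \<open>M\<close>.\<close>

lemma extension_closed:
  assumes o: "ext_orthogonal C E U V" and summands: "closed_under_direct_summands C U"
    and approx: "\<And>B. B \<in> Obj C \<Longrightarrow> \<exists>V1\<in>V. \<exists>U1\<in>U. \<exists>f g. ses V1 f U1 g B"
    and s: "ses X f Y g Z" and "X \<in> U" "Z \<in> U"
  shows "Y \<in> U"
proof -
  note D = ses_D[OF s]
  obtain K M k p where a: "K \<in> V" "M \<in> U" "ses K k M p Y" using approx[OF D(9)] by blast
  obtain L j k' q where L: "ses L j M (g \<cdot> p) Z" "ses K k' L q X" "j \<cdot> k' = k"
    using a(3) s by (rule ses_Comp_deflation)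
  obtain t r where b: "is_biproduct C K X L k' t r q"
    using o L(2) a(1) \<open>X \<in> U\<close> unfolding ext_orthogonal_def by blast
  note B = is_biproduct_D[OF b] ses_D[OF L(1)]
  obtain r' where r': "r' \<in> Hom C M K" "r' \<cdot> j = r"
    by (rule ext_orthogonal_extend[OF o \<open>Z \<in> U\<close> a(1) L(1), of r]) (use B in \<open>auto simp: Hom_def\<close>)
  have "r' \<cdot> k = Id C K"
    using Comp_absorb[OF r'(2), of k'] r'(1)[THEN Hom_D] B L(3) by simp
  then obtain s' where "is_biproduct C K Y M k s' r' p"
    by (rule ses_split_retraction[OF a(3) r'(1)])
  then have "is_biproduct C Y K M s' k p r'" by (rule is_biproduct_swap)
  then show ?thesis
    using summands a(2) D(9) ses_D(8)[OF a(3)] unfolding closed_under_direct_summands_def by blast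
qed

end

section \<open>Additive classes of objects and factorisations\<close>

definition additive_class :: "('o, 'm) addcat \<Rightarrow> 'o set \<Rightarrow> bool" where
  "additive_class C A \<longleftrightarrow> A \<subseteq> Obj C \<and> (\<exists>N\<in>A. zero_object C N) \<and>
     (\<forall>X1\<in>A. \<forall>X2\<in>A. \<exists>X\<in>A. \<exists>i1 i2 p1 p2. is_biproduct C X1 X2 X i1 i2 p1 p2)"

context preadditive_category
begin

text \<open>The description by \<open>1 = 0\<close> involves a single endomorphism group, so it passes to full
  subcategories and quotients.\<close>

lemma zero_object_iff: "zero_object C N \<longleftrightarrow> N \<in> Obj C \<and> Id C N = Zero C N N"
proof
  assume "zero_object C N"
  then have N: "N \<in> Obj C" "\<exists>!f. f \<in> Hom C N N" by (auto simp: zero_object_def)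
  moreover have "Id C N \<in> Hom C N N" "Zero C N N \<in> Hom C N N" using N by (auto simp: Hom_def)
  ultimately show "N \<in> Obj C \<and> Id C N = Zero C N N" by blast
next
  assume N: "N \<in> Obj C \<and> Id C N = Zero C N N"
  have "\<exists>!f. f \<in> Hom C N X" "\<exists>!f. f \<in> Hom C X N" if X: "X \<in> Obj C" for X
  proof -
    have Z: "Zero C N X \<in> Hom C N X" "Zero C X N \<in> Hom C X N" using N X by (auto simp: Hom_def)
    have "f = Zero C N X" if f: "f \<in> Hom C N X" for f
    proof -
      have "f = f \<cdot> Id C N" using f by (simp add: Hom_def)
      then show ?thesis using N f by (auto simp: Hom_def simp del: Comp_Id')
    qed
    then show "\<exists>!f. f \<in> Hom C N X" using Z by blast
    have "f = Zero C X N" if f: "f \<in> Hom C X N" for f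
    proof -
      have "f = Id C N \<cdot> f" using f by (simp add: Hom_def)
      then show ?thesis using N f by (auto simp: Hom_def simp del: Comp_Id')
    qed
    then show "\<exists>!f. f \<in> Hom C X N" using Z by blast
  qed
  then show "zero_object C N" using N by (auto simp: zero_object_def)
qed

lemma iso_biproduct:
  assumes "f \<in> Hom C X Y" "g \<in> Hom C Y X" "g \<cdot> f = Id C X" "f \<cdot> g = Id C Y" "zero_object C N"
  shows "is_biproduct C X N Y f (Zero C N Y) g (Zero C Y N)"
  using assms unfolding is_biproduct_def zero_object_iff by (auto dest!: Hom_D intro!: Hom_I)

text \<open>An object isomorphic to \<open>Y\<close> is a direct summand of \<open>Y\<close> with zero complement.\<close>

lemma closed_under_iso:
  assumes "closed_under_direct_summands C A" "zero_object C N" "Y \<in> A"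
    "f \<in> Hom C X Y" "g \<in> Hom C Y X" "g \<cdot> f = Id C X" "f \<cdot> g = Id C Y"
  shows "X \<in> A"
  using assms iso_biproduct[OF assms(4-7,2)] Hom_D[OF assms(4)]
  unfolding closed_under_direct_summands_def zero_object_def by blast

lemma zero_object_in_class:
  assumes "additive_class C A" "closed_under_direct_summands C A" "zero_object C N"
  shows "N \<in> A"
proof -
  obtain M where M: "M \<in> A" "zero_object C M" using assms(1) by (auto simp: additive_class_def)
  then have "Zero C N M \<in> Hom C N M" "Zero C M N \<in> Hom C M N" "Zero C M N \<cdot> Zero C N M = Id C N"
    "Zero C N M \<cdot> Zero C M N = Id C M"
    using assms(3) by (auto simp: zero_object_iff Hom_def)
  then show ?thesis using closed_under_iso[OF assms(2) M(2) M(1)] by blast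
qed

lemma biproduct_in_class:
  assumes A: "additive_class C A" "closed_under_direct_summands C A" and X: "X1 \<in> A" "X2 \<in> A"
    and b: "is_biproduct C X1 X2 X i1 i2 p1 p2"
  shows "X \<in> A"
proof -
  obtain Y j1 j2 q1 q2 where Y: "Y \<in> A" and b': "is_biproduct C X1 X2 Y j1 j2 q1 q2"
    using A(1) X unfolding additive_class_def by blast
  obtain N where N: "zero_object C N" using A(1) by (auto simp: additive_class_def)
  note H = is_biproduct_D[OF b] and H' = is_biproduct_D[OF b']
  note ab = Comp_absorb[OF H(16)] Comp_absorb[OF H(17)] Comp_absorb[OF H(18)] Comp_absorb[OF H(19)]
    Comp_absorb[OF H'(16)] Comp_absorb[OF H'(17)] Comp_absorb[OF H'(18)] Comp_absorb[OF H'(19)]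
  let ?f = "j1 \<cdot> p1 \<boxplus> j2 \<cdot> p2" and ?g = "i1 \<cdot> q1 \<boxplus> i2 \<cdot> q2"
  have "?f \<in> Hom C X Y" "?g \<in> Hom C Y X" "?g \<cdot> ?f = Id C X" "?f \<cdot> ?g = Id C Y"
    using H H' ab by (simp_all add: Hom_def)
  then show ?thesis using closed_under_iso[OF A(2) N Y] by blast
qed

lemma additive_class_op:
  assumes "additive_class C A" shows "additive_class (op C) A"
proof -
  have "\<exists>X\<in>A. \<exists>i1 i2 p1 p2. is_biproduct (op C) X1 X2 X i1 i2 p1 p2"
    if X: "X1 \<in> A" "X2 \<in> A" for X1 X2
  proof -
    obtain X i1 i2 p1 p2 where "X \<in> A" "is_biproduct C X1 X2 X i1 i2 p1 p2"
      using assms X unfolding additive_class_def by blast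
    then have "X \<in> A" "is_biproduct (op C) X1 X2 X p1 p2 i1 i2" by simp_all
    then show ?thesis by blast
  qed
  then show ?thesis using assms unfolding additive_class_def op_simps zero_object_op by blast
qed

lemma closed_under_direct_summands_op:
  "closed_under_direct_summands C A \<Longrightarrow> closed_under_direct_summands (op C) A"
  unfolding closed_under_direct_summands_def by simp blast

lemma factoring_I:
  "\<lbrakk>Z \<in> W; g \<in> Arr C; h \<in> Arr C; Cod C g = Z; Dom C h = Z; Dom C g = X; Cod C h = Y\<rbrakk> \<Longrightarrow>
     h \<cdot> g \<in> factoring_morphisms C W X Y"
  by (auto simp: factoring_morphisms_def Hom_def)

lemma factoring_E:
  assumes "f \<in> factoring_morphisms C W X Y"
  obtains Z g h where "Z \<in> W" "f = h \<cdot> g" "g \<in> Arr C" "h \<in> Arr C" "Cod C g = Z" "Dom C h = Z"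
    "Dom C g = X" "Cod C h = Y"
  using assms by (auto simp: factoring_morphisms_def Hom_def)

lemma factoring_Arr:
  assumes "f \<in> factoring_morphisms C W X Y"
  shows "f \<in> Arr C" "Dom C f = X" "Cod C f = Y"
  using assms by (auto elim!: factoring_E)

lemma factoring_Comp_left:
  assumes "f \<in> factoring_morphisms C W X Y" "h \<in> Arr C" "Dom C h = Y" "Cod C h = Z"
  shows "h \<cdot> f \<in> factoring_morphisms C W X Z"
  using assms(1)
proof (rule factoring_E)
  fix Z' g k assume k: "Z' \<in> W" "f = k \<cdot> g" "g \<in> Arr C" "k \<in> Arr C" "Cod C g = Z'" "Dom C k = Z'"
    "Dom C g = X" "Cod C k = Y"
  have "(h \<cdot> k) \<cdot> g \<in> factoring_morphisms C W X Z"
    by (rule factoring_I) (use k assms in auto)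
  then show ?thesis using k assms by simp
qed

lemma factoring_Comp_right:
  assumes "f \<in> factoring_morphisms C W X Y" "h \<in> Arr C" "Cod C h = X" "Dom C h = Z"
  shows "f \<cdot> h \<in> factoring_morphisms C W Z Y"
  using assms(1)
proof (rule factoring_E)
  fix Z' g k assume k: "Z' \<in> W" "f = k \<cdot> g" "g \<in> Arr C" "k \<in> Arr C" "Cod C g = Z'" "Dom C k = Z'"
    "Dom C g = X" "Cod C k = Y"
  have "k \<cdot> (g \<cdot> h) \<in> factoring_morphisms C W Z Y"
    by (rule factoring_I) (use k assms in auto)
  then show ?thesis using k assms by simp
qed

end

section \<open>Twin cotorsion pairs\<close>

text \<open>Duality exchanges the last two inclusions, and the hypotheses as a whole are self-dual: the opposite
  category satisfies them with \<open>(V, U), (T, S)\<close> in place of \<open>(S, T), (U, V)\<close>.\<close>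

locale twin_cotorsion = exact_category +
  fixes S T U V :: "'a set"
  assumes additive_classes:
      "additive_class C S" "additive_class C T" "additive_class C U" "additive_class C V"
    and summand_closed:
      "closed_under_direct_summands C S" "closed_under_direct_summands C T"
      "closed_under_direct_summands C U" "closed_under_direct_summands C V"
    and orthogonal: "ext_orthogonal C E S T" "ext_orthogonal C E U V"
    and S_approx: "B \<in> Obj C \<Longrightarrow> \<exists>T1\<in>T. \<exists>S1\<in>S. \<exists>f g. ses T1 f S1 g B"
    and T_approx: "B \<in> Obj C \<Longrightarrow> \<exists>T1\<in>T. \<exists>S1\<in>S. \<exists>f g. ses B f T1 g S1"
    and U_approx: "B \<in> Obj C \<Longrightarrow> \<exists>V1\<in>V. \<exists>U1\<in>U. \<exists>f g. ses V1 f U1 g B"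
    and V_approx: "B \<in> Obj C \<Longrightarrow> \<exists>V1\<in>V. \<exists>U1\<in>U. \<exists>f g. ses B f V1 g U1"
    and S_sub_U: "S \<subseteq> U"
    and V_sub_T: "V \<subseteq> T"

lemma twin_cotorsion_op:
  assumes "twin_cotorsion C E S T U V"
  shows "twin_cotorsion (op C) (E\<inverse>) V U T S"
proof -
  interpret twin_cotorsion C E S T U V by fact
  show ?thesis
  proof (intro twin_cotorsion.intro twin_cotorsion_axioms.intro exact_dual)
    fix B assume B: "B \<in> Obj (op C)"
    show "\<exists>T1\<in>U. \<exists>S1\<in>V. \<exists>f g. short_exact (op C) (E\<inverse>) T1 f S1 g B"
      using V_approx[of B] B by simp blast
    show "\<exists>T1\<in>U. \<exists>S1\<in>V. \<exists>f g. short_exact (op C) (E\<inverse>) B f T1 g S1"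
      using U_approx[of B] B by simp blast
    show "\<exists>T1\<in>S. \<exists>S1\<in>T. \<exists>f g. short_exact (op C) (E\<inverse>) T1 f S1 g B"
      using T_approx[of B] B by simp blast
    show "\<exists>T1\<in>S. \<exists>S1\<in>T. \<exists>f g. short_exact (op C) (E\<inverse>) B f T1 g S1"
      using S_approx[of B] B by simp blast
  qed (use additive_classes summand_closed orthogonal S_sub_U V_sub_T in
      \<open>auto intro: additive_class_op closed_under_direct_summands_op ext_orthogonal_op\<close>)
qed

context twin_cotorsion
begin

lemma twin_dual: "twin_cotorsion (op C) (E\<inverse>) V U T S"
  using twin_cotorsion_op twin_cotorsion_axioms .

abbreviation "Bminus \<equiv> B_minus C E (T \<inter> U) S"
abbreviation "Bplus \<equiv> B_plus C E (T \<inter> U) V"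
abbreviation "fac \<equiv> factoring_morphisms C (T \<inter> U)"

lemma Bminus_I: "\<lbrakk>ses B f T1 g S1; T1 \<in> T; T1 \<in> U; S1 \<in> S\<rbrakk> \<Longrightarrow> B \<in> Bminus"
  unfolding B_minus_def using ses_D(8) by blast

lemma Bminus_E:
  assumes "B \<in> Bminus"
  obtains f T1 g S1 where "ses B f T1 g S1" "T1 \<in> T" "T1 \<in> U" "S1 \<in> S"
  using assms unfolding B_minus_def by blast

lemma Bplus_I: "\<lbrakk>ses V1 f U1 g B; U1 \<in> T; U1 \<in> U; V1 \<in> V\<rbrakk> \<Longrightarrow> B \<in> Bplus"
  unfolding B_plus_def using ses_D(10) by blast

lemma Bplus_E:
  assumes "B \<in> Bplus"
  obtains V1 f U1 g where "ses V1 f U1 g B" "U1 \<in> T" "U1 \<in> U" "V1 \<in> V"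
  using assms unfolding B_plus_def by blast

lemma S_extension_closed: "\<lbrakk>ses X f Y g Z; X \<in> S; Z \<in> S\<rbrakk> \<Longrightarrow> Y \<in> S"
  using extension_closed[OF orthogonal(1) summand_closed(1) S_approx] .

lemma U_extension_closed: "\<lbrakk>ses X f Y g Z; X \<in> U; Z \<in> U\<rbrakk> \<Longrightarrow> Y \<in> U"
  using extension_closed[OF orthogonal(2) summand_closed(3) U_approx] .

text \<open>The term \<open>M\<close> is a direct summand of the pushout of the two sequences that start in \<open>B\<close>,
  and this pushout is an extension of \<open>S1\<close> by an object of \<open>U\<close>.\<close>

lemma T_envelope_in_U:
  assumes s: "ses B e M q S1" and "S1 \<in> S" "M \<in> T" "B \<in> Bminus"
  shows "M \<in> U"
proof -
  obtain t T1 s' S2 where B: "ses B t T1 s' S2" "T1 \<in> T" "T1 \<in> U" "S2 \<in> S"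
    using \<open>B \<in> Bminus\<close> by (rule Bminus_E)
  note D = ses_D[OF s] ses_D[OF B(1)]
  have "t \<in> Hom C B T1" using D by (simp add: Hom_def)
  with s obtain c d q' P where po: "is_pushout C e t c d" "ses T1 d P q' S1" "q' \<cdot> c = q" "c \<in> Hom C M P"
    by (rule ses_pushout)
  have PU: "P \<in> U" using U_extension_closed[OF po(2)] B(3) assms(2) S_sub_U by blast
  obtain q'' where q'': "ses (Dom C c) c (Cod C c) q'' S2"
    by (rule pushout_ses[OF is_pushout_swap[OF po(1)], of s' S2]) (use B D in auto)
  then have "ses M c P q'' S2" using po(4) by (auto simp: Hom_def)
  then obtain s'' r where b: "is_biproduct C M S2 P c s'' r q''"
    using orthogonal(1) B(4) \<open>M \<in> T\<close> unfolding ext_orthogonal_def by blast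
  show ?thesis
    using summand_closed(3) PU b is_biproduct_D(13,14)[OF b]
    unfolding closed_under_direct_summands_def by blast
qed

text \<open>Composing with an embedding of \<open>M\<close> into \<open>T\<close> yields one of \<open>B\<close>, whose cokernel is an extension of
  objects of \<open>S\<close>.\<close>

lemma Bminus_iff:
  assumes s: "ses B e M q S1" and "S1 \<in> S"
  shows "B \<in> Bminus \<longleftrightarrow> M \<in> Bminus"
proof
  assume B: "B \<in> Bminus"
  obtain t T1 s' S2 where t: "ses M t T1 s' S2" "T1 \<in> T" "S2 \<in> S"
    using T_approx[of M] ses_D(9)[OF s] by blast
  obtain Q c d q where Q: "ses B (t \<cdot> e) T1 c Q" "ses S1 d Q q S2"
    using s t(1) by (rule ses_Comp_inflation)
  have "Q \<in> S" using S_extension_closed[OF Q(2)] assms t by blast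
  then have "T1 \<in> U" using T_envelope_in_U[OF Q(1)] t B by blast
  then show "M \<in> Bminus" using Bminus_I t by blast
next
  assume "M \<in> Bminus"
  then obtain t T1 s' S2 where t: "ses M t T1 s' S2" "T1 \<in> T" "T1 \<in> U" "S2 \<in> S"
    by (rule Bminus_E)
  obtain Q c d q where Q: "ses B (t \<cdot> e) T1 c Q" "ses S1 d Q q S2"
    using s t(1) by (rule ses_Comp_inflation)
  have "Q \<in> S" using S_extension_closed[OF Q(2)] assms t by blast
  then show "B \<in> Bminus" using Bminus_I[OF Q(1)] t by blast
qed

lemma Bminus_biproduct:
  assumes "X1 \<in> Bminus" "X2 \<in> Bminus" and b: "is_biproduct C X1 X2 X i1 i2 p1 p2"
  shows "X \<in> Bminus"
proof -
  obtain f1 T1 g1 S1 where 1: "ses X1 f1 T1 g1 S1" "T1 \<in> T" "T1 \<in> U" "S1 \<in> S"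
    using assms(1) by (rule Bminus_E)
  obtain f2 T2 g2 S2 where 2: "ses X2 f2 T2 g2 S2" "T2 \<in> T" "T2 \<in> U" "S2 \<in> S"
    using assms(2) by (rule Bminus_E)
  note D = ses_D[OF 1(1)] ses_D[OF 2(1)]
  obtain T3 j1 j2 q1 q2 where T3: "is_biproduct C T1 T2 T3 j1 j2 q1 q2"
    using ex_biproduct[of T1 T2] D by blast
  obtain S3 k1 k2 r1 r2 where S3: "is_biproduct C S1 S2 S3 k1 k2 r1 r2"
    using ex_biproduct[of S1 S2] D by blast
  obtain f g where "ses X f T3 g S3" using 1(1) 2(1) b T3 S3 by (rule direct_sum_ses)
  moreover have "T3 \<in> T" "T3 \<in> U" "S3 \<in> S"
    using biproduct_in_class T3 S3 1 2 additive_classes summand_closed by blast+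
  ultimately show ?thesis using Bminus_I by blast
qed

lemma W_sub_Bminus:
  assumes "X \<in> T" "X \<in> U"
  shows "X \<in> Bminus"
proof -
  have X: "X \<in> Obj C" using additive_classes(2) assms unfolding additive_class_def by blast
  obtain N where N: "zero_object C N" using ex_zero_object by blast
  have "is_biproduct C X N X (Id C X) (Zero C N X) (Id C X) (Zero C X N)"
    by (rule iso_biproduct[OF _ _ _ _ N]) (use X in \<open>auto simp: Hom_def\<close>)
  from biproduct_ses[OF this] show ?thesis
    using Bminus_I assms zero_object_in_class[OF additive_classes(1) summand_closed(1) N] by blast
qed

text \<open>Modulo \<open>W\<close>, the inflation \<open>e\<close> is an epimorphism for all targets in \<open>Bplus\<close>. Morphisms from \<open>W\<close> to \<open>Y\<close>
  lift to the \<open>W\<close>-cover \<open>w\<close> of \<open>Y\<close>, and morphisms into \<open>W\<close> extend along \<open>e\<close>; so \<open>y\<close> agrees on \<open>B\<close> with a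
  morphism through \<open>w\<close>. The difference factors through \<open>S1\<close>, which lifts to the cover as well.\<close>

lemma factoring_reflected:
  assumes s: "ses B e M q S1" and S1: "S1 \<in> S" and Y: "Y \<in> Bplus" and y: "y \<in> Hom C M Y"
    and ye: "y \<cdot> e \<in> fac B Y"
  shows "y \<in> fac M Y"
proof -
  note D = ses_D[OF s] y[THEN Hom_D]
  obtain V1 v W1 w where w: "ses V1 v W1 w Y" "W1 \<in> T" "W1 \<in> U" "V1 \<in> V" using Y by (rule Bplus_E)
  note W = ses_D[OF w(1)]
  obtain W0 h1 h2 where h: "W0 \<in> T \<inter> U" "y \<cdot> e = h2 \<cdot> h1" "h1 \<in> Arr C" "h2 \<in> Arr C" "Cod C h1 = W0"
    "Dom C h2 = W0" "Dom C h1 = B" "Cod C h2 = Y" using ye by (rule factoring_E)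
  obtain l where l: "l \<in> Hom C W0 W1" "w \<cdot> l = h2"
    by (rule ext_orthogonal_lift[OF orthogonal(2) _ w(4,1)]) (use h in \<open>auto simp: Hom_def\<close>)
  have L: "l \<in> Arr C" "Dom C l = W0" "Cod C l = W1" using l by (auto simp: Hom_def)
  obtain m where m: "m \<in> Hom C M W1" "m \<cdot> e = l \<cdot> h1"
    by (rule ext_orthogonal_extend[OF orthogonal(1) S1 w(2) s, of "l \<cdot> h1"])
      (use h L in \<open>auto simp: Hom_def\<close>)
  have M: "m \<in> Arr C" "Dom C m = M" "Cod C m = W1" using m by (auto simp: Hom_def)
  have "(y \<boxminus> w \<cdot> m) \<cdot> e = y \<cdot> e \<boxminus> w \<cdot> (m \<cdot> e)" using D M W by simp
  also have "\<dots> = h2 \<cdot> h1 \<boxminus> (w \<cdot> l) \<cdot> h1" using m(2) h L W by simp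
  also have "\<dots> = Zero C B Y" using h l(2) by simp
  finally have 0: "(y \<boxminus> w \<cdot> m) \<cdot> e = Zero C B Y" .
  obtain n where n: "n \<in> Arr C" "Dom C n = S1" "Cod C n = Y" "n \<cdot> q = y \<boxminus> w \<cdot> m"
    by (rule cokernel_extend[OF D(13), of "y \<boxminus> w \<cdot> m"]) (use 0 D M W in auto)
  obtain n' where n': "n' \<in> Hom C S1 W1" "w \<cdot> n' = n"
    by (rule ext_orthogonal_lift[OF orthogonal(2) _ w(4,1), of S1 n])
      (use n S1 S_sub_U in \<open>auto simp: Hom_def\<close>)
  have N: "n' \<in> Arr C" "Dom C n' = S1" "Cod C n' = W1" using n' by (auto simp: Hom_def)
  have "w \<cdot> (n' \<cdot> q \<boxplus> m) = (w \<cdot> n') \<cdot> q \<boxplus> w \<cdot> m" using N D M W by simp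
  also have "\<dots> = y" using n n'(2) D M W by simp
  finally have "y = w \<cdot> (n' \<cdot> q \<boxplus> m)" by simp
  then show ?thesis using factoring_I[of W1 "T \<inter> U" "n' \<cdot> q \<boxplus> m" w] w D N M W by simp
qed

text \<open>The reflection of \<open>Bminus\<close> into the heart. A \<open>U\<close>-cover \<open>U1\<close> of \<open>B\<close> with kernel in \<open>V\<close> need not lie
  in \<open>T\<close>; embedding it into an object of \<open>T\<close> with cokernel in \<open>S\<close> and pushing out enlarges \<open>B\<close> to an
  object \<open>B'\<close> covered by \<open>W\<close> with the same kernel. A morphism from \<open>B\<close> to \<open>Y\<close> extends, because its restriction to
  \<open>U1\<close> lifts to the \<open>W\<close>-cover of \<open>Y\<close>, and the lift extends since its target lies in \<open>T\<close>.\<close>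

lemma reflection:
  assumes B: "B \<in> Bminus"
  obtains B' c q S1 where "B' \<in> Bplus" "B' \<in> Bminus" "S1 \<in> S" "ses B c B' q S1"
    "\<And>Y g. \<lbrakk>Y \<in> Bplus; g \<in> Hom C B Y\<rbrakk> \<Longrightarrow> \<exists>h\<in>Hom C B' Y. h \<cdot> c = g"
proof -
  have "B \<in> Obj C" using B by (auto simp: B_minus_def)
  then obtain V1 v U1 u where u: "V1 \<in> V" "U1 \<in> U" "ses V1 v U1 u B" using U_approx by blast
  obtain T1 S1 t s where t: "T1 \<in> T" "S1 \<in> S" "ses U1 t T1 s S1"
    using T_approx[of U1] ses_D(9)[OF u(3)] by blast
  have T1: "T1 \<in> U" using U_extension_closed[OF t(3) u(2)] t S_sub_U by blast
  obtain B' c d q where B': "ses V1 (t \<cdot> v) T1 c B'" "ses B d B' q S1" "q \<cdot> c = s"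
    and po: "is_pushout C t u c d"
    using u(3) t(3) by (rule ses_Comp_inflation)
  note D = is_pushout_D[OF po] ses_D[OF u(3)] ses_D[OF t(3)] ses_D[OF B'(1)] ses_D[OF B'(2)]
  show ?thesis
  proof (rule that[OF _ _ t(2) B'(2)])
    show "B' \<in> Bplus" using Bplus_I[OF B'(1)] t T1 u by blast
    show "B' \<in> Bminus" using Bminus_iff[OF B'(2) t(2)] B by blast
    fix Y g assume Y: "Y \<in> Bplus" and g: "g \<in> Hom C B Y"
    obtain V2 v2 W2 w where w: "ses V2 v2 W2 w Y" "W2 \<in> T" "W2 \<in> U" "V2 \<in> V"
      using Y by (rule Bplus_E)
    note W = ses_D[OF w(1)] g[THEN Hom_D]
    obtain l where l: "l \<in> Hom C U1 W2" "w \<cdot> l = g \<cdot> u"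
      by (rule ext_orthogonal_lift[OF orthogonal(2) u(2) w(4,1), of "g \<cdot> u"])
        (use D W in \<open>auto simp: Hom_def\<close>)
    obtain m where m: "m \<in> Hom C T1 W2" "m \<cdot> t = l"
      by (rule ext_orthogonal_extend[OF orthogonal(1) t(2) w(2) t(3) l(1)])
    have M: "m \<in> Arr C" "Dom C m = T1" "Cod C m = W2" using m by (auto simp: Hom_def)
    have e: "(w \<cdot> m) \<cdot> t = g \<cdot> u" using M W D m(2) l(2) by simp
    obtain h where "h \<in> Arr C" "Dom C h = Cod C c" "Cod C h = Cod C (w \<cdot> m)" "h \<cdot> c = w \<cdot> m" "h \<cdot> d = g"
      by (rule pushout_extend[OF po _ _ _ _ _ e]) (use M W D in auto)
    then show "\<exists>h\<in>Hom C B' Y. h \<cdot> d = g" using M W D by (auto simp: Hom_def)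
  qed
qed

text \<open>Pushing the sequence of \<open>A\<close> into \<open>W\<close> out along \<open>f\<close> makes \<open>f\<close> factor through \<open>W\<close>, in a universal
  way because morphisms from \<open>A\<close> to \<open>W\<close> extend along that sequence. The pushout lies in \<open>Bminus\<close> only,
  and is then reflected into the heart. Extensions along \<open>c\<close> exist on the nose, not only modulo
  \<open>W\<close>; their uniqueness modulo \<open>W\<close> is the content of \<open>factoring_reflected\<close>.\<close>

lemma weak_cokernel:
  assumes A: "A \<in> Bminus" and B: "B \<in> Bminus" and f: "f \<in> Hom C A B"
  obtains K c q S1 where "K \<in> Bplus" "K \<in> Bminus" "S1 \<in> S" "ses B c K q S1" "c \<cdot> f \<in> fac A K"
    "\<And>Y g. \<lbrakk>Y \<in> Bplus; g \<in> Hom C B Y; g \<cdot> f \<in> fac A Y\<rbrakk> \<Longrightarrow> \<exists>h\<in>Hom C K Y. h \<cdot> c = g"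
proof -
  obtain t T1 s S1 where t: "ses A t T1 s S1" "T1 \<in> T" "T1 \<in> U" "S1 \<in> S" using A by (rule Bminus_E)
  obtain c d q P where po: "is_pushout C t f c d" and P: "ses B d P q S1" "q \<cdot> c = s" "c \<in> Hom C T1 P"
    using t(1) f by (rule ses_pushout)
  have "P \<in> Bminus" using Bminus_iff[OF P(1) t(4)] B by blast
  then obtain K c' q' S2 where K: "K \<in> Bplus" "K \<in> Bminus" "S2 \<in> S" "ses P c' K q' S2"
    and ext: "\<And>Y g. \<lbrakk>Y \<in> Bplus; g \<in> Hom C P Y\<rbrakk> \<Longrightarrow> \<exists>h\<in>Hom C K Y. h \<cdot> c' = g"
    by (rule reflection) blast
  obtain Q r d' q'' where Q: "ses B (c' \<cdot> d) K r Q" "ses S1 d' Q q'' S2"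
    using P(1) K(4) by (rule ses_Comp_inflation)
  note D = is_pushout_D[OF po] ses_D[OF t(1)] ses_D[OF P(1)] ses_D[OF K(4)] f[THEN Hom_D]
  have QS: "Q \<in> S" using S_extension_closed[OF Q(2)] t K by blast
  have "(c' \<cdot> c) \<cdot> t \<in> fac A K"
    by (rule factoring_I) (use t D in auto)
  moreover have "(c' \<cdot> d) \<cdot> f = (c' \<cdot> c) \<cdot> t" using D(1-8) D by simp
  ultimately have cf: "(c' \<cdot> d) \<cdot> f \<in> fac A K" by simp
  show ?thesis
  proof (rule that[OF K(1,2) QS Q(1) cf])
    fix Y g assume Y: "Y \<in> Bplus" and g: "g \<in> Hom C B Y" and gf: "g \<cdot> f \<in> fac A Y"
    note G = g[THEN Hom_D]
    obtain W0 h1 h2 where h: "W0 \<in> T \<inter> U" "g \<cdot> f = h2 \<cdot> h1" "h1 \<in> Arr C" "h2 \<in> Arr C" "Cod C h1 = W0"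
      "Dom C h2 = W0" "Dom C h1 = A" "Cod C h2 = Y" using gf by (rule factoring_E)
    obtain m where m: "m \<in> Hom C T1 W0" "m \<cdot> t = h1"
      by (rule ext_orthogonal_extend[OF orthogonal(1) t(4) _ t(1), of W0 h1])
        (use h in \<open>auto simp: Hom_def\<close>)
    have M: "m \<in> Arr C" "Dom C m = T1" "Cod C m = W0" using m by (auto simp: Hom_def)
    have e: "(h2 \<cdot> m) \<cdot> t = g \<cdot> f" using M D h m(2) by simp
    obtain k where k: "k \<in> Arr C" "Dom C k = Cod C c" "Cod C k = Cod C (h2 \<cdot> m)" "k \<cdot> c = h2 \<cdot> m" "k \<cdot> d = g"
      by (rule pushout_extend[OF po _ _ _ _ _ e]) (use M h G D in auto)
    obtain h where h': "h \<in> Hom C K Y" "h \<cdot> c' = k"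
      using ext[OF Y, of k] k M h D by (auto simp: Hom_def)
    then show "\<exists>h\<in>Hom C K Y. h \<cdot> (c' \<cdot> d) = g"
      using Comp_absorb[OF h'(2), of d] D k by (intro bexI[of _ h]) (auto simp: Hom_def)
  qed
qed

text \<open>Modulo \<open>W\<close> the object \<open>B\<close> may be replaced by its biproduct with a \<open>W\<close>-cover \<open>W1\<close> of \<open>D\<close>, from which
  the induced map to \<open>S1\<close> is a deflation. Its kernel \<open>X0\<close> maps to \<open>A\<close>, the kernel of \<open>s\<close>, and the
  square over \<open>D\<close> commutes up to a morphism through \<open>W1\<close>. The inclusion of \<open>X0\<close> has cokernel \<open>S1\<close>, so
  \<open>factoring_reflected\<close> makes it an epimorphism modulo \<open>W\<close>; reflecting \<open>X0\<close> into the heart preserves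
  all of this.\<close>

lemma epi_cover_of_pullback:
  assumes s: "ses A d D s S1" and S1: "S1 \<in> S" and A: "A \<in> Bplus" and DB: "D \<in> Bplus"
    and B: "B \<in> Bplus" "B \<in> Bminus" and g: "g \<in> Hom C B D"
  obtains X e e' where "X \<in> Bplus" "X \<in> Bminus" "e \<in> Hom C X B" "e' \<in> Hom C X A"
    "g \<cdot> e \<boxminus> d \<cdot> e' \<in> fac X D"
    "\<And>Y y. \<lbrakk>Y \<in> Bplus; y \<in> Hom C B Y; y \<cdot> e \<in> fac X Y\<rbrakk> \<Longrightarrow> y \<in> fac B Y"
proof -
  obtain V1 v W1 w where w: "ses V1 v W1 w D" "W1 \<in> T" "W1 \<in> U" "V1 \<in> V" using DB by (rule Bplus_E)
  note D = ses_D[OF s] ses_D[OF w(1)] g[THEN Hom_D]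
  obtain P i1 i2 p1 p2 where b: "is_biproduct C B W1 P i1 i2 p1 p2" using ex_biproduct[of B W1] D by blast
  note Bi = is_biproduct_D[OF b]
  have P: "P \<in> Bminus" using Bminus_biproduct[OF B(2) W_sub_Bminus b] w by blast
  have sw: "deflation E (s \<cdot> w)"
    by (rule Comp_deflation) (use D in \<open>auto simp: deflation_def\<close>)
  define r where "r = (s \<cdot> g) \<cdot> p1 \<boxplus> (s \<cdot> w) \<cdot> p2"
  have r: "r \<in> Arr C" "Dom C r = P" "Cod C r = S1" unfolding r_def using D Bi by simp_all
  have "deflation E r" unfolding r_def
    by (rule deflation_copair[OF b sw, of S1]) (use D in \<open>auto simp: Hom_def\<close>)
  then obtain k where "(k, r) \<in> E" by (auto simp: deflation_def)
  from ses_I[OF this] have "ses (Dom C k) k (Cod C k) r S1" using r by simp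
  moreover from ses_D(4,6)[OF this] r have "Cod C k = P" by simp
  ultimately obtain X0 where k: "ses X0 k P r S1" by blast
  note K = ses_D[OF k]
  have X0: "X0 \<in> Bminus" using Bminus_iff[OF k S1] P by blast
  define z where "z = g \<cdot> p1 \<cdot> k \<boxplus> w \<cdot> p2 \<cdot> k"
  have z: "z \<in> Arr C" "Dom C z = X0" "Cod C z = D" unfolding z_def using K D Bi by simp_all
  have "s \<cdot> z = r \<cdot> k" unfolding z_def r_def using K D Bi by simp
  then have 0: "s \<cdot> z = Zero C X0 S1" using K by simp
  obtain e3 where e3: "e3 \<in> Arr C" "Dom C e3 = X0" "Cod C e3 = A" "d \<cdot> e3 = z"
    by (rule kernel_lift[OF D(12), of z]) (use z 0 D in auto)
  from X0 obtain X h q S2 where X: "X \<in> Bplus" "X \<in> Bminus" "S2 \<in> S" "ses X0 h X q S2"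
    and ext: "\<And>Y g. \<lbrakk>Y \<in> Bplus; g \<in> Hom C X0 Y\<rbrakk> \<Longrightarrow> \<exists>h'\<in>Hom C X Y. h' \<cdot> h = g"
    by (rule reflection) blast
  note H = ses_D[OF X(4)]
  obtain e where e: "e \<in> Hom C X B" "e \<cdot> h = p1 \<cdot> k"
    using ext[OF B(1), of "p1 \<cdot> k"] K Bi by (auto simp: Hom_def)
  obtain e' where e': "e' \<in> Hom C X A" "e' \<cdot> h = e3"
    using ext[OF A, of e3] e3 by (auto simp: Hom_def)
  have EA: "e \<in> Arr C" "Dom C e = X" "Cod C e = B" "e' \<in> Arr C" "Dom C e' = X" "Cod C e' = A"
    using e e' by (auto simp: Hom_def)
  show ?thesis
  proof (rule that[OF X(1,2) e(1) e'(1)])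
    have "(g \<cdot> e \<boxminus> d \<cdot> e') \<cdot> h = g \<cdot> (e \<cdot> h) \<boxminus> d \<cdot> (e' \<cdot> h)" using EA D H by simp
    also have "\<dots> = g \<cdot> p1 \<cdot> k \<boxminus> z" using K D Bi by (simp add: e(2) e'(2) e3(4))
    also have "\<dots> = Neg (w \<cdot> p2 \<cdot> k)" unfolding z_def
      by (rule Minus_Add_self) (use K D Bi in simp_all)
    also have "\<dots> = w \<cdot> Neg (p2 \<cdot> k)" using K D Bi by simp
    also have "\<dots> \<in> fac X0 D" by (rule factoring_I[of W1]) (use w K D Bi in simp_all)
    finally show "g \<cdot> e \<boxminus> d \<cdot> e' \<in> fac X D"
      by (rule factoring_reflected[OF X(4,3) DB, rotated]) (use EA D in \<open>simp add: Hom_def\<close>)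
  next
    fix Y y assume Y: "Y \<in> Bplus" and y: "y \<in> Hom C B Y" and ye: "y \<cdot> e \<in> fac X Y"
    have y': "y \<in> Arr C" "Dom C y = B" "Cod C y = Y" using y by (auto simp: Hom_def)
    have "(y \<cdot> e) \<cdot> h \<in> fac X0 Y" by (rule factoring_Comp_right[OF ye]) (use H in auto)
    then have "(y \<cdot> p1) \<cdot> k \<in> fac X0 Y" using y' EA H K Bi e(2) by simp
    then have "y \<cdot> p1 \<in> fac P Y"
      by (rule factoring_reflected[OF k S1 Y, rotated]) (use y' Bi in \<open>simp add: Hom_def\<close>)
    then have "(y \<cdot> p1) \<cdot> i1 \<in> fac B Y" by (rule factoring_Comp_right) (use Bi in auto)
    then show "y \<in> fac B Y" using y' Bi by simp
  qed
qed

end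

section \<open>Full subcategories and ideal quotients\<close>

lemma full_simps [simp]:
  "Obj (full_subcategory C H) = H"
  "Arr (full_subcategory C H) = {f \<in> Arr C. Dom C f \<in> H \<and> Cod C f \<in> H}"
  "Dom (full_subcategory C H) = Dom C" "Cod (full_subcategory C H) = Cod C"
  "Id (full_subcategory C H) = Id C" "g \<cdot>\<^bsub>full_subcategory C H\<^esub> f = g \<cdot>\<^bsub>C\<^esub> f"
  "Zero (full_subcategory C H) = Zero C" "Add (full_subcategory C H) = Add C"
  by (auto simp: full_subcategory_def)

lemma Hom_full: "Hom (full_subcategory C H) X Y = (if X \<in> H \<and> Y \<in> H then Hom C X Y else {})"
  by (auto simp: Hom_def)

lemma hom_group_full: "X \<in> H \<Longrightarrow> Y \<in> H \<Longrightarrow> hom_group (full_subcategory C H) X Y = hom_group C X Y"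
  by (simp add: hom_group_def Hom_full)

lemma factoring_full:
  assumes "W \<subseteq> H" "X \<in> H" "Y \<in> H"
  shows "factoring_morphisms (full_subcategory C H) W X Y = factoring_morphisms C W X Y"
  using assms unfolding factoring_morphisms_def by (auto simp: Hom_full; blast)

lemma full_op: "full_subcategory (op C) H = op (full_subcategory C H)"
  by (auto simp: full_subcategory_def op_def)

lemma factoring_op: "factoring_morphisms (op C) W X Y = factoring_morphisms C W Y X"
  unfolding factoring_morphisms_def by auto

lemma mor_class_op: "mor_class (op C) W f = mor_class C W f"
  unfolding mor_class_def by (simp add: factoring_op)

lemma op_record:
  "op \<lparr>Obj = ob, Arr = ar, Dom = d, Cod = c, Id = i, Comp = m, Zero = z, Add = p\<rparr> =
   \<lparr>Obj = ob, Arr = ar, Dom = c, Cod = d, Id = i, Comp = (\<lambda>g f. m f g), Zero = (\<lambda>X Y. z Y X), Add = p\<rparr>"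
  by (simp add: op_def)

lemma quotient_op: "quotient_category (op C) W = op (quotient_category C W)"
proof -
  have "(\<Union>g\<in>G. \<Union>f\<in>F. mor_class C W (f \<cdot>\<^bsub>C\<^esub> g)) = (\<Union>f\<in>F. \<Union>g\<in>G. mor_class C W (f \<cdot>\<^bsub>C\<^esub> g))"
    for F G by blast
  then show ?thesis
    unfolding quotient_category_def op_record
    by (simp add: mor_class_op factoring_op fun_eq_iff)
qed

context preadditive_category
begin

lemma full_preadditive:
  assumes "H \<subseteq> Obj C"
  shows "preadditive_category (full_subcategory C H)"
proof -
  have "category (full_subcategory C H)"
    using assms by unfold_locales (auto simp: Hom_def)
  moreover have "comm_group (hom_group (full_subcategory C H) X Y)" if "X \<in> H" "Y \<in> H" for X Y
    using hom_comm_group[of X Y] assms that by (auto simp: hom_group_full)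
  ultimately show ?thesis
    by (intro preadditive_category.intro preadditive_category_axioms.intro) (auto simp: Hom_def)
qed

lemma full_biproduct:
  assumes "H \<subseteq> Obj C" "X1 \<in> H" "X2 \<in> H" "X \<in> H"
  shows "is_biproduct (full_subcategory C H) X1 X2 X i1 i2 p1 p2 \<longleftrightarrow> is_biproduct C X1 X2 X i1 i2 p1 p2"
  using assms by (simp add: is_biproduct_def Hom_full)

lemma full_zero_object:
  assumes "H \<subseteq> Obj C"
  shows "zero_object (full_subcategory C H) N \<longleftrightarrow> zero_object C N \<and> N \<in> H"
proof -
  interpret H: preadditive_category "full_subcategory C H" using full_preadditive assms .
  show ?thesis using assms by (auto simp: zero_object_iff H.zero_object_iff)
qed

lemma additive_class_iff: "additive_class C H \<longleftrightarrow> additive_subcategory C H"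
proof
  assume H: "additive_class C H"
  then have sub: "H \<subseteq> Obj C" by (simp add: additive_class_def)
  have "\<exists>X i1 i2 p1 p2. is_biproduct (full_subcategory C H) X1 X2 X i1 i2 p1 p2"
    if X: "X1 \<in> H" "X2 \<in> H" for X1 X2
  proof -
    obtain X i1 i2 p1 p2 where "X \<in> H" "is_biproduct C X1 X2 X i1 i2 p1 p2"
      using H X unfolding additive_class_def by blast
    then have "is_biproduct (full_subcategory C H) X1 X2 X i1 i2 p1 p2"
      using full_biproduct[OF sub] X by blast
    then show ?thesis by blast
  qed
  moreover have "\<exists>N. zero_object (full_subcategory C H) N"
    using H full_zero_object[OF sub] unfolding additive_class_def by blast
  ultimately have "additive_category (full_subcategory C H)"
    by (intro additive_category.intro additive_category_axioms.intro full_preadditive[OF sub]) simp_all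
  then show "additive_subcategory C H" using sub by (simp add: additive_subcategory_def)
next
  assume H: "additive_subcategory C H"
  then have sub: "H \<subseteq> Obj C" by (simp add: additive_subcategory_def)
  interpret H: additive_category "full_subcategory C H"
    using H by (simp add: additive_subcategory_def)
  have "\<exists>X\<in>H. \<exists>i1 i2 p1 p2. is_biproduct C X1 X2 X i1 i2 p1 p2"
    if X: "X1 \<in> H" "X2 \<in> H" for X1 X2
  proof -
    obtain X i1 i2 p1 p2 where b: "is_biproduct (full_subcategory C H) X1 X2 X i1 i2 p1 p2"
      using H.ex_biproduct[of X1 X2] X by auto
    then have "X \<in> H" using H.is_biproduct_D(15) by fastforce
    with b have "is_biproduct C X1 X2 X i1 i2 p1 p2" using full_biproduct[OF sub] X by blast
    then show ?thesis using \<open>X \<in> H\<close> by blast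
  qed
  moreover have "\<exists>N\<in>H. zero_object C N"
    using H.ex_zero_object full_zero_object[OF sub] by blast
  ultimately show "additive_class C H" using sub by (simp add: additive_class_def)
qed

end

locale ideal_quotient = additive_category +
  fixes W :: "'a set"
  assumes W_additive: "additive_class C W"
begin

abbreviation "ideal \<equiv> factoring_morphisms C W"
abbreviation "cls \<equiv> mor_class C W"
abbreviation "Q \<equiv> quotient_category C W"

lemma ideal_Zero: "\<lbrakk>X \<in> Obj C; Y \<in> Obj C\<rbrakk> \<Longrightarrow> Zero C X Y \<in> ideal X Y"
proof -
  assume X: "X \<in> Obj C" "Y \<in> Obj C"
  obtain N where N: "N \<in> W" "N \<in> Obj C" using W_additive by (auto simp: additive_class_def)
  have "Zero C N Y \<cdot> Zero C X N \<in> ideal X Y"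
    by (rule factoring_I[OF N(1)]) (use X N in auto)
  then show ?thesis using X N by simp
qed

lemma ideal_Neg:
  assumes "f \<in> ideal X Y" shows "Neg f \<in> ideal X Y"
  using assms
proof (rule factoring_E)
  fix Z g h assume k: "Z \<in> W" "f = h \<cdot> g" "g \<in> Arr C" "h \<in> Arr C" "Cod C g = Z" "Dom C h = Z"
    "Dom C g = X" "Cod C h = Y"
  have "h \<cdot> Neg g \<in> ideal X Y" by (rule factoring_I[OF k(1)]) (use k in auto)
  then show ?thesis using k by simp
qed

text \<open>Two factorisations combine through the biproduct of the intermediate objects.\<close>

lemma ideal_Add:
  assumes f: "f \<in> ideal X Y" and f': "f' \<in> ideal X Y"
  shows "f \<boxplus> f' \<in> ideal X Y"
proof -
  obtain Z g h where k: "Z \<in> W" "f = h \<cdot> g" "g \<in> Arr C" "h \<in> Arr C" "Cod C g = Z" "Dom C h = Z"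
    "Dom C g = X" "Cod C h = Y" using f by (rule factoring_E)
  obtain Z' g' h' where k': "Z' \<in> W" "f' = h' \<cdot> g'" "g' \<in> Arr C" "h' \<in> Arr C" "Cod C g' = Z'"
    "Dom C h' = Z'" "Dom C g' = X" "Cod C h' = Y" using f' by (rule factoring_E)
  obtain P i1 i2 p1 p2 where P: "P \<in> W" and b: "is_biproduct C Z Z' P i1 i2 p1 p2"
    using W_additive k(1) k'(1) unfolding additive_class_def by blast
  note B = is_biproduct_D[OF b]
  note ab = Comp_absorb[OF B(16)] Comp_absorb[OF B(17)] Comp_absorb[OF B(18)] Comp_absorb[OF B(19)]
  have "(h \<cdot> p1 \<boxplus> h' \<cdot> p2) \<cdot> (i1 \<cdot> g \<boxplus> i2 \<cdot> g') \<in> ideal X Y"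
    by (rule factoring_I[OF P]) (use k k' B in simp_all)
  moreover have "X \<in> Obj C" using k by auto
  ultimately show ?thesis using k k' B ab by simp
qed

lemma mem_cls:
  assumes f: "f \<in> Arr C"
  shows "g \<in> cls f \<longleftrightarrow> g \<in> Arr C \<and> Dom C g = Dom C f \<and> Cod C g = Cod C f \<and>
     g \<boxminus> f \<in> ideal (Dom C f) (Cod C f)"
proof
  assume "g \<in> cls f"
  then obtain h where h: "h \<in> ideal (Dom C f) (Cod C f)" "g = h \<boxplus> f"
    by (auto simp: mor_class_def r_coset_def hom_group_def)
  note H = factoring_Arr[OF h(1)]
  have "g \<boxminus> f = h" using h H f by (simp add: Add_assoc)
  then show "g \<in> Arr C \<and> Dom C g = Dom C f \<and> Cod C g = Cod C f \<and> g \<boxminus> f \<in> ideal (Dom C f) (Cod C f)"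
    using h H f by simp
next
  assume g: "g \<in> Arr C \<and> Dom C g = Dom C f \<and> Cod C g = Cod C f \<and>
    g \<boxminus> f \<in> ideal (Dom C f) (Cod C f)"
  then have "g = (g \<boxminus> f) \<boxplus> f" using f by simp
  then show "g \<in> cls f" using g
    by (auto simp: mor_class_def r_coset_def hom_group_def)
qed

lemma cls_self: "f \<in> Arr C \<Longrightarrow> f \<in> cls f"
  using ideal_Zero by (simp add: mem_cls)

lemma cls_eq:
  assumes "f \<in> Arr C" "g \<in> Arr C" "Dom C g = Dom C f" "Cod C g = Cod C f"
  shows "cls f = cls g \<longleftrightarrow> f \<boxminus> g \<in> ideal (Dom C f) (Cod C f)"
proof
  assume "cls f = cls g"
  then have "f \<in> cls g" using cls_self[of f] assms by simp
  then show "f \<boxminus> g \<in> ideal (Dom C f) (Cod C f)" using assms by (simp add: mem_cls)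
next
  assume fg: "f \<boxminus> g \<in> ideal (Dom C f) (Cod C f)"
  then have gf: "g \<boxminus> f \<in> ideal (Dom C f) (Cod C f)"
    using ideal_Neg[OF fg] assms Add_comm[of "Neg f" g] by (simp add: Neg_Add)
  show "cls f = cls g"
  proof (intro Set.set_eqI iffI)
    fix h assume "h \<in> cls f"
    then have h: "h \<in> Arr C" "Dom C h = Dom C f" "Cod C h = Cod C f"
      "h \<boxminus> f \<in> ideal (Dom C f) (Cod C f)" using assms by (auto simp: mem_cls)
    have "h \<boxminus> g = (h \<boxminus> f) \<boxplus> (f \<boxminus> g)"
      by (rule Minus_telescope[symmetric]) (use h assms in simp_all)
    then show "h \<in> cls g" using ideal_Add[OF h(4) fg] h assms by (simp add: mem_cls)
  next
    fix h assume "h \<in> cls g"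
    then have h: "h \<in> Arr C" "Dom C h = Dom C f" "Cod C h = Cod C f"
      "h \<boxminus> g \<in> ideal (Dom C f) (Cod C f)" using assms by (auto simp: mem_cls)
    have "h \<boxminus> f = (h \<boxminus> g) \<boxplus> (g \<boxminus> f)"
      by (rule Minus_telescope[symmetric]) (use h assms in simp_all)
    then show "h \<in> cls f" using ideal_Add[OF h(4) gf] h assms by (simp add: mem_cls)
  qed
qed

lemma cls_eq_Zero:
  assumes "f \<in> Arr C" "Dom C f = X" "Cod C f = Y"
  shows "cls f = cls (Zero C X Y) \<longleftrightarrow> f \<in> ideal X Y"
proof -
  have "X \<in> Obj C" "Y \<in> Obj C" using assms by auto
  then show ?thesis using cls_eq[of f "Zero C X Y"] assms by simp
qed

lemma Q_simps [simp]:
  "Obj Q = Obj C" "Arr Q = cls ` Arr C" "Id Q X = cls (Id C X)" "Zero Q X Y = ideal X Y"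
  by (simp_all add: quotient_category_def)

lemma Q_Dom_Cod [simp]:
  assumes "f \<in> Arr C"
  shows "Dom Q (cls f) = Dom C f" "Cod Q (cls f) = Cod C f"
proof -
  have "(SOME g. g \<in> cls f) \<in> cls f" using cls_self[OF assms] by (rule someI)
  then show "Dom Q (cls f) = Dom C f" "Cod Q (cls f) = Cod C f"
    using assms by (auto simp: quotient_category_def mem_cls)
qed

lemma Zero_cls:
  assumes "X \<in> Obj C" "Y \<in> Obj C"
  shows "ideal X Y = cls (Zero C X Y)"
proof -
  have "g \<in> ideal X Y \<longleftrightarrow> g \<in> cls (Zero C X Y)" for g
    using assms factoring_Arr[of g W X Y] by (auto simp: mem_cls)
  then show ?thesis by blast
qed

lemma Hom_Q: "F \<in> Hom Q X Y \<longleftrightarrow> (\<exists>f. F = cls f \<and> f \<in> Arr C \<and> Dom C f = X \<and> Cod C f = Y)"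
  by (auto simp: Hom_def)

lemma Q_Comp:
  assumes "f \<in> Arr C" "g \<in> Arr C" "Dom C g = Cod C f"
  shows "cls g \<cdot>\<^bsub>Q\<^esub> cls f = cls (g \<cdot> f)"
proof -
  have eq: "cls (g' \<cdot> f') = cls (g \<cdot> f)" if gf: "g' \<in> cls g" "f' \<in> cls f" for g' f'
  proof -
    have g': "g' \<in> Arr C" "Dom C g' = Dom C g" "Cod C g' = Cod C g" "g' \<boxminus> g \<in> ideal (Dom C g) (Cod C g)"
      and f': "f' \<in> Arr C" "Dom C f' = Dom C f" "Cod C f' = Cod C f" "f' \<boxminus> f \<in> ideal (Dom C f) (Cod C f)"
      using gf assms by (auto simp: mem_cls)
    have 1: "(g' \<boxminus> g) \<cdot> f' \<in> ideal (Dom C f) (Cod C g)"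
      by (rule factoring_Comp_right[OF g'(4)]) (use f' assms in auto)
    have 2: "g \<cdot> (f' \<boxminus> f) \<in> ideal (Dom C f) (Cod C g)"
      by (rule factoring_Comp_left[OF f'(4)]) (use assms in auto)
    have "g' \<cdot> f' \<boxminus> g \<cdot> f = (g' \<cdot> f' \<boxminus> g \<cdot> f') \<boxplus> (g \<cdot> f' \<boxminus> g \<cdot> f)"
      using Minus_telescope[of "g' \<cdot> f'" "g \<cdot> f'" "g \<cdot> f"] f' g' assms by simp
    also have "\<dots> = (g' \<boxminus> g) \<cdot> f' \<boxplus> g \<cdot> (f' \<boxminus> f)" using f' g' assms by simp
    finally show ?thesis using ideal_Add[OF 1 2] cls_eq[of "g' \<cdot> f'" "g \<cdot> f"] f' g' assms by simp
  qed
  have "cls g \<cdot>\<^bsub>Q\<^esub> cls f = (\<Union>g'\<in>cls g. \<Union>f'\<in>cls f. cls (g' \<cdot> f'))"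
    by (simp add: quotient_category_def)
  also have "\<dots> = (\<Union>g'\<in>cls g. \<Union>f'\<in>cls f. cls (g \<cdot> f))" using eq by (intro SUP_cong refl) auto
  also have "\<dots> = cls (g \<cdot> f)" using cls_self[OF assms(1)] cls_self[OF assms(2)] by auto
  finally show ?thesis .
qed

lemma Q_Add:
  assumes "f \<in> Arr C" "g \<in> Arr C" "Dom C g = Dom C f" "Cod C g = Cod C f"
  shows "cls f \<boxplus>\<^bsub>Q\<^esub> cls g = cls (f \<boxplus> g)"
proof (intro Set.set_eqI iffI)
  fix h assume "h \<in> cls f \<boxplus>\<^bsub>Q\<^esub> cls g"
  then obtain f' g' where h: "h = f' \<boxplus> g'" "f' \<in> cls f" "g' \<in> cls g"
    by (auto simp: quotient_category_def)
  then have f': "f' \<in> Arr C" "Dom C f' = Dom C f" "Cod C f' = Cod C f" "f' \<boxminus> f \<in> ideal (Dom C f) (Cod C f)"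
    and g': "g' \<in> Arr C" "Dom C g' = Dom C f" "Cod C g' = Cod C f" "g' \<boxminus> g \<in> ideal (Dom C f) (Cod C f)"
    using assms by (auto simp: mem_cls)
  have "(f' \<boxplus> g') \<boxminus> (f \<boxplus> g) = f' \<boxplus> ((g' \<boxminus> g) \<boxplus> Neg f)"
    using f' g' assms Add_comm[of "Neg f" "Neg g"] by (simp add: Neg_Add Add_assoc)
  also have "\<dots> = (f' \<boxminus> f) \<boxplus> (g' \<boxminus> g)"
    using f' g' assms Add_comm[of "Neg f" "g' \<boxminus> g"] Add_assoc[of f' "Neg f" "g' \<boxminus> g"] by simp
  finally show "h \<in> cls (f \<boxplus> g)"
    using ideal_Add[OF f'(4) g'(4)] h f' g' assms by (simp add: mem_cls)
next
  fix h assume "h \<in> cls (f \<boxplus> g)"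
  then have h: "h \<in> Arr C" "Dom C h = Dom C f" "Cod C h = Cod C f"
    "h \<boxminus> (f \<boxplus> g) \<in> ideal (Dom C f) (Cod C f)" using assms by (auto simp: mem_cls)
  have "h = (h \<boxminus> g) \<boxplus> g" using h assms by simp
  moreover have "(h \<boxminus> g) \<boxminus> f = h \<boxminus> (f \<boxplus> g)"
    using h assms Add_comm[of "Neg f" "Neg g"] by (simp add: Neg_Add Add_assoc)
  then have "h \<boxminus> g \<in> cls f" using h assms by (simp add: mem_cls)
  moreover note cls_self[OF assms(2)]
  ultimately show "h \<in> cls f \<boxplus>\<^bsub>Q\<^esub> cls g" by (auto simp: quotient_category_def)
qed

lemma Q_category: "category Q"
proof
  fix X Y Z W' F G K
  show "F \<in> Arr Q \<Longrightarrow> Dom Q F \<in> Obj Q" "F \<in> Arr Q \<Longrightarrow> Cod Q F \<in> Obj Q" by auto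
  show "X \<in> Obj Q \<Longrightarrow> Id Q X \<in> Hom Q X X" by (force simp: Hom_Q)
  show "\<lbrakk>F \<in> Hom Q X Y; G \<in> Hom Q Y Z\<rbrakk> \<Longrightarrow> G \<cdot>\<^bsub>Q\<^esub> F \<in> Hom Q X Z"
    unfolding Hom_Q by (metis Arr_Comp Q_Comp)
  show "\<lbrakk>F \<in> Hom Q W' X; G \<in> Hom Q X Y; K \<in> Hom Q Y Z\<rbrakk> \<Longrightarrow>
     K \<cdot>\<^bsub>Q\<^esub> (G \<cdot>\<^bsub>Q\<^esub> F) = K \<cdot>\<^bsub>Q\<^esub> G \<cdot>\<^bsub>Q\<^esub> F"
    by (auto simp: Hom_Q Q_Comp)
  show "F \<in> Hom Q X Y \<Longrightarrow> F \<cdot>\<^bsub>Q\<^esub> Id Q X = F" "F \<in> Hom Q X Y \<Longrightarrow> Id Q Y \<cdot>\<^bsub>Q\<^esub> F = F"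
    by (auto simp: Hom_Q Q_Comp)
qed

lemma Q_hom_group:
  assumes X: "X \<in> Obj C" "Y \<in> Obj C"
  shows "comm_group (hom_group Q X Y)"
proof (rule comm_groupI)
  let ?G = "hom_group Q X Y"
  have [simp]: "carrier ?G = Hom Q X Y" "monoid.mult ?G = Add Q" "\<one>\<^bsub>?G\<^esub> = cls (Zero C X Y)"
    using X by (simp_all add: hom_group_def Zero_cls)
  fix F G K
  show "F \<otimes>\<^bsub>?G\<^esub> G \<in> carrier ?G" if FG: "F \<in> carrier ?G" "G \<in> carrier ?G"
  proof -
    obtain f g where "F = cls f" "f \<in> Arr C" "Dom C f = X" "Cod C f = Y"
      "G = cls g" "g \<in> Arr C" "Dom C g = X" "Cod C g = Y" using FG by (auto simp: Hom_Q)
    then show ?thesis by (auto simp: Hom_Q Q_Add intro!: exI[of _ "f \<boxplus> g"])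
  qed
  show "\<one>\<^bsub>?G\<^esub> \<in> carrier ?G" using X by (auto simp: Hom_Q)
  show "\<lbrakk>F \<in> carrier ?G; G \<in> carrier ?G; K \<in> carrier ?G\<rbrakk> \<Longrightarrow>
     F \<otimes>\<^bsub>?G\<^esub> G \<otimes>\<^bsub>?G\<^esub> K = F \<otimes>\<^bsub>?G\<^esub> (G \<otimes>\<^bsub>?G\<^esub> K)"
    by (auto simp: Hom_Q Q_Add Add_assoc)
  show "\<lbrakk>F \<in> carrier ?G; G \<in> carrier ?G\<rbrakk> \<Longrightarrow> F \<otimes>\<^bsub>?G\<^esub> G = G \<otimes>\<^bsub>?G\<^esub> F"
    using Add_comm by (auto simp: Hom_Q Q_Add)
  show "F \<in> carrier ?G \<Longrightarrow> \<one>\<^bsub>?G\<^esub> \<otimes>\<^bsub>?G\<^esub> F = F"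
    using X by (auto simp: Hom_Q Q_Add)
  show "\<exists>G\<in>carrier ?G. G \<otimes>\<^bsub>?G\<^esub> F = \<one>\<^bsub>?G\<^esub>" if F: "F \<in> carrier ?G"
  proof -
    obtain f where "F = cls f" "f \<in> Arr C" "Dom C f = X" "Cod C f = Y" using F by (auto simp: Hom_Q)
    then have "cls (Neg f) \<in> carrier ?G" "cls (Neg f) \<otimes>\<^bsub>?G\<^esub> F = \<one>\<^bsub>?G\<^esub>"
      by (auto simp: Hom_Q Q_Add intro!: exI[of _ "Neg f"])
    then show ?thesis by blast
  qed
qed

lemma Q_preadditive: "preadditive_category Q"
proof (intro preadditive_category.intro preadditive_category_axioms.intro Q_category)
  fix X Y Z F G K
  show "X \<in> Obj Q \<Longrightarrow> Y \<in> Obj Q \<Longrightarrow> comm_group (hom_group Q X Y)" using Q_hom_group by simp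
  show "\<lbrakk>F \<in> Hom Q X Y; G \<in> Hom Q X Y; K \<in> Hom Q Y Z\<rbrakk> \<Longrightarrow>
     K \<cdot>\<^bsub>Q\<^esub> (F \<boxplus>\<^bsub>Q\<^esub> G) = K \<cdot>\<^bsub>Q\<^esub> F \<boxplus>\<^bsub>Q\<^esub> K \<cdot>\<^bsub>Q\<^esub> G"
    by (auto simp: Hom_Q Q_Add Q_Comp)
  show "\<lbrakk>F \<in> Hom Q X Y; G \<in> Hom Q Y Z; K \<in> Hom Q Y Z\<rbrakk> \<Longrightarrow>
     (G \<boxplus>\<^bsub>Q\<^esub> K) \<cdot>\<^bsub>Q\<^esub> F = G \<cdot>\<^bsub>Q\<^esub> F \<boxplus>\<^bsub>Q\<^esub> K \<cdot>\<^bsub>Q\<^esub> F"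
    by (auto simp: Hom_Q Q_Add Q_Comp)
qed

lemma Q_additive: "additive_category Q"
proof -
  interpret Q: preadditive_category Q by (rule Q_preadditive)
  have "\<exists>N. zero_object Q N"
  proof -
    obtain N where "zero_object C N" using ex_zero_object by blast
    then have "N \<in> Obj C" "Id C N = Zero C N N" by (auto simp: zero_object_iff)
    then have "zero_object Q N" by (simp add: Q.zero_object_iff Zero_cls)
    then show ?thesis by blast
  qed
  moreover have "\<exists>X i1 i2 p1 p2. is_biproduct Q X1 X2 X i1 i2 p1 p2"
    if X: "X1 \<in> Obj Q" "X2 \<in> Obj Q" for X1 X2
  proof -
    obtain X i1 i2 p1 p2 where b: "is_biproduct C X1 X2 X i1 i2 p1 p2"
      using ex_biproduct[of X1 X2] X by auto
    note B = is_biproduct_D[OF b]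
    have "is_biproduct Q X1 X2 X (cls i1) (cls i2) (cls p1) (cls p2)"
      unfolding is_biproduct_def using B by (auto simp: Hom_Q Q_Comp Q_Add Zero_cls)
    then show ?thesis by blast
  qed
  ultimately show ?thesis
    by (intro additive_category.intro additive_category_axioms.intro Q_preadditive)
qed

end

section \<open>The heart\<close>

text \<open>Extensions along \<open>c\<close> exist on the nose for representatives, whereas their uniqueness holds only
  modulo the ideal.\<close>

lemma (in ideal_quotient) Q_cokernel_I:
  assumes f: "f \<in> Arr C" and c: "c \<in> Arr C" "Dom C c = Cod C f" "c \<cdot> f \<in> ideal (Dom C f) (Cod C c)"
    and ext: "\<And>Y g. g \<in> Hom C (Cod C f) Y \<Longrightarrow> g \<cdot> f \<in> ideal (Dom C f) Y \<Longrightarrow>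
       \<exists>h\<in>Hom C (Cod C c) Y. h \<cdot> c = g"
    and refl: "\<And>Y h. h \<in> Hom C (Cod C c) Y \<Longrightarrow> h \<cdot> c \<in> ideal (Cod C f) Y \<Longrightarrow> h \<in> ideal (Cod C c) Y"
  shows "is_cokernel_of Q (cls c) (cls f)"
proof -
  interpret Q: preadditive_category Q by (rule Q_preadditive)
  show ?thesis
  proof (rule Q.is_cokernel_of_I)
    show "cls c \<in> Arr Q" "cls f \<in> Arr Q" "Dom Q (cls c) = Cod Q (cls f)" using f c by simp_all
    show "cls c \<cdot>\<^bsub>Q\<^esub> cls f = Zero Q (Dom Q (cls f)) (Cod Q (cls c))"
      using f c by (simp add: Q_Comp Zero_cls cls_eq_Zero)
  next
    fix G assume "G \<in> Arr Q" "Dom Q G = Cod Q (cls f)"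
      "G \<cdot>\<^bsub>Q\<^esub> cls f = Zero Q (Dom Q (cls f)) (Cod Q G)"
    then obtain g where g: "G = cls g" "g \<in> Arr C" "Dom C g = Cod C f"
      "cls (g \<cdot> f) = cls (Zero C (Dom C f) (Cod C g))"
      using f by (auto simp: Q_Comp Zero_cls)
    then have "g \<cdot> f \<in> ideal (Dom C f) (Cod C g)" using f by (simp add: cls_eq_Zero)
    then obtain h where h: "h \<in> Hom C (Cod C c) (Cod C g)" "h \<cdot> c = g"
      using ext[of g "Cod C g"] g by (auto simp: Hom_def)
    then have "cls h \<cdot>\<^bsub>Q\<^esub> cls c = G" "cls h \<in> Hom Q (Cod Q (cls c)) (Cod Q G)"
      using g c by (auto simp: Hom_def Q_Comp)
    then show "\<exists>w\<in>Hom Q (Cod Q (cls c)) (Cod Q G). w \<cdot>\<^bsub>Q\<^esub> cls c = G" by blast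
  next
    fix G G' assume "G \<in> Arr Q" "G' \<in> Arr Q" "Dom Q G = Cod Q (cls c)" "Dom Q G' = Cod Q (cls c)"
      "Cod Q G' = Cod Q G" and eq: "G \<cdot>\<^bsub>Q\<^esub> cls c = G' \<cdot>\<^bsub>Q\<^esub> cls c"
    then obtain g g' where g: "G = cls g" "G' = cls g'" "g \<in> Arr C" "g' \<in> Arr C"
      "Dom C g = Cod C c" "Dom C g' = Cod C c" "Cod C g' = Cod C g" using c by auto
    have "cls (g \<cdot> c) = cls (g' \<cdot> c)" using eq g c by (simp add: Q_Comp)
    then have "(g \<boxminus> g') \<cdot> c \<in> ideal (Cod C f) (Cod C g)"
      using cls_eq[of "g \<cdot> c" "g' \<cdot> c"] g c f by simp
    then have "g \<boxminus> g' \<in> ideal (Cod C c) (Cod C g)"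
      by (rule refl[rotated]) (use g in \<open>simp add: Hom_def\<close>)
    then show "G = G'" using cls_eq[of g g'] g by simp
  qed
qed

context twin_cotorsion
begin

lemma B_minus_dual: "B_minus (op C) (E\<inverse>) (U \<inter> T) V = Bplus"
  unfolding B_minus_def B_plus_def by (simp add: Int_commute) blast

lemma B_plus_dual: "B_plus (op C) (E\<inverse>) (U \<inter> T) S = Bminus"
  unfolding B_minus_def B_plus_def by (simp add: Int_commute) blast

text \<open>Kernels and the dual semi-abelian condition in the heart are cokernels and the original condition
  in the heart of the opposite twin cotorsion pair.\<close>

lemma heart_dual: "heart (op C) (E\<inverse>) V U T S = op (heart C E S T U V)"
  unfolding heart_def Let_def B_minus_dual B_plus_dual full_op quotient_op
  by (simp add: Int_commute)

lemma W_additive: "additive_class C (T \<inter> U)"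
proof -
  obtain N where N: "zero_object C N" using ex_zero_object by blast
  have "N \<in> T \<inter> U" using zero_object_in_class additive_classes summand_closed N by blast
  moreover have "\<exists>X\<in>T \<inter> U. \<exists>i1 i2 p1 p2. is_biproduct C X1 X2 X i1 i2 p1 p2"
    if X: "X1 \<in> T \<inter> U" "X2 \<in> T \<inter> U" for X1 X2
  proof -
    have "X1 \<in> Obj C" "X2 \<in> Obj C" using additive_classes(2) X by (auto simp: additive_class_def)
    then obtain Y i1 i2 p1 p2 where b: "is_biproduct C X1 X2 Y i1 i2 p1 p2"
      using ex_biproduct by blast
    have "Y \<in> T" by (rule biproduct_in_class[OF additive_classes(2) summand_closed(2) _ _ b]) (use X in auto)
    moreover have "Y \<in> U" by (rule biproduct_in_class[OF additive_classes(3) summand_closed(3) _ _ b]) (use X in auto)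
    ultimately show ?thesis using b by blast
  qed
  ultimately show ?thesis
    using additive_classes(2) N unfolding additive_class_def by blast
qed

abbreviation "H \<equiv> Bplus \<inter> Bminus"

lemma W_sub_H: "T \<inter> U \<subseteq> H"
proof
  interpret dual: twin_cotorsion "op C" "E\<inverse>" V U T S by (rule twin_dual)
  fix X assume "X \<in> T \<inter> U"
  then show "X \<in> H" using W_sub_Bminus[of X] dual.W_sub_Bminus[of X] by (simp add: B_minus_dual)
qed

lemma H_additive: "additive_class C H"
proof -
  interpret dual: twin_cotorsion "op C" "E\<inverse>" V U T S by (rule twin_dual)
  have sub: "H \<subseteq> Obj C" by (auto simp: B_plus_def)
  have "\<exists>X\<in>H. \<exists>i1 i2 p1 p2. is_biproduct C X1 X2 X i1 i2 p1 p2" if X: "X1 \<in> H" "X2 \<in> H" for X1 X2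
  proof -
    obtain Y i1 i2 p1 p2 where b: "is_biproduct C X1 X2 Y i1 i2 p1 p2"
      using ex_biproduct[of X1 X2] X sub by blast
    have "Y \<in> Bminus" using Bminus_biproduct[OF _ _ b] X by blast
    moreover have "Y \<in> Bplus"
      using dual.Bminus_biproduct[of X1 X2 Y p1 p2 i1 i2] X b by (simp add: B_minus_dual)
    ultimately show ?thesis using b by blast
  qed
  moreover have "\<exists>N\<in>H. zero_object C N"
    using W_additive W_sub_H unfolding additive_class_def by blast
  ultimately show ?thesis using sub unfolding additive_class_def by blast
qed

lemma heart_quotient: "ideal_quotient (full_subcategory C H) (T \<inter> U)"
proof (intro ideal_quotient.intro ideal_quotient_axioms.intro)
  have sub: "H \<subseteq> Obj C" using H_additive by (simp add: additive_class_def)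
  show add: "additive_category (full_subcategory C H)"
    using H_additive by (simp add: additive_class_iff additive_subcategory_def)
  have "\<exists>X\<in>T \<inter> U. \<exists>i1 i2 p1 p2. is_biproduct (full_subcategory C H) X1 X2 X i1 i2 p1 p2"
    if X: "X1 \<in> T \<inter> U" "X2 \<in> T \<inter> U" for X1 X2
  proof -
    obtain Y i1 i2 p1 p2 where Y: "Y \<in> T \<inter> U" "is_biproduct C X1 X2 Y i1 i2 p1 p2"
      using W_additive X unfolding additive_class_def by blast
    then have "is_biproduct (full_subcategory C H) X1 X2 Y i1 i2 p1 p2"
      using full_biproduct[OF sub] W_sub_H X by blast
    then show ?thesis using Y by blast
  qed
  moreover have "\<exists>N\<in>T \<inter> U. zero_object (full_subcategory C H) N"
    using W_additive full_zero_object[OF sub] W_sub_H unfolding additive_class_def by blast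
  ultimately show "additive_class (full_subcategory C H) (T \<inter> U)"
    using W_sub_H unfolding additive_class_def by simp
qed

abbreviation "Heart \<equiv> heart C E S T U V"

lemma Heart_eq: "Heart = quotient_category (full_subcategory C H) (T \<inter> U)"
  by (simp add: heart_def Let_def)

abbreviation "hcls \<equiv> mor_class (full_subcategory C H) (T \<inter> U)"

lemma Neg_full:
  assumes "f \<in> Arr C" "Dom C f \<in> H" "Cod C f \<in> H"
  shows "preadditive_category.Neg (full_subcategory C H) f = Neg f"
proof -
  interpret HQ: ideal_quotient "full_subcategory C H" "T \<inter> U" by (rule heart_quotient)
  show ?thesis using assms by (simp add: HQ.Neg_def Neg_def hom_group_full del: Int_iff)
qed

lemma ideal_eq: "X \<in> H \<Longrightarrow> Y \<in> H \<Longrightarrow>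
    factoring_morphisms (full_subcategory C H) (T \<inter> U) X Y = fac X Y"
  using factoring_full[OF W_sub_H] .

text \<open>The representing inflation with cokernel in \<open>S\<close> is part of the statement because the argument
  for pullbacks starts from such a representative of a cokernel.\<close>

lemma heart_cokernel:
  assumes A: "A \<in> H" and B: "B \<in> H" and f: "f \<in> Hom C A B"
  obtains K c q S1 where "K \<in> H" "S1 \<in> S" "ses B c K q S1" "is_cokernel_of Heart (hcls c) (hcls f)"
proof -
  interpret HQ: ideal_quotient "full_subcategory C H" "T \<inter> U" by (rule heart_quotient)
  obtain K c q S1 where K: "K \<in> Bplus" "K \<in> Bminus" "S1 \<in> S" "ses B c K q S1" "c \<cdot> f \<in> fac A K"
    and ext: "\<And>Y g. \<lbrakk>Y \<in> Bplus; g \<in> Hom C B Y; g \<cdot> f \<in> fac A Y\<rbrakk> \<Longrightarrow> \<exists>h\<in>Hom C K Y. h \<cdot> c = g"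
    using A B f by (rule_tac weak_cokernel[of A B f]) auto
  have KH: "K \<in> H" using K by simp
  note D = ses_D[OF K(4)] f[THEN Hom_D]
  have "is_cokernel_of HQ.Q (hcls c) (hcls f)"
  proof (rule HQ.Q_cokernel_I)
    show "f \<in> Arr (full_subcategory C H)" "c \<in> Arr (full_subcategory C H)"
      "Dom (full_subcategory C H) c = Cod (full_subcategory C H) f" using D A B KH by auto
    show "c \<cdot>\<^bsub>full_subcategory C H\<^esub> f \<in> factoring_morphisms (full_subcategory C H) (T \<inter> U)
        (Dom (full_subcategory C H) f) (Cod (full_subcategory C H) c)"
      using K(5) D by (simp add: ideal_eq[OF A KH])
  next
    fix Y g assume g: "g \<in> Hom (full_subcategory C H) (Cod (full_subcategory C H) f) Y"
      and gf: "g \<cdot>\<^bsub>full_subcategory C H\<^esub> f \<in> factoring_morphisms (full_subcategory C H) (T \<inter> U)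
        (Dom (full_subcategory C H) f) Y"
    have Y: "Y \<in> H" "g \<in> Hom C B Y" using g D by (auto simp: Hom_def)
    then have "g \<cdot> f \<in> fac A Y" using gf D by (simp add: ideal_eq[OF A Y(1)])
    then obtain h where "h \<in> Hom C K Y" "h \<cdot> c = g" using ext[of Y g] Y by blast
    then show "\<exists>h\<in>Hom (full_subcategory C H) (Cod (full_subcategory C H) c) Y.
        h \<cdot>\<^bsub>full_subcategory C H\<^esub> c = g"
      using D KH Y by (intro bexI[of _ h]) (auto simp: Hom_def)
  next
    fix Y h assume h: "h \<in> Hom (full_subcategory C H) (Cod (full_subcategory C H) c) Y"
      and hc: "h \<cdot>\<^bsub>full_subcategory C H\<^esub> c \<in> factoring_morphisms (full_subcategory C H) (T \<inter> U)
        (Cod (full_subcategory C H) f) Y"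
    have Y: "Y \<in> H" "h \<in> Hom C K Y" using h D by (auto simp: Hom_def)
    then have "h \<cdot> c \<in> fac B Y" using hc D by (simp add: ideal_eq[OF B Y(1)])
    then have "h \<in> fac K Y" using factoring_reflected[OF K(4,3) _ Y(2)] Y(1) by blast
    then show "h \<in> factoring_morphisms (full_subcategory C H) (T \<inter> U) (Cod (full_subcategory C H) c) Y"
      using D by (simp add: ideal_eq[OF KH Y(1)])
  qed
  then show ?thesis using that[OF KH K(3,4)] by (simp add: Heart_eq)
qed

lemma heart_additive: "additive_category Heart"
proof -
  interpret HQ: ideal_quotient "full_subcategory C H" "T \<inter> U" by (rule heart_quotient)
  show ?thesis unfolding Heart_eq by (rule HQ.Q_additive)
qed

lemma Heart_Arr_E:
  assumes "F \<in> Arr Heart"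
  obtains f where "F = hcls f" "f \<in> Arr C" "Dom C f = Dom Heart F" "Cod C f = Cod Heart F"
    "Dom Heart F \<in> H" "Cod Heart F \<in> H"
proof -
  interpret HQ: ideal_quotient "full_subcategory C H" "T \<inter> U" by (rule heart_quotient)
  obtain f where f: "F = hcls f" "f \<in> Arr (full_subcategory C H)"
    using assms unfolding Heart_eq HQ.Q_simps by blast
  have D: "Dom Heart F = Dom C f" "Cod Heart F = Cod C f"
    using HQ.Q_Dom_Cod[OF f(2)] by (simp_all only: Heart_eq f(1) full_simps)
  have "f \<in> Arr C" "Dom C f \<in> H" "Cod C f \<in> H" using f(2) by simp_all
  then show ?thesis using that[of f] D f(1) by metis
qed

lemma heart_has_cokernels:
  assumes "F \<in> Arr Heart"
  shows "\<exists>c. is_cokernel_of Heart c F"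
proof -
  obtain f where f: "F = hcls f" "f \<in> Arr C" "Dom C f = Dom Heart F" "Cod C f = Cod Heart F"
    "Dom Heart F \<in> H" "Cod Heart F \<in> H" using assms by (rule Heart_Arr_E)
  have "f \<in> Hom C (Dom Heart F) (Cod Heart F)" using f by (simp add: Hom_def)
  then obtain K c q S1 where "is_cokernel_of Heart (hcls c) (hcls f)"
    by (rule heart_cokernel[OF f(5,6)])
  then show ?thesis using f by blast
qed

text \<open>Replacing the cokernel \<open>d\<close> by an isomorphic one, represented by an inflation with cokernel in
  \<open>S\<close>, the cover constructed above maps to the pullback; the composite of this map with \<open>a\<close> is already
  an epimorphism, hence so is \<open>a\<close>.\<close>

lemma heart_pullback_epi:
  assumes pb: "is_pullback Heart a b c d" and d: "is_cokernel Heart d"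
  shows "is_epi Heart a"
proof -
  interpret HQ: ideal_quotient "full_subcategory C H" "T \<inter> U" by (rule heart_quotient)
  interpret Q: additive_category Heart by (rule heart_additive)
  let ?D = "full_subcategory C H"
  obtain F where F: "is_cokernel_of Heart d F" using d by (auto simp: is_cokernel_def)
  have FA: "F \<in> Arr Heart" "d \<in> Arr Heart" "Dom Heart d = Cod Heart F"
    using F by (auto simp: is_cokernel_of_def)
  have sq: "a \<in> Arr Heart" "b \<in> Arr Heart" "c \<in> Arr Heart" "Dom Heart a = Dom Heart b"
    "Cod Heart a = Dom Heart c" "Cod Heart b = Dom Heart d" "Cod Heart c = Cod Heart d"
    using pb by (auto simp: is_pullback_def commutative_square_def)
  obtain f where f: "F = hcls f" "f \<in> Arr C" "Dom C f = Dom Heart F" "Cod C f = Cod Heart F"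
    "Dom Heart F \<in> H" "Cod Heart F \<in> H" using FA(1) by (rule Heart_Arr_E)
  define A where "A = Cod Heart F"
  have A: "A \<in> H" "Dom Heart d = A" using f FA by (simp_all add: A_def)
  have fA: "f \<in> Hom C (Dom Heart F) A" using f by (simp add: Hom_def A_def)
  obtain K k q S1 where K: "K \<in> H" "S1 \<in> S" "ses A k K q S1"
    and "is_cokernel_of Heart (hcls k) (hcls f)"
    by (rule heart_cokernel[OF f(5) A(1) fA])
  then have ck: "is_cokernel_of Heart (hcls k) F" by (simp only: f(1)[symmetric])
  note D = ses_D[OF K(3)]
  have k: "k \<in> Arr ?D" using D K A by simp
  have kH: "hcls k \<in> Arr Heart" "Dom Heart (hcls k) = A" "Cod Heart (hcls k) = K"
    using HQ.Q_Dom_Cod[OF k] k D(3,4) unfolding Heart_eq HQ.Q_simps full_simps(3,4)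
    by (simp_all only: imageI)
  obtain \<phi> where phi: "is_iso Heart \<phi>" "\<phi> \<in> Hom Heart K (Cod Heart d)" "\<phi> \<cdot>\<^bsub>Heart\<^esub> hcls k = d"
    using Q.cokernel_iso[OF ck F] kH by metis
  then obtain \<psi> where psi: "\<psi> \<in> Hom Heart (Cod Heart d) K" "\<phi> \<cdot>\<^bsub>Heart\<^esub> \<psi> = Id Heart (Cod Heart d)"
    using Q.is_iso_inverse[OF phi(1)] by (metis Q.Hom_D)
  note PP = phi(2)[THEN Q.Hom_D] psi(1)[THEN Q.Hom_D]
  define B where "B = Dom Heart c"
  have "\<psi> \<cdot>\<^bsub>Heart\<^esub> c \<in> Arr Heart" "Dom Heart (\<psi> \<cdot>\<^bsub>Heart\<^esub> c) = B" "Cod Heart (\<psi> \<cdot>\<^bsub>Heart\<^esub> c) = K"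
    using PP sq by (simp_all add: B_def)
  then obtain g where g: "\<psi> \<cdot>\<^bsub>Heart\<^esub> c = hcls g" "g \<in> Arr C" "Dom C g = B" "Cod C g = K" "B \<in> H"
    using Heart_Arr_E by metis
  have gH: "g \<in> Hom C B K" using g by (simp add: Hom_def)
  obtain X e e' where X: "X \<in> Bplus" "X \<in> Bminus" "e \<in> Hom C X B" "e' \<in> Hom C X A"
    "g \<cdot> e \<boxminus> k \<cdot> e' \<in> fac X K"
    and epi: "\<And>Y y. \<lbrakk>Y \<in> Bplus; y \<in> Hom C B Y; y \<cdot> e \<in> fac X Y\<rbrakk> \<Longrightarrow> y \<in> fac B Y"
    by (rule epi_cover_of_pullback[OF K(3,2) _ _ _ _ gH]) (use A K g in auto)
  have XH: "X \<in> H" using X by simp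
  have EE: "e \<in> Arr C" "Dom C e = X" "Cod C e = B" "e' \<in> Arr C" "Dom C e' = X" "Cod C e' = A"
    using X by (auto simp: Hom_def)
  have arr: "e \<in> Arr ?D" "e' \<in> Arr ?D" "g \<in> Arr ?D" using EE g XH A K by simp_all
  have eH: "hcls e \<in> Hom Heart X B" "hcls e' \<in> Hom Heart X A" "hcls g \<in> Hom Heart B K"
    using arr EE g unfolding Heart_eq HQ.Hom_Q by auto
  note EH = eH[THEN Q.Hom_D]
  have "hcls (g \<cdot> e) = hcls (k \<cdot> e')"
  proof -
    have "preadditive_category.Neg ?D (k \<cdot> e') = Neg (k \<cdot> e')"
      by (rule Neg_full) (use EE D XH K in simp_all)
    then show ?thesis
      using HQ.cls_eq[of "g \<cdot> e" "k \<cdot> e'"] X(5) EE g D XH K ideal_eq[OF XH K(1)] by simp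
  qed
  moreover have "hcls g \<cdot>\<^bsub>Heart\<^esub> hcls e = hcls (g \<cdot> e)" "hcls k \<cdot>\<^bsub>Heart\<^esub> hcls e' = hcls (k \<cdot> e')"
    using HQ.Q_Comp[OF arr(1,3)] HQ.Q_Comp[OF arr(2) k] EE g D by (simp_all add: Heart_eq)
  ultimately have comm: "hcls g \<cdot>\<^bsub>Heart\<^esub> hcls e = hcls k \<cdot>\<^bsub>Heart\<^esub> hcls e'" by simp
  have "c \<cdot>\<^bsub>Heart\<^esub> hcls e = (\<phi> \<cdot>\<^bsub>Heart\<^esub> \<psi>) \<cdot>\<^bsub>Heart\<^esub> (c \<cdot>\<^bsub>Heart\<^esub> hcls e)"
    using psi(2) sq EH by (simp add: B_def)
  also have "\<dots> = \<phi> \<cdot>\<^bsub>Heart\<^esub> ((\<psi> \<cdot>\<^bsub>Heart\<^esub> c) \<cdot>\<^bsub>Heart\<^esub> hcls e)"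
    using PP sq EH by (simp add: B_def)
  also have "\<dots> = \<phi> \<cdot>\<^bsub>Heart\<^esub> (hcls k \<cdot>\<^bsub>Heart\<^esub> hcls e')" by (simp only: g(1) comm)
  also have "\<dots> = d \<cdot>\<^bsub>Heart\<^esub> hcls e'"
    using Q.Comp_absorb[OF phi(3), of "hcls e'"] PP kH EH by simp
  finally have "c \<cdot>\<^bsub>Heart\<^esub> hcls e = d \<cdot>\<^bsub>Heart\<^esub> hcls e'" .
  moreover have "hcls e \<in> Hom Heart X (Dom Heart c)" "hcls e' \<in> Hom Heart X (Dom Heart d)"
    using eH A by (simp_all add: B_def)
  ultimately obtain x where x: "x \<in> Hom Heart X (Dom Heart a)" "a \<cdot>\<^bsub>Heart\<^esub> x = hcls e"
    using pb unfolding is_pullback_def by blast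
  note XX = x(1)[THEN Q.Hom_D]
  have "u = v" if uv: "u \<in> Hom Heart (Cod Heart a) Y" "v \<in> Hom Heart (Cod Heart a) Y"
    "u \<cdot>\<^bsub>Heart\<^esub> a = v \<cdot>\<^bsub>Heart\<^esub> a" for Y u v
  proof -
    note UV = uv(1,2)[THEN Q.Hom_D]
    have UB: "Dom Heart u = B" "Dom Heart v = B" using UV sq by (simp_all add: B_def)
    obtain y where y: "u = hcls y" "y \<in> Arr C" "Dom C y = B" "Cod C y = Y" "Y \<in> H"
      using Heart_Arr_E[of u] UV UB by metis
    obtain z where z: "v = hcls z" "z \<in> Arr C" "Dom C z = B" "Cod C z = Y"
      using Heart_Arr_E[of v] UV UB by metis
    have yz: "y \<in> Arr ?D" "z \<in> Arr ?D" using y z g by simp_all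
    have "u \<cdot>\<^bsub>Heart\<^esub> hcls e = (u \<cdot>\<^bsub>Heart\<^esub> a) \<cdot>\<^bsub>Heart\<^esub> x" using UV XX sq x(2) by simp
    also have "\<dots> = v \<cdot>\<^bsub>Heart\<^esub> hcls e" using UV XX sq x(2) by (simp add: uv(3))
    finally have "hcls (y \<cdot> e) = hcls (z \<cdot> e)"
      using HQ.Q_Comp[OF arr(1) yz(1)] HQ.Q_Comp[OF arr(1) yz(2)] y z EE by (simp add: Heart_eq)
    moreover have "preadditive_category.Neg ?D (z \<cdot> e) = Neg (z \<cdot> e)"
      "preadditive_category.Neg ?D z = Neg z"
      by (rule Neg_full; use EE y z XH g in simp)+
    ultimately have "y \<cdot> e \<boxminus> z \<cdot> e \<in> fac X Y"
      using HQ.cls_eq[of "y \<cdot> e" "z \<cdot> e"] EE y z XH ideal_eq[OF XH y(5)] by simp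
    then have "(y \<boxminus> z) \<cdot> e \<in> fac X Y" using y z EE by simp
    then have "y \<boxminus> z \<in> fac B Y"
      using epi[of Y "y \<boxminus> z"] y z by (simp add: Hom_def)
    then have "hcls y = hcls z"
      using HQ.cls_eq[OF yz] \<open>preadditive_category.Neg ?D z = Neg z\<close> y z ideal_eq[OF g(5) y(5)] by simp
    then show ?thesis using y z by simp
  qed
  then show ?thesis using sq(1) unfolding is_epi_def by blast
qed

theorem heart_semi_abelian: "semi_abelian Heart"
proof -
  interpret dual: twin_cotorsion "op C" "E\<inverse>" V U T S by (rule twin_dual)
  have pre: "preabelian Heart"
    unfolding preabelian_def
  proof (intro conjI ballI heart_additive heart_has_cokernels)
    fix f assume "f \<in> Arr Heart"
    then show "\<exists>k. is_kernel_of Heart k f"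
      using dual.heart_has_cokernels[of f] by (simp add: heart_dual)
  qed
  have "is_mono Heart d" if po: "is_pushout Heart a b c d" and a: "is_kernel Heart a" for a b c d
  proof -
    have "is_pullback (op Heart) d c b a"
      using is_pushout_op[of "op Heart" b a d c] is_pushout_swap[OF po] by simp
    moreover have "is_cokernel (op Heart) a" using a by (simp add: is_cokernel_def is_kernel_def)
    ultimately have "is_epi (op Heart) d"
      using dual.heart_pullback_epi[of d c b a] by (simp add: heart_dual)
    then show ?thesis using is_mono_op[of "op Heart" d] by simp
  qed
  then show ?thesis
    using pre heart_pullback_epi
    unfolding semi_abelian_def left_semi_abelian_def right_semi_abelian_def by blast
qed

end

section \<open>From cotorsion pairs to splittings\<close>

text \<open>Every extension lies in its own class, which must be the class of the split extensions.\<close>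

lemma Ext1_trivial_splits:
  assumes "exact_category C E" "\<forall>X\<in>U. \<forall>Y\<in>V. Ext1 C E X Y = {Ext1_zero C E X Y}"
  shows "ext_orthogonal C E U V"
  unfolding ext_orthogonal_def
proof (intro ballI allI impI)
  interpret exact_category C E by fact
  fix Z X f M g assume Z: "Z \<in> U" and X: "X \<in> V" and s: "short_exact C E X f M g Z"
  note D = ses_D[OF s]
  have fg: "(f, g) \<in> extensions C E Z X" using s by (auto simp: extensions_def)
  have "((f, g), (f, g)) \<in> ext_equiv C E Z X"
  proof -
    have "\<exists>h\<in>Hom C (Cod C f) (Cod C f). h \<cdot>\<^bsub>C\<^esub> f = f \<and> g \<cdot>\<^bsub>C\<^esub> h = g"
      using D by (intro bexI[of _ "Id C (Cod C f)"]) (simp_all add: Hom_def)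
    then show ?thesis using fg unfolding ext_equiv_def by simp
  qed
  then have "(f, g) \<in> ext_equiv C E Z X `` {(f, g)}" by simp
  moreover have "ext_equiv C E Z X `` {(f, g)} \<in> Ext1 C E Z X"
    using fg unfolding Ext1_def by (rule quotientI)
  then have "ext_equiv C E Z X `` {(f, g)} = Ext1_zero C E Z X" using assms(2) Z X by simp
  ultimately obtain Y i p where "is_biproduct C X Z Y f i p g" by (auto simp: Ext1_zero_def)
  moreover from is_biproduct_D(3)[OF this] have "Y = M" using D by simp
  ultimately show "\<exists>s r. is_biproduct C X Z M f s r g" by blast
qed

lemma cotorsion_pair_D:
  assumes "cotorsion_pair C E U V"
  shows "additive_subcategory C U" "closed_under_direct_summands C U"
    "additive_subcategory C V" "closed_under_direct_summands C V"
    "\<forall>X\<in>U. \<forall>Y\<in>V. Ext1 C E X Y = {Ext1_zero C E X Y}"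
    "\<forall>B\<in>Obj C. \<exists>V1\<in>V. \<exists>U1\<in>U. \<exists>f g. short_exact C E V1 f U1 g B"
    "\<forall>B\<in>Obj C. \<exists>V1\<in>V. \<exists>U1\<in>U. \<exists>f g. short_exact C E B f V1 g U1"
  using assms by (simp_all add: cotorsion_pair_def)

text \<open>An object of \<open>V\<close> is a direct summand of its embedding into \<open>T\<close>, because the cokernel lies in
  \<open>S\<close> and hence in \<open>U\<close>.\<close>

lemma twin_cotorsion_I:
  assumes "exact_category C E" "twin_cotorsion_pair C E S T U V"
  shows "twin_cotorsion C E S T U V"
proof -
  interpret exact_category C E by fact
  have cp: "cotorsion_pair C E S T" "cotorsion_pair C E U V" "S \<subseteq> U"
    using assms(2) by (auto simp: twin_cotorsion_pair_def)
  note D = cotorsion_pair_D[OF cp(1)] and D' = cotorsion_pair_D[OF cp(2)]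
  have ST: "ext_orthogonal C E S T" and UV: "ext_orthogonal C E U V"
    using Ext1_trivial_splits[OF assms(1)] D(5) D'(5) by simp_all
  have "Y \<in> T" if Y: "Y \<in> V" for Y
  proof -
    have YO: "Y \<in> Obj C" using D'(3) Y by (auto simp: additive_subcategory_def)
    obtain T1 S1 f g where a: "T1 \<in> T" "S1 \<in> S" "ses Y f T1 g S1"
      using bspec[OF D(7) YO] by blast
    then obtain s r where b: "is_biproduct C Y S1 T1 f s r g"
      using UV Y cp(3) unfolding ext_orthogonal_def by blast
    show ?thesis
      using D(4) a(1) b is_biproduct_D(13,14)[OF b] unfolding closed_under_direct_summands_def by blast
  qed
  then have VT: "V \<subseteq> T" by blast
  show ?thesis
    by (intro twin_cotorsion.intro twin_cotorsion_axioms.intro assms(1) ST UV cp(3) VT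
        D(2,4) D'(2,4) D(1,3)[folded additive_class_iff] D'(1,3)[folded additive_class_iff]
        D(6,7)[THEN bspec] D'(6,7)[THEN bspec])
qed

theorem theorem5p6:
  fixes C :: "('o, 'm) addcat"
    and E :: "('m \<times> 'm) set"
    and S T U V :: "'o set"
  assumes "exact_category C E"
    and "krull_schmidt C"
    and "enough_projectives C E"
    and "enough_injectives C E"
    and "twin_cotorsion_pair C E S T U V"
  shows "semi_abelian (heart C E S T U V)"
  using twin_cotorsion.heart_semi_abelian[OF twin_cotorsion_I[OF assms(1,5)]] .

end
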